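(* Fix an o-minimal structure $\mathcal{S}$ over $\mathbb{R}$ that contains all semialgebraic sets. Let $m$ and $n$ be positive integers, let $Z\subseteq \mathbb{R}^{m+n}$ be a definable family, and suppose that for every $T\in\mathbb{R}^m$ the fiber $Z_T=\{x\in\mathbb{R}^n:(T,x)\in Z\}$ is bounded. Then there exists a constant $c_Z\in\mathbb{R}$, depending only on the family $Z$, such that for every $T\in\mathbb{R}^m$ and every lattice $\Lambda\subseteq\mathbb{R}^n$ with successive minima $\lambda_1,\ldots,\lambda_n$, $$\left||Z_T\cap \Lambda|-\frac{\mathrm{Vol}(Z_T)}{\det \Lambda}\right|\leq c_{Z}\sum_{j=0}^{n-1}\frac{V_j(Z_T)}{\lambda_1\cdots \lambda_j},$$ where for $j=0$ the term in the sum is to be understood as $1$.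
   Context: An o-minimal structure (over $\mathbb{R}$) is a sequence $\mathcal{S}=(\mathcal{S}_n)_{n\geq 1}$, where $\mathcal{S}_n$ is a family of subsets of $\mathbb{R}^n$, such that for each $n$: (1) $\emptyset\in\mathcal{S}_n$ and $\mathcal{S}_n$ is closed under finite unions and complements in $\mathbb{R}^n$; (2) if $A\in\mathcal{S}_n$ then $\mathbb{R}\times A\in\mathcal{S}_{n+1}$ and $A\times\mathbb{R}\in\mathcal{S}_{n+1}$; (3) $\{(x_1,\ldots,x_n):x_i=x_j\}\in\mathcal{S}_n$ for $1\leq i<j\leq n$; (4) if $\pi:\mathbb{R}^{n+1}\to\mathbb{R}^n$ is the projection on the first $n$ coordinates and $A\in\mathcal{S}_{n+1}$, then $\pi(A)\in\mathcal{S}_n$; (5) $\{r\}\in\mathcal{S}_1$ for every $r\in\mathbb{R}$ and $\{(x,y)\in\mathbb{R}^2:x<y\}\in\mathcal{S}_2$; (6) the only sets in $\mathcal{S}_1$ are the finite unions of open intervals (infinite endpoints allowed) and points. A set is definable if it lies in some $\mathcal{S}_n$. A definable set $Z\subseteq\mathbb{R}^{m+n}$ is also called a definable family, viewed as the family of its fibers $Z_T$, $T\in\mathbb{R}^m$. A lattice $\Lambda$ in $\mathbb{R}^n$ has full rank $n$. Its successive minima (with respect to the closed Euclidean unit ball centered at $0$) are $\lambda_i=\inf\{\lambda: B_0(\lambda)\cap\Lambda\text{ contains } i \text{ linearly independent vectors}\}$ for $i=1,\ldots,n$, where $B_0(\lambda)$ is the zero-centered Euclidean ball of radius $\lambda$.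 For $1\leq j\leq n-1$, $V_j(Z_T)$ denotes the sum of the $j$-dimensional volumes (Lebesgue measures) of the orthogonal projections of $Z_T$ onto all $j$-dimensional coordinate subspaces of $\mathbb{R}^n$; $V_0(Z_T)=1$. $\mathrm{Vol}$ is $n$-dimensional Lebesgue measure. (These volumes exist and are finite for bounded definable sets.) *)

theory Defs
  imports "HOL-Analysis.Analysis" "Jordan_Normal_Form.Determinant"
begin

section \<open>Points and volumes\<close>

text \<open>The dimension varies inside a single o-minimal structure, so points are not elements of
  \<open>real ^ 'n\<close>: a point of $n$-space is a function on the index set \<open>{..<n}\<close> (coordinates are
  numbered from 0), \<open>undefined\<close> elsewhere.  This is the space of the product measure
  \<open>Pi\<^sub>M {..<n} (\<lambda>_. lborel)\<close>.\<close>

definition Rn :: "nat \<Rightarrow> (nat \<Rightarrow> real) set" where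
  "Rn n = {..<n} \<rightarrow>\<^sub>E UNIV"

definition enorm :: "nat \<Rightarrow> (nat \<Rightarrow> real) \<Rightarrow> real" where
  "enorm n x = L2_set x {..<n}"

definition bounded_in :: "nat \<Rightarrow> (nat \<Rightarrow> real) set \<Rightarrow> bool" where
  "bounded_in n A \<longleftrightarrow> (\<exists>B. \<forall>x\<in>A. enorm n x \<le> B)"

definition lebesgue_on_coords :: "nat set \<Rightarrow> (nat \<Rightarrow> real) measure" where
  "lebesgue_on_coords I = completion (Pi\<^sub>M I (\<lambda>_. lborel))"

definition vol :: "nat \<Rightarrow> (nat \<Rightarrow> real) set \<Rightarrow> real" where
  "vol n A = measure (lebesgue_on_coords {..<n}) A"

text \<open>Orthogonal projection onto the coordinate subspace spanned by the coordinates in \<open>I\<close> is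
  restriction to \<open>I\<close>.\<close>

definition proj_vol :: "nat \<Rightarrow> nat \<Rightarrow> (nat \<Rightarrow> real) set \<Rightarrow> real" where
  "proj_vol n j A =
     (if j = 0 then 1
      else \<Sum>I | I \<subseteq> {..<n} \<and> card I = j.
             measure (lebesgue_on_coords I) ((\<lambda>x. restrict x I) ` A))"

section \<open>O-minimal structures\<close>

definition times_R_left :: "nat \<Rightarrow> (nat \<Rightarrow> real) set \<Rightarrow> (nat \<Rightarrow> real) set" where
  "times_R_left n A = {x \<in> Rn (Suc n). (\<lambda>i\<in>{..<n}. x (Suc i)) \<in> A}"

definition times_R_right :: "nat \<Rightarrow> (nat \<Rightarrow> real) set \<Rightarrow> (nat \<Rightarrow> real) set" where
  "times_R_right n A = {x \<in> Rn (Suc n). restrict x {..<n} \<in> A}"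

definition open_interval_or_point :: "real set \<Rightarrow> bool" where
  "open_interval_or_point J \<longleftrightarrow>
     (\<exists>a b :: ereal. J = {x. a < ereal x \<and> ereal x < b}) \<or> (\<exists>r. J = {r})"

locale o_minimal =
  fixes S :: "nat \<Rightarrow> (nat \<Rightarrow> real) set set"
  assumes subset_Rn: "n \<ge> 1 \<Longrightarrow> A \<in> S n \<Longrightarrow> A \<subseteq> Rn n"
    and empty: "n \<ge> 1 \<Longrightarrow> {} \<in> S n"
    and union: "n \<ge> 1 \<Longrightarrow> A \<in> S n \<Longrightarrow> B \<in> S n \<Longrightarrow> A \<union> B \<in> S n"
    and compl: "n \<ge> 1 \<Longrightarrow> A \<in> S n \<Longrightarrow> Rn n - A \<in> S n"
    and times_left: "n \<ge> 1 \<Longrightarrow> A \<in> S n \<Longrightarrow> times_R_left n A \<in> S (Suc n)"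
    and times_right: "n \<ge> 1 \<Longrightarrow> A \<in> S n \<Longrightarrow> times_R_right n A \<in> S (Suc n)"
    and diagonal: "i < j \<Longrightarrow> j < n \<Longrightarrow> {x \<in> Rn n. x i = x j} \<in> S n"
    and projection: "n \<ge> 1 \<Longrightarrow> A \<in> S (Suc n) \<Longrightarrow> (\<lambda>x. restrict x {..<n}) ` A \<in> S n"
    and singleton: "{\<lambda>i\<in>{..<1}. r} \<in> S 1"
    and less: "{x \<in> Rn 2. x 0 < x 1} \<in> S 2"
    and tame: "A \<in> S 1 \<Longrightarrow>
      \<exists>F. finite F \<and> (\<forall>J\<in>F. open_interval_or_point J) \<and> (\<lambda>x. x 0) ` A = \<Union>F"

text \<open>Real polynomials in \<open>n\<close> variables are given by a finite set \<open>M\<close> of exponent vectors, of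
  which only the first \<open>n\<close> entries are used, and coefficients \<open>c\<close>.\<close>

definition poly_fun :: "nat \<Rightarrow> ((nat \<Rightarrow> real) \<Rightarrow> real) \<Rightarrow> bool" where
  "poly_fun n p \<longleftrightarrow>
     (\<exists>(M :: (nat \<Rightarrow> nat) set) c. finite M \<and> p = (\<lambda>x. \<Sum>\<alpha>\<in>M. c \<alpha> * (\<Prod>i<n. x i ^ \<alpha> i)))"

definition semialgebraic :: "nat \<Rightarrow> (nat \<Rightarrow> real) set \<Rightarrow> bool" where
  "semialgebraic n A \<longleftrightarrow>
     (\<exists>C. finite C \<and>
        (\<forall>(F, G)\<in>C. finite F \<and> finite G \<and> (\<forall>p\<in>F \<union> G. poly_fun n p)) \<and>
        A = (\<Union>(F, G)\<in>C. {x \<in> Rn n. (\<forall>f\<in>F. f x = 0) \<and> (\<forall>g\<in>G. g x > 0)}))"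

definition append_pt :: "nat \<Rightarrow> nat \<Rightarrow> (nat \<Rightarrow> real) \<Rightarrow> (nat \<Rightarrow> real) \<Rightarrow> nat \<Rightarrow> real" where
  "append_pt m n T x = (\<lambda>i\<in>{..<m + n}. if i < m then T i else x (i - m))"

definition fiber :: "nat \<Rightarrow> nat \<Rightarrow> (nat \<Rightarrow> real) set \<Rightarrow> (nat \<Rightarrow> real) \<Rightarrow> (nat \<Rightarrow> real) set" where
  "fiber m n Z T = {x \<in> Rn n. append_pt m n T x \<in> Z}"

section \<open>Lattices\<close>

text \<open>Linear independence over the reals of the family \<open>v 0, \<dots>, v (k - 1)\<close> in $n$-space.\<close>

definition lin_indep :: "nat \<Rightarrow> nat \<Rightarrow> (nat \<Rightarrow> nat \<Rightarrow> real) \<Rightarrow> bool" where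
  "lin_indep n k v \<longleftrightarrow>
     (\<forall>c. (\<forall>l<n. (\<Sum>i<k. c i * v i l) = 0) \<longrightarrow> (\<forall>i<k. c i = 0))"

definition lattice_basis :: "nat \<Rightarrow> (nat \<Rightarrow> nat \<Rightarrow> real) \<Rightarrow> (nat \<Rightarrow> real) set \<Rightarrow> bool" where
  "lattice_basis n b \<Lambda> \<longleftrightarrow>
     (\<forall>i<n. b i \<in> Rn n) \<and> lin_indep n n b \<and>
     \<Lambda> = {\<lambda>l\<in>{..<n}. \<Sum>i<n. of_int (z i) * b i l | z :: nat \<Rightarrow> int. True}"

definition full_lattice :: "nat \<Rightarrow> (nat \<Rightarrow> real) set \<Rightarrow> bool" where
  "full_lattice n \<Lambda> \<longleftrightarrow> (\<exists>b. lattice_basis n b \<Lambda>)"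

definition basis_det :: "nat \<Rightarrow> (nat \<Rightarrow> nat \<Rightarrow> real) \<Rightarrow> real" where
  "basis_det n b = \<bar>Determinant.det (Matrix.mat n n (\<lambda>(i, l). b i l))\<bar>"

text \<open>The choice of basis is irrelevant, see \<open>lattice_det_eq\<close> below.\<close>

definition lattice_det :: "nat \<Rightarrow> (nat \<Rightarrow> real) set \<Rightarrow> real" where
  "lattice_det n \<Lambda> = basis_det n (SOME b. lattice_basis n b \<Lambda>)"

definition succ_min :: "nat \<Rightarrow> (nat \<Rightarrow> real) set \<Rightarrow> nat \<Rightarrow> real" where
  "succ_min n \<Lambda> i =
     Inf {r. \<exists>v. (\<forall>k<i. v k \<in> {x \<in> Rn n. enorm n x \<le> r} \<inter> \<Lambda>) \<and> lin_indep n i v}"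

lemma lattice_basis_mem_iff:
  assumes "lattice_basis n b \<Lambda>"
  shows "x \<in> \<Lambda> \<longleftrightarrow>
    (\<exists>z :: nat \<Rightarrow> int. x = (\<lambda>l\<in>{..<n}. \<Sum>i<n. of_int (z i) * b i l))"
proof -
  have "\<Lambda> = {\<lambda>l\<in>{..<n}. \<Sum>i<n. of_int (z i) * b i l | z :: nat \<Rightarrow> int. True}"
    using assms by (simp only: lattice_basis_def)
  then show ?thesis by simp
qed

lemma lattice_basis_coeffs:
  assumes b: "lattice_basis n b \<Lambda>" and b': "lattice_basis n b' \<Lambda>"
  obtains U :: "nat \<Rightarrow> nat \<Rightarrow> int"
  where "\<And>i l. i < n \<Longrightarrow> l < n \<Longrightarrow> b' i l = (\<Sum>j<n. of_int (U i j) * b j l)"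
proof -
  have "\<exists>z :: nat \<Rightarrow> int. \<forall>l<n. b' i l = (\<Sum>j<n. of_int (z j) * b j l)" if i: "i < n" for i
  proof -
    have "(\<Sum>j<n. of_int (if j = i then 1 else 0) * b' j l) = b' i l" for l
    proof -
      have "(\<Sum>j<n. of_int (if j = i then 1 else 0) * b' j l) = (\<Sum>j<n. if j = i then b' j l else 0)"
        by (intro sum.cong) auto
      then show ?thesis using i by simp
    qed
    then have "restrict (b' i) {..<n} = (\<lambda>l\<in>{..<n}. \<Sum>j<n. of_int (if j = i then 1 else 0) * b' j l)"
      by simp
    then have "restrict (b' i) {..<n} \<in> \<Lambda>"
      unfolding lattice_basis_mem_iff[OF b']
      by (rule exI[of _ "\<lambda>j. if j = i then 1 else 0"])
    then obtain z :: "nat \<Rightarrow> int"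
      where z: "restrict (b' i) {..<n} = (\<lambda>l\<in>{..<n}. \<Sum>j<n. of_int (z j) * b j l)"
      unfolding lattice_basis_mem_iff[OF b] by (elim exE)
    have "b' i l = (\<Sum>j<n. of_int (z j) * b j l)" if "l < n" for l
      using fun_cong[OF z, of l] that by simp
    then show ?thesis by blast
  qed
  then have "\<forall>i. \<exists>z :: nat \<Rightarrow> int. i < n \<longrightarrow> (\<forall>l<n. b' i l = (\<Sum>j<n. of_int (z j) * b j l))"
    by blast
  then obtain U :: "nat \<Rightarrow> nat \<Rightarrow> int"
    where "\<forall>i. i < n \<longrightarrow> (\<forall>l<n. b' i l = (\<Sum>j<n. of_int (U i j) * b j l))"
    unfolding choice_iff by (elim exE)
  then show ?thesis using that by blast
qed

lemma basis_det_eq: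
  assumes b: "lattice_basis n b \<Lambda>" and b': "lattice_basis n b' \<Lambda>"
  shows "basis_det n b = basis_det n b'"
proof -
  obtain U :: "nat \<Rightarrow> nat \<Rightarrow> int"
    where U: "\<And>i l. i < n \<Longrightarrow> l < n \<Longrightarrow> b' i l = (\<Sum>j<n. of_int (U i j) * b j l)"
    using lattice_basis_coeffs[OF b b'] by blast
  obtain W :: "nat \<Rightarrow> nat \<Rightarrow> int"
    where W: "\<And>i l. i < n \<Longrightarrow> l < n \<Longrightarrow> b i l = (\<Sum>j<n. of_int (W i j) * b' j l)"
    using lattice_basis_coeffs[OF b' b] by blast
  define MU where "MU = Matrix.mat n n (\<lambda>(i, j). U i j)"
  define MW where "MW = Matrix.mat n n (\<lambda>(i, j). W i j)"
  have WU: "(\<Sum>j<n. W i j * U j k) = (if i = k then 1 else 0)" if i: "i < n" and k: "k < n" for i k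
  proof -
    define c :: "nat \<Rightarrow> real"
      where "c k = of_int (\<Sum>j<n. W i j * U j k) - (if k = i then 1 else 0)" for k
    have "(\<Sum>k<n. c k * b k l) = 0" if l: "l < n" for l
    proof -
      have "b i l = (\<Sum>j<n. of_int (W i j) * (\<Sum>k<n. of_int (U j k) * b k l))"
        using W[OF i l] U[OF _ l] by simp
      also have "\<dots> = (\<Sum>k<n. of_int (\<Sum>j<n. W i j * U j k) * b k l)"
        unfolding sum_distrib_left of_int_sum sum_distrib_right
        by (subst sum.swap) (simp add: mult.assoc)
      finally have *: "b i l = (\<Sum>k<n. of_int (\<Sum>j<n. W i j * U j k) * b k l)" .
      have "(\<Sum>k<n. (if k = i then 1 else 0) * b k l) = (\<Sum>k<n. if k = i then b k l else 0)"
        by (intro sum.cong) auto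
      then have "(\<Sum>k<n. (if k = i then 1 else 0) * b k l) = b i l"
        using i by simp
      then show ?thesis
        unfolding c_def left_diff_distrib sum_subtractf using * by simp
    qed
    then have "c k = 0"
      using b k unfolding lattice_basis_def lin_indep_def by blast
    then show ?thesis
      unfolding c_def by (cases "k = i") (simp_all flip: of_int_sum of_int_mult)
  qed
  have "MW * MU = 1\<^sub>m n"
    by (rule eq_matI) (auto simp: MW_def MU_def scalar_prod_def atLeast0LessThan WU)
  then have "Determinant.det MW * Determinant.det MU = 1"
    using det_mult[of MW n MU] by (simp add: MW_def MU_def)
  then have 1: "\<bar>Determinant.det MU\<bar> = 1"
    by (metis abs_zmult_eq_1 mult.commute abs_1)
  have "Matrix.mat n n (\<lambda>(i, l). b' i l) =
      map_mat real_of_int MU * Matrix.mat n n (\<lambda>(i, l). b i l)"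
    by (rule eq_matI) (auto simp: MU_def scalar_prod_def atLeast0LessThan U)
  then have "Determinant.det (Matrix.mat n n (\<lambda>(i, l). b' i l)) =
      of_int (Determinant.det MU) * Determinant.det (Matrix.mat n n (\<lambda>(i, l). b i l))"
    using det_mult[of "map_mat real_of_int MU" n "Matrix.mat n n (\<lambda>(i, l). b i l)"]
    by (simp add: MU_def of_int_hom.hom_det)
  then show ?thesis
    unfolding basis_det_def using 1 by (simp add: abs_mult flip: of_int_abs)
qed

lemma lattice_det_eq: "lattice_basis n b \<Lambda> \<Longrightarrow> lattice_det n \<Lambda> = basis_det n b"
  unfolding lattice_det_def by (metis basis_det_eq someI)

end

theory Submission
  imports Defs
begin

text \<open>
  Uniform finiteness: let \<open>A\<close> be a definable family of finite subsets of the line. On every line in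
  the parameter space there are, by a pigeonhole argument over countably many rational codes, only
  finitely many parameters near which the fibres cannot be matched by proximity, and the
  cardinality is constant between two such parameters. Collecting the fibres over these parameters
  and over one parameter in each gap gives a family with one parameter less and with the same
  maximal cardinality, so induction applies. Applied to frontiers, this bounds the number of
  intervals in the fibres of any definable family of subsets of the line.

  Counting (Davenport): on a union of \<open>h\<close> bounded intervals, the number of integers and the length
  differ by at most \<open>h\<close>. Exchanging the counting measure of the integers for Lebesgue measure in one
  coordinate at a time bounds the difference between the number of integer points of a set and its
  volume by volumes of its coordinate projections.

  Let \<open>b\<close> be a reduced basis of the lattice and \<open>p\<close> the inverse of the matrix with columns \<open>b k\<close>, so
  that the lattice points in \<open>Z\<close> are the integer points in \<open>p Z\<close>. For the projections of \<open>p Z\<close>, the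
  rows of \<open>p\<close> are replaced by coordinate functions one by one: the image of a set \<open>F\<close> under a linear
  form is contained in the image of the product of its coordinate projections, which are unions of
  at most \<open>h\<close> intervals. Since the entries of row \<open>k\<close> of \<open>p\<close> are bounded by a multiple of the inverse
  of the norm of \<open>b k\<close>, this gives the factors \<open>1 / (\<lambda>\<^sub>1 \<dots> \<lambda>\<^sub>j)\<close>.
\<close>

section \<open>Definable predicates\<close>

text \<open>The constant may depend neither on \<open>T\<close> nor on the lattice, and this shapes
  the proof. The entries of the inverse basis matrix \<open>p\<close> are treated as additional real
  parameters of one definable family, next to \<open>T\<close> and the base point of a slice;
  uniform finiteness then gives a single \<open>h\<close> for all lattices at once. The constant of
  the reduced bases depends on the dimension only: it is quantified before the basis. That products
  of norms of basis vectors dominate products of successive minima holds for every basis;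
  reducedness enters through the bound on \<open>p\<close>. Slicing arguments rest on Fubini, so
  definable sets have to be shown Borel as well, which again uses that frontiers on lines are
  finite. What the counting part knows of the o-minimal structure is collected in the locale
  \<open>sliced_set\<close>. Exchanging the measure in one coordinate leaves an error in which other
  coordinates may still be counted, hence the volumes \<open>mixed_vol\<close> with both kinds of
  factors.\<close>

lemma poly_funI:
  assumes "finite A"
  shows "poly_fun n (\<lambda>x. \<Sum>a\<in>A. c a * (\<Prod>i<n. x i ^ e a i))"
  unfolding poly_fun_def
proof (intro exI conjI ext)
  show "finite (e ` A)" using assms by simp
  fix x :: "nat \<Rightarrow> real"
  \<comment> \<open>Different indices may carry the same exponent vector; their coefficients are
    added up. Sums and products of polynomials can then be indexed by disjoint unions and
    pairs.\<close>
  show "(\<Sum>a\<in>A. c a * (\<Prod>i<n. x i ^ e a i)) =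
      (\<Sum>\<alpha>\<in>e ` A. (\<Sum>a\<in>{a\<in>A. e a = \<alpha>}. c a) * (\<Prod>i<n. x i ^ \<alpha> i))"
    unfolding sum_distrib_right by (subst sum.image_gen[OF assms, where g = e]) (auto intro!: sum.cong)
qed

text \<open>Exponent vectors may carry arbitrary entries beyond \<open>n\<close>; these are set to 0
  before the product is extended to \<open>k\<close> factors.\<close>

lemma poly_fun_mono:
  assumes "poly_fun n p" "n \<le> k"
  shows "poly_fun k p"
proof -
  obtain M c where M: "finite M" and p: "p = (\<lambda>x. \<Sum>\<alpha>\<in>M. c \<alpha> * (\<Prod>i<n. x i ^ \<alpha> i))"
    using assms(1) unfolding poly_fun_def by blast
  have "(\<Prod>i<k. x i ^ (if i < n then \<alpha> i else 0)) = (\<Prod>i<n. x i ^ \<alpha> i)"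
    for x :: "nat \<Rightarrow> real" and \<alpha>
    using assms(2) by (intro prod.mono_neutral_cong_right) auto
  then show ?thesis
    using poly_funI[OF M, of k c "\<lambda>\<alpha> i. if i < n then \<alpha> i else 0"] by (simp add: p)
qed

lemma poly_fun_const: "poly_fun n (\<lambda>x. c)"
  using poly_funI[of "{()}" n "\<lambda>_. c" "\<lambda>_ _. 0"] by simp

lemma poly_fun_var:
  assumes "k < n"
  shows "poly_fun n (\<lambda>x. x k)"
proof -
  have "(\<Prod>i<n. x i ^ (if i = k then 1 else 0)) = x k" for x :: "nat \<Rightarrow> real"
    using assms by (subst prod.remove[of _ k]) auto
  then show ?thesis
    using poly_funI[of "{()}" n "\<lambda>_. 1" "\<lambda>_ i. if i = k then 1 else 0"] by simp
qed

lemma poly_fun_add: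
  assumes "poly_fun n p" "poly_fun n q"
  shows "poly_fun n (\<lambda>x. p x + q x)"
proof -
  obtain M c where M: "finite M" and p: "p = (\<lambda>x. \<Sum>\<alpha>\<in>M. c \<alpha> * (\<Prod>i<n. x i ^ \<alpha> i))"
    using assms(1) unfolding poly_fun_def by blast
  obtain M' c' where M': "finite M'" and q: "q = (\<lambda>x. \<Sum>\<alpha>\<in>M'. c' \<alpha> * (\<Prod>i<n. x i ^ \<alpha> i))"
    using assms(2) unfolding poly_fun_def by blast
  have "(\<lambda>x. p x + q x) = (\<lambda>x. \<Sum>a\<in>M <+> M'. case_sum c c' a * (\<Prod>i<n. x i ^ case_sum id id a i))"
    unfolding p q by (subst sum.Plus[OF M M']) simp
  then show ?thesis
    using poly_funI[of "M <+> M'" n "case_sum c c'" "case_sum id id"] M M' by simp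
qed

lemma poly_fun_mult:
  assumes "poly_fun n p" "poly_fun n q"
  shows "poly_fun n (\<lambda>x. p x * q x)"
proof -
  obtain M c where M: "finite M" and p: "p = (\<lambda>x. \<Sum>\<alpha>\<in>M. c \<alpha> * (\<Prod>i<n. x i ^ \<alpha> i))"
    using assms(1) unfolding poly_fun_def by blast
  obtain M' c' where M': "finite M'" and q: "q = (\<lambda>x. \<Sum>\<alpha>\<in>M'. c' \<alpha> * (\<Prod>i<n. x i ^ \<alpha> i))"
    using assms(2) unfolding poly_fun_def by blast
  have "(\<lambda>x. p x * q x) =
      (\<lambda>x. \<Sum>a\<in>M \<times> M'. (c (fst a) * c' (snd a)) * (\<Prod>i<n. x i ^ (fst a i + snd a i)))"
    unfolding p q sum_product
    by (auto simp: sum.cartesian_product power_add prod.distrib intro!: sum.cong)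
  then show ?thesis
    using poly_funI[of "M \<times> M'" n "\<lambda>a. c (fst a) * c' (snd a)" "\<lambda>a i. fst a i + snd a i"] M M'
    by simp
qed

definition polynomial :: "((nat \<Rightarrow> real) \<Rightarrow> real) \<Rightarrow> bool" where
  "polynomial f \<longleftrightarrow> (\<exists>n. poly_fun n f)"

lemma polynomial_common:
  assumes "polynomial f" "polynomial g"
  obtains n where "poly_fun n f" "poly_fun n g"
proof -
  obtain m n where "poly_fun m f" "poly_fun n g" using assms unfolding polynomial_def by blast
  then show thesis using that[of "max m n"] poly_fun_mono[of m f "max m n"] poly_fun_mono[of n g "max m n"]
    by simp
qed

text \<open>Closure rules for polynomials and definable predicates. Applied repeatedly, they prove
  definability by following the syntax of a formula.\<close>

named_theorems def_intros

lemma polynomial_const [def_intros]: "polynomial (\<lambda>x. c)"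
  and polynomial_var [def_intros]: "polynomial (\<lambda>x. x k)"
  using poly_fun_const poly_fun_var[of k "Suc k"] unfolding polynomial_def by blast+

lemma polynomial_add [def_intros]:
    "polynomial f \<Longrightarrow> polynomial g \<Longrightarrow> polynomial (\<lambda>x. f x + g x)"
  and polynomial_mult [def_intros]:
    "polynomial f \<Longrightarrow> polynomial g \<Longrightarrow> polynomial (\<lambda>x. f x * g x)"
  by (erule (1) polynomial_common; unfold polynomial_def; blast intro: poly_fun_add poly_fun_mult)+

lemma polynomial_diff [def_intros]:
  "polynomial f \<Longrightarrow> polynomial g \<Longrightarrow> polynomial (\<lambda>x. f x - g x)"
  using polynomial_add[OF _ polynomial_mult[OF polynomial_const[of "-1"]], of f g] by simp

lemma polynomial_sum [def_intros]:
  "(\<And>i. polynomial (f i)) \<Longrightarrow> polynomial (\<lambda>x. \<Sum>i\<in>I. f i x)"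
  by (induction I rule: infinite_finite_induct) (auto intro: def_intros)

text \<open>The condition is constant in \<open>x\<close>; the rule serves for substitutions that
  choose an entry by its index.\<close>

lemma polynomial_if [def_intros]:
  "polynomial f \<Longrightarrow> polynomial g \<Longrightarrow> polynomial (\<lambda>x. if c then f x else g x)"
  by (cases c) auto

lemma polynomial_common_family:
  fixes k :: nat
  assumes "\<And>i. polynomial (f i)"
  shows "\<exists>n. \<forall>m\<ge>n. \<forall>i<k. poly_fun m (f i)"
proof (induction k)
  case (Suc k)
  then obtain n where "\<forall>m\<ge>n. \<forall>i<k. poly_fun m (f i)" by blast
  moreover obtain n' where "poly_fun n' (f k)" using assms unfolding polynomial_def by blast
  ultimately have "\<forall>m\<ge>max n n'. \<forall>i<Suc k. poly_fun m (f i)"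
    using poly_fun_mono by (auto simp: less_Suc_eq)
  then show ?case by blast
qed simp

definition depends_below :: "nat \<Rightarrow> ((nat \<Rightarrow> real) \<Rightarrow> 'a) \<Rightarrow> bool" where
  "depends_below n P \<longleftrightarrow> (\<forall>x y. (\<forall>i<n. x i = y i) \<longrightarrow> P x = P y)"

lemma depends_belowD: "depends_below n P \<Longrightarrow> (\<And>i. i < n \<Longrightarrow> x i = y i) \<Longrightarrow> P x = P y"
  unfolding depends_below_def by blast

lemma poly_fun_depends: "poly_fun n f \<Longrightarrow> depends_below n f"
  unfolding poly_fun_def depends_below_def by (auto intro!: sum.cong)

lemma restrict_mem_Rn: "restrict x {..<n} \<in> Rn n"
  by (simp add: Rn_def)

section \<open>Definable predicates: connectives, polynomial substitution, quantifiers\<close>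

locale o_minimal_semialgebraic = o_minimal +
  assumes semialgebraic: "k \<ge> 1 \<Longrightarrow> semialgebraic k A \<Longrightarrow> A \<in> S k"
begin

text \<open>Membership in \<open>S n\<close> only controls \<open>P\<close> on points that are
  \<open>undefined\<close> beyond \<open>n\<close>; \<open>depends_below\<close> carries this over
  to all sequences.\<close>

definition defN :: "nat \<Rightarrow> ((nat \<Rightarrow> real) \<Rightarrow> bool) \<Rightarrow> bool" where
  "defN n P \<longleftrightarrow> n \<ge> 1 \<and> depends_below n P \<and> {x \<in> Rn n. P x} \<in> S n"

text \<open>Predicates are on all sequences, so that the number of free variables of a formula need not
  be tracked; a definable predicate depends on finitely many entries.\<close>

definition definable :: "((nat \<Rightarrow> real) \<Rightarrow> bool) \<Rightarrow> bool" where
  "definable P \<longleftrightarrow> (\<exists>n. defN n P)"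

lemma defN_Suc:
  assumes "defN n P"
  shows "defN (Suc n) P"
proof -
  have P: "depends_below n P" "n \<ge> 1" "{x \<in> Rn n. P x} \<in> S n" using assms by (auto simp: defN_def)
  have "P (restrict x {..<n}) = P x" for x
    by (rule depends_belowD[OF P(1)]) auto
  then have "times_R_right n {x \<in> Rn n. P x} = {x \<in> Rn (Suc n). P x}"
    by (auto simp: times_R_right_def restrict_mem_Rn)
  moreover have "depends_below (Suc n) P"
    using P(1) unfolding depends_below_def by auto
  ultimately show ?thesis using times_right[OF P(2,3)] by (simp add: defN_def)
qed

lemma defN_mono: "defN n P \<Longrightarrow> n \<le> k \<Longrightarrow> defN k P"
  by (rotate_tac, induction k rule: dec_induct) (auto intro: defN_Suc)

text \<open>Makes room for \<open>N\<close> variables in front of the arguments of \<open>P\<close>,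
  as substitution requires.\<close>

lemma defN_shift:
  assumes "defN n P"
  shows "defN (N + n) (\<lambda>x. P (\<lambda>i. x (N + i)))"
proof (induction N)
  case 0
  then show ?case using assms by simp
next
  case (Suc N)
  let ?Q = "\<lambda>x. P (\<lambda>i. x (N + i))"
  have Q: "depends_below (N + n) ?Q" "N + n \<ge> 1" "{x \<in> Rn (N + n). ?Q x} \<in> S (N + n)"
    using Suc by (auto simp: defN_def)
  have "?Q (\<lambda>i\<in>{..<N + n}. x (Suc i)) = ?Q (\<lambda>i. x (Suc i))" for x
    by (rule depends_belowD[OF Q(1)]) auto
  then have "times_R_left (N + n) {x \<in> Rn (N + n). ?Q x} =
      {x \<in> Rn (Suc (N + n)). P (\<lambda>i. x (Suc N + i))}"
    by (auto simp: times_R_left_def restrict_mem_Rn)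
  moreover have "depends_below (Suc (N + n)) (\<lambda>x. P (\<lambda>i. x (Suc N + i)))"
    unfolding depends_below_def
  proof (intro allI impI)
    fix x y :: "nat \<Rightarrow> real" assume xy: "\<forall>i<Suc (N + n). x i = y i"
    show "P (\<lambda>i. x (Suc N + i)) = P (\<lambda>i. y (Suc N + i))"
      using depends_belowD[OF Q(1), of "\<lambda>i. x (Suc i)" "\<lambda>i. y (Suc i)"] xy by simp
  qed
  ultimately show ?case using times_left[OF Q(2,3)] by (simp add: defN_def)
qed

lemma defN_conj: "defN n P \<Longrightarrow> defN n Q \<Longrightarrow> defN n (\<lambda>x. P x \<and> Q x)"
proof -
  assume *: "defN n P" "defN n Q"
  then have "Rn n - ((Rn n - {x \<in> Rn n. P x}) \<union> (Rn n - {x \<in> Rn n. Q x})) \<in> S n"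
    by (intro compl union) (auto simp: defN_def)
  also have "Rn n - ((Rn n - {x \<in> Rn n. P x}) \<union> (Rn n - {x \<in> Rn n. Q x})) = {x \<in> Rn n. P x \<and> Q x}"
    by auto
  finally show ?thesis using * by (auto simp: defN_def depends_below_def)
qed

lemma defN_not: "defN n P \<Longrightarrow> defN n (\<lambda>x. \<not> P x)"
proof -
  assume *: "defN n P"
  then have "Rn n - {x \<in> Rn n. P x} \<in> S n" by (intro compl) (auto simp: defN_def)
  also have "Rn n - {x \<in> Rn n. P x} = {x \<in> Rn n. \<not> P x}"
    by auto
  finally show ?thesis using * by (auto simp: defN_def depends_below_def)
qed

lemma defN_project:
  assumes "defN (Suc n) P" "n \<ge> 1"
  shows "defN n (\<lambda>x. \<exists>t. P (x(n := t)))"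
proof -
  have P: "depends_below (Suc n) P" "{x \<in> Rn (Suc n). P x} \<in> S (Suc n)"
    using assms by (auto simp: defN_def)
  have "(\<lambda>x. restrict x {..<n}) ` {x \<in> Rn (Suc n). P x} = {x \<in> Rn n. \<exists>t. P (x(n := t))}"
  proof (intro equalityI subsetI)
    fix y assume "y \<in> (\<lambda>x. restrict x {..<n}) ` {x \<in> Rn (Suc n). P x}"
    then obtain x where x: "P x" "y = restrict x {..<n}" by blast
    have "P (y(n := x n)) = P x"
      by (rule depends_belowD[OF P(1)]) (auto simp: x)
    then show "y \<in> {x \<in> Rn n. \<exists>t. P (x(n := t))}"
      using x restrict_mem_Rn by blast
  next
    fix y assume "y \<in> {x \<in> Rn n. \<exists>t. P (x(n := t))}"
    then obtain t where t: "y \<in> Rn n" "P (y(n := t))" by blast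
    then have "y(n := t) \<in> Rn (Suc n)" "y = restrict (y(n := t)) {..<n}"
      unfolding Rn_def by (auto simp: PiE_def extensional_def restrict_def fun_eq_iff)
    then show "y \<in> (\<lambda>x. restrict x {..<n}) ` {x \<in> Rn (Suc n). P x}"
      using t by blast
  qed
  moreover have "depends_below n (\<lambda>x. \<exists>t. P (x(n := t)))"
    unfolding depends_below_def
  proof (intro allI impI)
    fix x y :: "nat \<Rightarrow> real" assume "\<forall>i<n. x i = y i"
    then have "P (x(n := t)) = P (y(n := t))" for t
      by (intro depends_belowD[OF P(1)]) auto
    then show "(\<exists>t. P (x(n := t))) = (\<exists>t. P (y(n := t)))" by simp
  qed
  ultimately show ?thesis using projection[OF assms(2) P(2)] assms(2) by (simp add: defN_def)
qed

lemma defN_project_many: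
  assumes "n \<ge> 1"
  shows "defN (n + k) P \<Longrightarrow> defN n (\<lambda>x. \<exists>z. P (\<lambda>i. if i < n then x i else z i))"
proof (induction k arbitrary: P)
  case 0
  then have dep: "depends_below n P" by (simp add: defN_def)
  have "P (\<lambda>i. if i < n then x i else z i) = P x" for x z
    by (rule depends_belowD[OF dep]) auto
  then show ?case using 0 by simp
next
  case (Suc k)
  have "defN n (\<lambda>x. \<exists>z t. P ((\<lambda>i. if i < n then x i else z i)(n + k := t)))"
    using defN_project[of "n + k" P] Suc assms by simp
  moreover have "(\<exists>z t. P ((\<lambda>i. if i < n then x i else z i)(n + k := t))) =
    (\<exists>z. P (\<lambda>i. if i < n then x i else z i))" (is "?L = ?R") for x
  proof
    assume ?L
    then obtain z t where "P ((\<lambda>i. if i < n then x i else z i)(n + k := t))" by blast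
    also have "(\<lambda>i. if i < n then x i else z i)(n + k := t) =
      (\<lambda>i. if i < n then x i else (z(n + k := t)) i)"
      by auto
    finally show ?R by blast
  next
    assume ?R
    then obtain z where "P (\<lambda>i. if i < n then x i else z i)" by blast
    also have "(\<lambda>i. if i < n then x i else z i) =
      (\<lambda>i. if i < n then x i else z i)(n + k := z (n + k))"
      by auto
    finally show ?L by blast
  qed
  ultimately show ?case by simp
qed

lemma defN_eq_0:
  assumes "poly_fun n f" "n \<ge> 1"
  shows "defN n (\<lambda>x. f x = 0)"
proof -
  have "semialgebraic n {x \<in> Rn n. f x = 0}"
    unfolding semialgebraic_def using assms by (intro exI[of _ "{({f}, {})}"]) auto
  then show ?thesis
    using assms semialgebraic poly_fun_depends[OF assms(1)] unfolding defN_def depends_below_def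
    by metis
qed

lemma defN_pos:
  assumes "poly_fun n f" "n \<ge> 1"
  shows "defN n (\<lambda>x. f x > 0)"
proof -
  have "semialgebraic n {x \<in> Rn n. f x > 0}"
    unfolding semialgebraic_def using assms by (intro exI[of _ "{({}, {f})}"]) auto
  then have "{x \<in> Rn n. f x > 0} \<in> S n" using assms semialgebraic by blast
  moreover have "depends_below n (\<lambda>x. f x > 0)"
    using poly_fun_depends[OF assms(1)] unfolding depends_below_def by metis
  ultimately show ?thesis using assms by (simp add: defN_def)
qed

lemma defN_ball: 
  assumes "\<And>i. i < (k::nat) \<Longrightarrow> defN n (P i)" "n \<ge> 1"
  shows "defN n (\<lambda>x. \<forall>i<k. P i x)"
  using assms(1)
proof (induction k)
  case 0
  then show ?case using defN_eq_0[OF poly_fun_const[of n 0] assms(2)] by simp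
next
  case (Suc k)
  then show ?case using defN_conj[of n "\<lambda>x. \<forall>i<k. P i x" "P k"]
    unfolding All_less_Suc by (simp add: conj_commute)
qed

text \<open>\<open>P\<close> at the values \<open>f i x\<close> means that there are
  \<open>z i = f i x\<close> with \<open>P z\<close>. \<open>P\<close> sees only the first
  \<open>k\<close> entries, so finitely many polynomial equations suffice, and a projection removes
  the \<open>z i\<close>.\<close>

lemma definable_subst:
  assumes "definable P" and f: "\<And>i. polynomial (f i)"
  shows "definable (\<lambda>x. P (\<lambda>i. f i x))"
proof -
  obtain k where k: "defN k P" using assms(1) unfolding definable_def by blast
  obtain N0 where N0: "\<forall>m\<ge>N0. \<forall>i<k. poly_fun m (f i)"
    using polynomial_common_family[of f k, OF f] by (elim exE)
  define N where "N = Suc N0"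
  have N: "N \<ge> 1" "\<And>i m. i < k \<Longrightarrow> m \<ge> N \<Longrightarrow> poly_fun m (f i)" using N0 by (auto simp: N_def)
  have "defN (N + k) (\<lambda>x. (\<forall>i<k. x (N + i) - f i x = 0) \<and> P (\<lambda>i. x (N + i)))"
  proof (intro defN_conj defN_ball defN_shift k)
    fix i assume "i < k"
    then show "defN (N + k) (\<lambda>x. x (N + i) - f i x = 0)"
      using N poly_fun_add[OF poly_fun_var[of "N + i" "N + k"]
          poly_fun_mult[OF poly_fun_const[of _ "-1"] N(2)[of i "N + k"]]]
      by (intro defN_eq_0) auto
  qed (use N in auto)
  from defN_project_many[OF N(1) this]
  have "defN N (\<lambda>x. \<exists>z. (\<forall>i<k. z (N + i) - f i (\<lambda>i. if i < N then x i else z i) = 0) \<and>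
      P (\<lambda>i. z (N + i)))" by simp
  moreover have "(\<exists>z. (\<forall>i<k. z (N + i) - f i (\<lambda>i. if i < N then x i else z i) = 0) \<and>
      P (\<lambda>i. z (N + i))) = P (\<lambda>i. f i x)" for x
  proof -
    have fx: "f i (\<lambda>i. if i < N then x i else z i) = f i x" if "i < k" for i z
      using poly_fun_depends[OF N(2)[OF that order_refl]] by (rule depends_belowD) auto
    have dep: "depends_below k P" using k by (simp add: defN_def)
    have "P (\<lambda>i. z (N + i)) = P (\<lambda>i. f i x)" if "\<forall>i<k. z (N + i) - f i x = 0" for z
      using that by (intro depends_belowD[OF dep]) auto
    then have "(\<exists>z. (\<forall>i<k. z (N + i) - f i x = 0) \<and> P (\<lambda>i. z (N + i))) = P (\<lambda>i. f i x)"
      \<comment> \<open>The witness puts the value \<open>f i x\<close> at position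
        \<open>N + i\<close>.\<close>
      by (auto intro!: exI[of _ "\<lambda>j. f (j - N) x"])
    then show ?thesis using fx by simp
  qed
  ultimately show ?thesis unfolding definable_def by auto
qed

lemma definable_common:
  assumes "definable P" "definable Q"
  obtains n where "defN n P" "defN n Q"
proof -
  obtain m n where "defN m P" "defN n Q" using assms unfolding definable_def by blast
  then show thesis using that[of "max m n"] defN_mono[of m P "max m n"] defN_mono[of n Q "max m n"]
    by simp
qed

lemma definable_conj [def_intros]: "definable P \<Longrightarrow> definable Q \<Longrightarrow> definable (\<lambda>x. P x \<and> Q x)"
  by (erule (1) definable_common) (unfold definable_def, blast intro: defN_conj)

lemma definable_not [def_intros]: "definable P \<Longrightarrow> definable (\<lambda>x. \<not> P x)"
  unfolding definable_def by (blast intro: defN_not)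

lemma definable_disj [def_intros]:
  assumes "definable P" "definable Q"
  shows "definable (\<lambda>x. P x \<or> Q x)"
  using definable_not[OF definable_conj[OF assms[THEN definable_not]]] by simp

lemma definable_imp [def_intros]:
  assumes "definable P" "definable Q"
  shows "definable (\<lambda>x. P x \<longrightarrow> Q x)"
  using definable_not[OF definable_conj[OF assms(1) definable_not[OF assms(2)]]] by simp

lemma definable_less [def_intros]:
  assumes "polynomial f" "polynomial g"
  shows "definable (\<lambda>x. f x < g x)"
proof -
  obtain n where n: "poly_fun n (\<lambda>x. g x - f x)"
    using polynomial_diff[OF assms(2,1)] unfolding polynomial_def by blast
  from defN_pos[OF poly_fun_mono[OF n], of "Suc n"] show ?thesis
    unfolding definable_def by auto
qed

lemma definable_le [def_intros]:
  assumes "polynomial f" "polynomial g"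
  shows "definable (\<lambda>x. f x \<le> g x)"
  using definable_not[OF definable_less[OF assms(2,1)]] by (simp add: not_less)

lemma definable_eq [def_intros]:
  assumes "polynomial f" "polynomial g"
  shows "definable (\<lambda>x. f x = g x)"
  using definable_conj[OF definable_le[OF assms] definable_le[OF assms(2,1)]]
  by (simp add: eq_iff)

lemma definable_True: "definable (\<lambda>x. True)"
  using definable_le[OF polynomial_const polynomial_const, of 0 0] by simp

lemma definable_finite_ball [def_intros]:
  "finite I \<Longrightarrow> (\<And>i. definable (P i)) \<Longrightarrow> definable (\<lambda>x. \<forall>i\<in>I. P i x)"
  by (induction I rule: finite_induct) (auto intro: def_intros definable_True)

text \<open>Variables beyond \<open>n\<close> are projected away; since \<open>P\<close> does not
  see them, the projection is again described by \<open>P\<close>.\<close>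

lemma defN_of_definable:
  assumes "definable P" "depends_below n P" "n \<ge> 1"
  shows "defN n P"
proof -
  obtain L where L: "defN L P" using assms(1) unfolding definable_def by blast
  show ?thesis
  proof (cases "L \<le> n")
    case True
    then show ?thesis using L defN_mono by blast
  next
    case False
    then obtain d where d: "L = n + d" by (metis le_add_diff_inverse nat_le_linear)
    have "P (\<lambda>i. if i < n then x i else z i) = P x" for x z
      by (rule depends_belowD[OF assms(2)]) auto
    then show ?thesis
      using defN_project_many[of n d P] L assms(3) by (simp add: d)
  qed
qed

text \<open>Quantifiers in de Bruijn style: the entry 0 is the bound variable, and the outer variables
  are shifted by one.\<close>

lemma definable_ex [def_intros]:
  assumes "definable (\<lambda>x. Q (\<lambda>i. x (Suc i)) (x 0))"
  shows "definable (\<lambda>x. \<exists>t. Q x t)"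
proof -
  define P where "P x = Q (\<lambda>i. x (Suc i)) (x 0)" for x
  obtain k where "defN k P" using assms unfolding P_def definable_def by blast
  define M where "M = Suc k"
  \<comment> \<open>Projection eliminates the last variable, so the bound entry 0 is moved to
    position \<open>M\<close>, beyond every outer entry that matters.\<close>
  define P' where "P' x = P (\<lambda>i. if i = 0 then x M else x (i - 1))" for x
  have "definable P" using \<open>defN k P\<close> unfolding definable_def by blast
  then have "definable P'" unfolding P'_def
    by (rule definable_subst) (intro def_intros)
  have kP: "depends_below k P" "k \<ge> 1" using \<open>defN k P\<close> by (auto simp: defN_def)
  have dep: "depends_below (Suc M) P'"
    unfolding depends_below_def P'_def
  proof (intro allI impI)
    fix x y :: "nat \<Rightarrow> real" assume "\<forall>i<Suc M. x i = y i"
    then show "P (\<lambda>i. if i = 0 then x M else x (i - 1)) = P (\<lambda>i. if i = 0 then y M else y (i - 1))"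
      by (intro depends_belowD[OF kP(1)]) (auto simp: M_def)
  qed
  have down: "defN (Suc M) P'" by (rule defN_of_definable[OF \<open>definable P'\<close> dep]) simp
  have "defN M (\<lambda>x. \<exists>t. P' (x(M := t)))"
    by (rule defN_project[OF down]) (simp add: M_def)
  moreover have "P' (x(M := t)) = Q x t" for x t
  proof -
    have "P' (x(M := t)) = P (\<lambda>i. if i = 0 then t else x (i - 1))"
      unfolding P'_def by (rule depends_belowD[OF kP(1)]) (auto simp: M_def)
    then show ?thesis by (simp add: P_def)
  qed
  ultimately show ?thesis unfolding definable_def by auto
qed

lemma definable_all [def_intros]:
  assumes "definable (\<lambda>x. Q (\<lambda>i. x (Suc i)) (x 0))"
  shows "definable (\<lambda>x. \<forall>t. Q x t)"
  using definable_not[OF definable_ex[of "\<lambda>x t. \<not> Q x t", OF definable_not[OF assms]]] by simp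

end

section \<open>Uniform finiteness\<close>

definition tame1 :: "real set \<Rightarrow> bool" where
  "tame1 U \<longleftrightarrow> (\<exists>F. finite F \<and> (\<forall>J\<in>F. open_interval_or_point J) \<and> U = \<Union>F)"

text \<open>One of the finitely many pieces is infinite, hence an interval that contains two
  distinct points.\<close>

lemma tame1_infinite_imp_interval:
  assumes "tame1 U" "infinite U"
  obtains a b where "a < b" "{a<..<b} \<subseteq> U"
proof -
  obtain F where F: "finite F" "\<forall>J\<in>F. open_interval_or_point J" "U = \<Union>F"
    using assms(1) unfolding tame1_def by blast
  then obtain J where J: "J \<in> F" "infinite J" using assms(2) by blast
  then obtain l u :: ereal where lu: "J = {x. l < ereal x \<and> ereal x < u}"
    using F(2) unfolding open_interval_or_point_def by fastforce
  from J(2) obtain x where x: "x \<in> J" by fastforce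
  from J(2) have "infinite (J - {x})" by simp
  then obtain y where y: "y \<in> J" "y \<noteq> x" by (metis Diff_iff finite.emptyI insertI1 ex_in_conv)
  have "{min x y<..<max x y} \<subseteq> J"
  proof
    fix z assume "z \<in> {min x y<..<max x y}"
    then have "ereal (min x y) < ereal z" "ereal z < ereal (max x y)" unfolding less_ereal.simps by auto
    moreover have "l < ereal (min x y)" "ereal (max x y) < u"
      using x y by (auto simp: lu min_def max_def)
    ultimately show "z \<in> J" unfolding lu by (blast intro: less_trans)
  qed
  then have "{min x y<..<max x y} \<subseteq> U" using J(1) F(3) by blast
  moreover have "min x y < max x y" using y(2) by (simp add: min_def max_def)
  ultimately show thesis using that by blast
qed

lemma tame1_finite_frontier:
  assumes "tame1 U"
  shows "finite (frontier U)"
proof -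
  have *: "finite {x. ereal x = l}" for l
    by (rule finite_subset[of _ "{real_of_ereal l}"]) auto
  have J: "finite (frontier J)" if "open_interval_or_point J" for J
  proof -
    from that show ?thesis unfolding open_interval_or_point_def
    proof (elim disjE exE)
      fix l u :: ereal assume 1: "J = {x. l < ereal x \<and> ereal x < u}"
      have "open J" unfolding 1 by (intro open_Collect_conj open_Collect_less continuous_intros)
      moreover have "closed {x. l \<le> ereal x \<and> ereal x \<le> u}"
        by (intro closed_Collect_conj closed_Collect_le continuous_intros)
      then have "closure J \<subseteq> {x. l \<le> ereal x \<and> ereal x \<le> u}"
        by (intro closure_minimal) (auto simp: 1)
      ultimately have "frontier J \<subseteq> {x. ereal x = l} \<union> {x. ereal x = u}"
        unfolding frontier_def by (auto simp: 1 interior_open)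
      then show ?thesis using * finite_subset by (metis finite_Un)
    qed (simp add: frontier_def)
  qed
  obtain F where F: "finite F" "\<forall>J\<in>F. open_interval_or_point J" "U = \<Union>F"
    using assms unfolding tame1_def by blast
  have "finite (\<Union>(frontier ` F))" using F J by auto
  then show ?thesis using frontier_Union_subset[OF F(1)] F(3) finite_subset by blast
qed

text \<open>Pieces may be empty, so \<open>h\<close> is only an upper bound for their number;
  disjointness makes measures add up over the pieces.\<close>

definition interval_union :: "nat \<Rightarrow> real set \<Rightarrow> bool" where
  "interval_union h U \<longleftrightarrow>
     (\<exists>J. (\<forall>k<h. is_interval (J k)) \<and> disjoint_family_on J {..<h} \<and> U = (\<Union>k<h. J k))"

text \<open>\<open>N\<close> frontier points cut the line into \<open>N\<close> points and
  \<open>N + 1\<close> gaps, and a connected gap lies inside or outside \<open>U\<close>. The rank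
  \<open>r\<close> numbers these pieces from left to right: it is even on gaps and odd at frontier
  points.\<close>

lemma interval_union_if_card_frontier:
  assumes fin: "finite (frontier U)" and N: "card (frontier U) \<le> N"
  shows "interval_union (2 * N + 1) U"
proof -
  define E where "E = frontier U"
  define r where "r x = card {e\<in>E. e < x} + card {e\<in>E. e \<le> x}" for x
  have finE: "finite E" "card E \<le> N" using assms by (auto simp: E_def)
  have mono: "card {e\<in>E. e < x} \<le> card {e\<in>E. e < y}" "card {e\<in>E. e \<le> x} \<le> card {e\<in>E. e \<le> y}"
    if "x \<le> y" for x y
    using that finE by (auto intro!: card_mono)
  have le: "r x < 2 * N + 1" for x
  proof -
    have "card {e\<in>E. e < x} \<le> card E" "card {e\<in>E. e \<le> x} \<le> card E"
      using finE by (auto intro!: card_mono)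
    then show ?thesis using finE unfolding r_def by linarith
  qed
  define J where "J k = {x\<in>U. r x = k}" for k
  have "is_interval (J k)" for k
    unfolding is_interval_1
  proof (intro ballI allI impI)
    fix x y z assume x: "x \<in> J k" and y: "y \<in> J k" and z: "x \<le> z \<and> z \<le> y"
    \<comment> \<open>Both counts are monotone and their sum is \<open>k\<close> at \<open>x\<close>
      and at \<open>y\<close>, so each of them agrees separately.\<close>
    have eq: "card {e\<in>E. e < x} = card {e\<in>E. e < y}" "card {e\<in>E. e \<le> x} = card {e\<in>E. e \<le> y}"
      "r z = k"
      using mono[of x y] mono[of x z] mono[of z y] x y z unfolding J_def r_def by auto
    have "{e\<in>E. e < x} = {e\<in>E. e < y}"
      by (rule card_subset_eq) (use z finE eq in auto)
    then have E1: "e < x" if "e \<in> E" "e < y" for e using that by blast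
    have "{e\<in>E. e \<le> x} = {e\<in>E. e \<le> y}"
      by (rule card_subset_eq) (use z finE eq in auto)
    then have E2: "e \<le> x" if "e \<in> E" "e \<le> y" for e using that by blast
    have "e \<notin> E" if "x \<le> e" "e \<le> y" "x \<noteq> y" for e
      using that E1[of e] E2[of e] by force
    moreover have "z = x" if "x = y" using that z by simp
    moreover have "z \<in> U" if "{x..y} \<inter> E = {}"
    proof (rule ccontr)
      assume "z \<notin> U"
      then have "z \<in> {x..y} - U" "x \<in> {x..y} \<inter> U" using x z by (simp_all add: J_def)
      then have "{x..y} \<inter> frontier U \<noteq> {}"
        by (intro connected_Int_frontier connected_Icc) blast+
      then show False using that by (simp add: E_def)
    qed
    ultimately have "z \<in> U" using x unfolding J_def by fastforce
    then show "z \<in> J k" using eq by (simp add: J_def)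
  qed
  moreover have "disjoint_family_on J {..<2 * N + 1}"
    unfolding disjoint_family_on_def J_def by auto
  moreover have "U = (\<Union>k<2 * N + 1. J k)" using le by (auto simp: J_def)
  ultimately show ?thesis unfolding interval_union_def by blast
qed

lemma interval_union_mono:
  assumes "interval_union h U" "h \<le> h'"
  shows "interval_union h' U"
proof -
  obtain J where J: "\<forall>k<h. is_interval (J k)" "disjoint_family_on J {..<h}" "U = (\<Union>k<h. J k)"
    using assms(1) unfolding interval_union_def by blast
  have "\<forall>k<h'. is_interval (if k < h then J k else {})" using J(1) by simp
  moreover have "disjoint_family_on (\<lambda>k. if k < h then J k else {}) {..<h'}"
    using J(2) by (auto simp: disjoint_family_on_def)
  moreover have "U = (\<Union>k<h'. if k < h then J k else {})" using J(3) assms(2) by force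
  ultimately show ?thesis
    unfolding interval_union_def by (intro exI[of _ "\<lambda>k. if k < h then J k else {}"]) blast
qed

text \<open>At a good parameter the fibres of \<open>C\<close> near \<open>t\<close> are matched bijectively with the fibre at
  \<open>t\<close> by proximity, so their cardinality is locally constant, and this condition is first-order.\<close>

definition good :: "(real \<Rightarrow> real \<Rightarrow> bool) \<Rightarrow> real \<Rightarrow> bool" where
  "good C t \<longleftrightarrow> (\<exists>d e. d > 0 \<and> e > 0 \<and> (\<forall>u. u - t < e \<and> t - u < e \<longrightarrow>
     (\<forall>y. C t y \<longrightarrow> (\<exists>!z. C u z \<and> y - z < d \<and> z - y < d)) \<and>
     (\<forall>z. C u z \<longrightarrow> (\<exists>!y. C t y \<and> y - z < d \<and> z - y < d))))"

lemma good_card_locally_constant: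
  assumes "good C t"
  shows "\<exists>e>0. \<forall>u. \<bar>u - t\<bar> < e \<longrightarrow> card {y. C u y} = card {y. C t y}"
proof -
  obtain d e where e: "e > 0" and *: "\<And>u. \<bar>u - t\<bar> < e \<Longrightarrow>
     (\<forall>y. C t y \<longrightarrow> (\<exists>!z. C u z \<and> y - z < d \<and> z - y < d)) \<and>
     (\<forall>z. C u z \<longrightarrow> (\<exists>!y. C t y \<and> y - z < d \<and> z - y < d))"
    using assms unfolding good_def by (auto simp: abs_less_iff)
  have "card {y. C u y} = card {y. C t y}" if "\<bar>u - t\<bar> < e" for u
  proof -
    from *[OF that] have 1: "\<And>y. C t y \<Longrightarrow> \<exists>!z. C u z \<and> y - z < d \<and> z - y < d"
      and 2: "\<And>z. C u z \<Longrightarrow> \<exists>!y. C t y \<and> y - z < d \<and> z - y < d" by blast+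
    obtain f where f: "\<And>y. C t y \<Longrightarrow> C u (f y) \<and> y - f y < d \<and> f y - y < d"
      using 1 by metis
    obtain g where g: "\<And>z. C u z \<Longrightarrow> C t (g z) \<and> g z - z < d \<and> z - g z < d"
      using 2 by metis
    have "g (f y) = y" if "C t y" for y using 2[of "f y"] f[OF that] g[of "f y"] that by blast
    moreover have "f (g z) = z" if "C u z" for z using 1[of "g z"] g[OF that] f[of "g z"] that by blast
    ultimately have "bij_betw f {y. C t y} {y. C u y}"
      using f g by (intro bij_betwI[where g = g]) auto
    then show ?thesis by (simp add: bij_betw_same_card)
  qed
  then show ?thesis using e by blast
qed

text \<open>A code records which cells \<open>[i/m, (i+1)/m)\<close> meet a finite set, for a grid fine enough that
  distinct points are separated by an empty cell. There are only countably many codes, and a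
  parameter is good as soon as the code is constant nearby.\<close>

definition separated :: "int set \<Rightarrow> bool" where
  "separated F \<longleftrightarrow> (\<forall>i\<in>F. \<forall>j\<in>F. i < j \<longrightarrow> i + 2 \<le> j)"

text \<open>The existence of a cell in \<open>F\<close> is written as a negated universal statement
  so that \<open>definable_finite_ball\<close> applies.\<close>

definition code :: "nat \<Rightarrow> int set \<Rightarrow> (real \<Rightarrow> bool) \<Rightarrow> bool" where
  "code m F Y \<longleftrightarrow>
     (\<forall>y. Y y \<longrightarrow> \<not> (\<forall>i\<in>F. \<not> (of_int i \<le> of_nat m * y \<and> of_nat m * y < of_int i + 1))) \<and>
     (\<forall>i\<in>F. \<exists>!y. Y y \<and> of_int i \<le> of_nat m * y \<and> of_nat m * y < of_int i + 1)"

lemma code_exists: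
  assumes "finite {y. Y y}"
  shows "\<exists>m F. m > 0 \<and> finite F \<and> separated F \<and> code m F Y"
proof -
  \<comment> \<open>Scaled distances above 3 force the floors apart by more than 2, which leaves an
    empty cell. For \<open>y = z\<close> the quotient is 0 by convention and does no harm. The
    element 1 inserted below makes \<open>m\<close> positive.\<close>
  define D where "D = (\<lambda>(y, z). 3 / \<bar>y - z\<bar>) ` ({y. Y y} \<times> {y. Y y})"
  have "finite D" using assms by (simp add: D_def)
  obtain m :: nat where m: "Max (insert 1 D) < m" using reals_Archimedean2 by blast
  have m': "x < m" if "x \<in> insert 1 D" for x
    by (rule le_less_trans[OF Max_ge m]) (use \<open>finite D\<close> that in auto)
  then have m0: "m > 0" using m'[of 1] by simp
  have sep: "real m * \<bar>y - z\<bar> > 3" if "Y y" "Y z" "y \<noteq> z" for y z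
  proof -
    have "3 / \<bar>y - z\<bar> < m" by (rule m') (use that in \<open>auto simp: D_def\<close>)
    then show ?thesis using that by (simp add: field_simps)
  qed
  define fl where "fl y = \<lfloor>real m * y\<rfloor>" for y
  have cell: "of_int i \<le> of_nat m * y \<and> of_nat m * y < of_int i + 1 \<longleftrightarrow> i = fl y" for i y
    unfolding fl_def using floor_eq_iff[of "real m * y" i] by auto
  have floors: "fl y + 2 \<le> fl z" if "Y y" "Y z" "y < z" for y z
  proof -
    have "real m * z - real m * y > 3"
      using sep[of y z] that by (simp add: abs_if right_diff_distrib split: if_splits)
    then show ?thesis unfolding fl_def by linarith
  qed
  have mono: "fl y \<le> fl z" if "y \<le> z" for y z
    unfolding fl_def using that m0 by (intro floor_mono mult_left_mono) auto
  have inj: "y = z" if "Y y" "Y z" "fl y = fl z" for y z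
    using floors[of y z] floors[of z y] that by (cases y z rule: linorder_cases) auto
  define F where "F = fl ` {y. Y y}"
  have "separated F"
    unfolding separated_def F_def
  proof (intro ballI impI)
    fix i j assume "i \<in> fl ` {y. Y y}" "j \<in> fl ` {y. Y y}" "i < j"
    then obtain y z where "i = fl y" "j = fl z" "Y y" "Y z" by blast
    then show "i + 2 \<le> j" using floors[of y z] mono[of z y] \<open>i < j\<close> by (cases "y < z") auto
  qed
  moreover have "code m F Y"
    unfolding code_def cell using inj by (fastforce simp: F_def)
  moreover have "finite F" using assms by (simp add: F_def)
  ultimately show ?thesis using m0 by blast
qed

text \<open>Points in the same cell are closer than \<open>1 / m\<close>, points in cells whose
  indices differ by at least 2 are farther apart. Since \<open>F\<close> is separated, being close
  is the same as sharing a cell, and each cell of \<open>F\<close> contains one point of either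
  set.\<close>

lemma code_match:
  assumes "m > 0" "separated F" "code m F Y" "code m F Z" "Y y"
  shows "\<exists>!z. Z z \<and> y - z < 1 / real m \<and> z - y < 1 / real m"
proof -
  define fl where "fl y = \<lfloor>real m * y\<rfloor>" for y
  have cell: "of_int i \<le> of_nat m * y \<and> of_nat m * y < of_int i + 1 \<longleftrightarrow> i = fl y" for i y
    unfolding fl_def using floor_eq_iff[of "real m * y" i] by auto
  have Y: "fl y \<in> F" and Z: "\<And>i. i \<in> F \<Longrightarrow> \<exists>!z. Z z \<and> i = fl z" "\<And>z. Z z \<Longrightarrow> fl z \<in> F"
    using assms(3-5) unfolding code_def cell by blast+
  have lt: "u < 1 / real m \<longleftrightarrow> real m * u < 1" for u
    using assms(1) by (simp add: field_simps)
  have near: "y - z < 1 / real m \<and> z - y < 1 / real m" if "fl z = fl y" for z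
    using that unfolding lt right_diff_distrib fl_def by linarith
  have same: "fl z = fl y" if "Z z" "y - z < 1 / real m \<and> z - y < 1 / real m" for z
  proof (rule ccontr)
    assume "fl z \<noteq> fl y"
    then have "fl z + 2 \<le> fl y \<or> fl y + 2 \<le> fl z"
      using Y Z(2)[OF that(1)] assms(2) unfolding separated_def by (metis linorder_neqE)
    then show False
      using that(2) unfolding lt right_diff_distrib fl_def by linarith
  qed
  show ?thesis using Z(1)[OF Y] near same by metis
qed

text \<open>Were infinitely many parameters bad, they would fill an interval. Countably many codes
  cover it, so some code is valid at infinitely many of its points and, by tameness, on a whole
  subinterval. There \<open>code_match\<close> makes the midpoint good.\<close>

lemma finite_bad:
  assumes fin: "\<And>t. finite {y. C t y}"
    and bad: "tame1 {t. \<not> good C t}"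
    and codes: "\<And>a b m F. finite F \<Longrightarrow> tame1 {t. a < t \<and> t < b \<and> code m F (C t)}"
  shows "finite {t. \<not> good C t}"
proof (rule ccontr)
  assume "infinite {t. \<not> good C t}"
  then obtain a b where ab: "a < b" "{a<..<b} \<subseteq> {t. \<not> good C t}"
    using tame1_infinite_imp_interval[OF bad] by blast
  define K :: "(nat \<times> int set) set" where "K = {(m, F). m > 0 \<and> finite F \<and> separated F}"
  define X where "X = (\<lambda>(m, F). {t. a < t \<and> t < b \<and> code m F (C t)})"
  have "countable ((UNIV :: nat set) \<times> {F :: int set. finite F})"
    by (intro countable_SIGMA countable_Collect_finite) auto
  then have "countable K" by (rule countable_subset[rotated]) (auto simp: K_def)
  have "{a<..<b} \<subseteq> (\<Union>k\<in>K. X k)"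
    using code_exists[OF fin] by (fastforce simp: K_def X_def)
  moreover have "uncountable {a<..<b}" using ab(1) by (simp add: uncountable_open_interval)
  ultimately have "\<exists>k\<in>K. infinite (X k)"
    using \<open>countable K\<close> by (meson countable_UN countable_finite countable_subset)
  then obtain m F where mF: "m > 0" "finite F" "separated F" "infinite (X (m, F))"
    by (auto simp: K_def)
  then obtain c d where cd: "c < d" "{c<..<d} \<subseteq> X (m, F)"
    using tame1_infinite_imp_interval[OF codes[OF mF(2), of a b m]] by (auto simp: X_def)
  define t where "t = (c + d) / 2"
  have t: "t \<in> {c<..<d}" using cd(1) by (auto simp: t_def field_simps)
  have "good C t"
    unfolding good_def
  \<comment> \<open>The tolerance is the width of the grid; \<open>(d - c) / 2\<close> is the
    distance from the midpoint to the ends of the subinterval.\<close>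
  proof (rule exI[of _ "1 / real m"], rule exI[of _ "(d - c) / 2"], intro conjI allI impI)
    fix u assume u: "u - t < (d - c) / 2 \<and> t - u < (d - c) / 2"
    then have "u < d" "c < u" unfolding t_def by argo+
    then have cu: "code m F (C u)" and ct: "code m F (C t)" using cd(2) t by (auto simp: X_def)
    show "\<exists>!z. C u z \<and> y - z < 1 / real m \<and> z - y < 1 / real m" if "C t y" for y
      by (rule code_match[OF mF(1,3) ct cu that])
    show "\<exists>!y. C t y \<and> y - z < 1 / real m \<and> z - y < 1 / real m" if "C u z" for z
      using code_match[OF mF(1,3) cu ct that] by (simp add: conj_commute)
  qed (use mF cd in auto)
  moreover have "t \<in> {a<..<b}" using cd t by (auto simp: X_def)
  then have "\<not> good C t" using ab(2) by blast
  ultimately show False by simp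
qed

lemma card_constant_between:
  assumes "\<And>u. u \<in> closed_segment c t \<Longrightarrow> good C u"
  shows "card {y. C c y} = card {y. C t y}"
proof (rule connected_local_const[of "closed_segment c t"])
  show "\<forall>a\<in>closed_segment c t. \<forall>\<^sub>F b in at a within closed_segment c t.
      card {y. C a y} = card {y. C b y}"
  proof
    fix a assume "a \<in> closed_segment c t"
    then obtain e where "e > 0" "\<forall>u. \<bar>u - a\<bar> < e \<longrightarrow> card {y. C u y} = card {y. C a y}"
      using good_card_locally_constant assms by blast
    then show "\<forall>\<^sub>F b in at a within closed_segment c t. card {y. C a y} = card {y. C b y}"
      unfolding eventually_at by (metis dist_real_def)
  qed
qed auto

section \<open>Bounds for finite fibres by induction on the number of parameters\<close>

context o_minimal_semialgebraic
begin

lemma definable_tame1: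
  assumes "definable (\<lambda>x. Q (x 0))"
  shows "tame1 {t. Q t}"
proof -
  have "depends_below 1 (\<lambda>x. Q (x (0::nat)))" by (simp add: depends_below_def)
  then have "{x \<in> Rn 1. Q (x 0)} \<in> S 1"
    using defN_of_definable[OF assms] by (simp add: defN_def)
  from tame[OF this] obtain F where F: "finite F" "\<forall>J\<in>F. open_interval_or_point J"
    "(\<lambda>x. x 0) ` {x \<in> Rn 1. Q (x 0)} = \<Union>F" by blast
  have "(\<lambda>x. x 0) ` {x \<in> Rn 1. Q (x 0)} = {t. Q t}"
  proof (intro equalityI subsetI)
    fix t assume "t \<in> {t. Q t}"
    then show "t \<in> (\<lambda>x. x 0) ` {x \<in> Rn 1. Q (x 0)}"
      using restrict_mem_Rn[of "\<lambda>_. t" 1] by (intro image_eqI[of _ _ "\<lambda>_\<in>{..<1}. t"]) auto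
  qed auto
  then show ?thesis using F unfolding tame1_def by metis
qed

text \<open>Entry 0 holds the fibre variable and the parameters follow, in agreement with the
  convention for quantifiers.\<close>

definition definable_family :: "((nat \<Rightarrow> real) \<Rightarrow> real \<Rightarrow> bool) \<Rightarrow> bool" where
  "definable_family A \<longleftrightarrow> definable (\<lambda>x. A (\<lambda>i. x (Suc i)) (x 0))"

lemma definable_familyI [def_intros]:
  "definable (\<lambda>x. A (\<lambda>i. x (Suc i)) (x 0)) \<Longrightarrow> definable_family A"
  unfolding definable_family_def .

text \<open>Lets a definable family occur as an atom of a larger formula, with polynomials as
  arguments.\<close>

lemma definable_app:
  assumes "definable_family A" and f: "\<And>i. polynomial (f i)" and g: "polynomial g"
  shows "definable (\<lambda>x. A (\<lambda>i. f i x) (g x))"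
proof -
  have "polynomial (case_nat g f i)" for i using f g by (cases i) auto
  from definable_subst[OF assms(1)[unfolded definable_family_def], of "case_nat g f", OF this]
  show ?thesis by simp
qed

lemma definable_ex1 [def_intros]:
  assumes "definable (\<lambda>x. Q (\<lambda>i. x (Suc i)) (x 0))"
    and "definable (\<lambda>x. Q (\<lambda>i. x (Suc (Suc i))) (x 0))"
  shows "definable (\<lambda>x. \<exists>!t. Q x t)"
  unfolding Ex1_def by (intro def_intros assms)

lemma definable_code:
  assumes "definable_family A" "finite F"
  shows "definable_family (\<lambda>s t. code m F (A (\<lambda>i. if i = n then t else s i)))"
  unfolding code_def by (intro def_intros definable_app[OF assms(1)] assms(2))

lemma definable_good:
  assumes "definable_family A"
  shows "definable_family (\<lambda>s. good (\<lambda>t. A (\<lambda>i. if i = n then t else s i)))"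
  unfolding good_def[abs_def] by (intro def_intros definable_app[OF assms])

lemma tame1_fibre:
  assumes "definable_family A"
  shows "tame1 {t. A s t}"
  by (intro definable_tame1 definable_app[OF assms] def_intros)

lemma finite_fibres_bounded_aux:
  assumes "definable_family A" "depends_below n A" "\<And>s. finite {t. A s t}"
  shows "\<exists>N. \<forall>s. card {t. A s t} \<le> N"
  using assms
proof (induction n arbitrary: A)
  case 0
  have "A s = A (\<lambda>_. 0)" for s by (rule depends_belowD[OF 0(2)]) simp
  then have "card {t. A s t} \<le> card {t. A (\<lambda>_. 0) t}" for s by (metis order_refl)
  then show ?case by blast
next
  case (Suc n)
  define B where "B s t = A (\<lambda>i. if i = n then t else s i)" for s t
  define bad where "bad s t \<longleftrightarrow> \<not> good (B s) t" for s t
  define cut where "cut s c \<longleftrightarrow>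
     (\<exists>e e'. bad s e \<and> bad s e' \<and> 2 * c = e + e') \<or> 
     (\<exists>e. bad s e \<and> (c = e + 1 \<or> c = e - 1)) \<or> c = 0" for s c
  \<comment> \<open>The union of the fibres over all samples no longer involves entry
    \<open>n\<close>, and it contains a fibre of the same cardinality as any given fibre on this
    line.\<close>
  define A' where "A' s y \<longleftrightarrow> (\<exists>c. cut s c \<and> B s c y)" for s y
  have finB: "finite {y. B s t y}" for s t using Suc.prems(3) by (simp add: B_def)
  have defbad: "definable_family bad"
    unfolding bad_def B_def
    by (intro def_intros definable_app[OF definable_good[OF Suc.prems(1)]])
  have defcut: "definable_family cut"
    unfolding cut_def by (intro def_intros definable_app[OF defbad])
  have defA': "definable_family A'"
    unfolding A'_def B_def by (intro def_intros definable_app[OF defcut] definable_app[OF Suc.prems(1)])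
  have finbad: "finite {t. bad s t}" for s
    unfolding bad_def
  proof (rule finite_bad[OF finB])
    show "tame1 {t. \<not> good (B s) t}" using tame1_fibre[OF defbad, of s] by (simp add: bad_def)
    fix a b m and F :: "int set" assume "finite F"
    then show "tame1 {t. a < t \<and> t < b \<and> code m F (B s t)}"
      unfolding B_def
      by (intro definable_tame1 def_intros definable_app[OF definable_code[OF Suc.prems(1)]])
  qed
  have fincut: "finite {c. cut s c}" for s
  proof (rule finite_subset)
    show "{c. cut s c} \<subseteq> (\<lambda>(e, e'). (e + e') / 2) ` ({t. bad s t} \<times> {t. bad s t}) \<union>
        (\<lambda>e. e + 1) ` {t. bad s t} \<union> (\<lambda>e. e - 1) ` {t. bad s t} \<union> {0}"
      unfolding cut_def by (force simp: image_iff)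
  qed (use finbad in auto)
  have finA': "finite {y. A' s y}" for s
  proof -
    have "{y. A' s y} = (\<Union>c\<in>{c. cut s c}. {y. B s c y})" by (auto simp: A'_def)
    then show ?thesis using fincut finB by auto
  qed
  have "depends_below n B"
    unfolding B_def
    unfolding depends_below_def
  proof (intro allI impI ext)
    fix x y :: "nat \<Rightarrow> real" and t assume "\<forall>i<n. x i = y i"
    then have "A (\<lambda>i. if i = n then t else x i) = A (\<lambda>i. if i = n then t else y i)"
      by (intro depends_belowD[OF Suc.prems(2)]) auto
    then show "A (\<lambda>i. if i = n then t else x i) z = A (\<lambda>i. if i = n then t else y i) z" for z
      by simp
  qed
  then have "depends_below n A'"
    unfolding depends_below_def
  proof (intro allI impI ext)
    fix x y :: "nat \<Rightarrow> real" and t assume xy: "\<forall>i<n. x i = y i"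
    have "B x = B y" by (rule depends_belowD[OF \<open>depends_below n B\<close>]) (use xy in auto)
    then show "A' x t = A' y t" unfolding A'_def cut_def bad_def by simp
  qed
  from Suc.IH[OF defA' this finA'] obtain N where N: "\<And>s. card {y. A' s y} \<le> N" by blast
  have "card {y. A s y} \<le> N" for s
  proof -
    define t where "t = s n"
    have AB: "A s = B s t" unfolding B_def t_def by (intro arg_cong[where f = A]) auto
    have "\<exists>c. cut s c \<and> (c = t \<or> (\<forall>u\<in>closed_segment c t. \<not> bad s u))"
    proof (cases "bad s t")
      case True
      then have "cut s t" unfolding cut_def by (intro disjI1 exI[of _ t]) auto
      then show ?thesis by blast
    next
      case False
      define lo hi where "lo = {e. bad s e \<and> e < t}" and "hi = {e. bad s e \<and> t < e}"
      have fin: "finite lo" "finite hi" using finbad[of s] by (auto simp: lo_def hi_def)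
      have lo: "bad s (Max lo)" "Max lo < t" if "lo \<noteq> {}"
        using Max_in[OF fin(1) that] by (auto simp: lo_def)
      have lo': "u \<le> Max lo" if "bad s u" "u < t" for u
        by (rule Max_ge[OF fin(1)]) (use that in \<open>auto simp: lo_def\<close>)
      have hi: "bad s (Min hi)" "t < Min hi" if "hi \<noteq> {}"
        using Min_in[OF fin(2) that] by (auto simp: hi_def)
      have hi': "u \<ge> Min hi" if "bad s u" "t < u" for u
        by (rule Min_le[OF fin(2)]) (use that in \<open>auto simp: hi_def\<close>)
      \<comment> \<open>The sample in the gap around \<open>t\<close>, between the nearest bad
        parameters on both sides as far as they exist.\<close>
      define c where "c = (if lo = {} then if hi = {} then 0 else Min hi - 1
          else if hi = {} then Max lo + 1 else (Max lo + Min hi) / 2)"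
      have "cut s c"
      proof (cases "lo = {}"; cases "hi = {}")
        assume *: "lo \<noteq> {}" "hi \<noteq> {}"
        then have "2 * c = Max lo + Min hi" by (simp add: c_def)
        then show ?thesis unfolding cut_def using lo(1) hi(1) * by blast
      next
        assume *: "lo \<noteq> {}" "hi = {}"
        then have "c = Max lo + 1" by (simp add: c_def)
        then show ?thesis unfolding cut_def using lo(1) * by blast
      next
        assume *: "lo = {}" "hi \<noteq> {}"
        then have "c = Min hi - 1" by (simp add: c_def)
        then show ?thesis unfolding cut_def using hi(1) * by blast
      qed (simp add: c_def cut_def)
      moreover have "\<not> bad s u" if "u \<in> closed_segment c t" for u
      proof
        assume b: "bad s u"
        then have "u \<noteq> t" using False by (metis (full_types))
        then consider "u < t" "lo \<noteq> {}" | "t < u" "hi \<noteq> {}"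
          using b by (cases u t rule: linorder_cases) (auto simp: lo_def hi_def)
        then show False
        proof cases
          case 1
          then show False using lo'[OF b] lo hi that unfolding c_def closed_segment_eq_real_ivl
            by (auto split: if_splits)
        next
          case 2
          then show False using hi'[OF b] lo hi that unfolding c_def closed_segment_eq_real_ivl
            by (auto split: if_splits)
        qed
      qed
      ultimately show ?thesis by blast
    qed
    then obtain c where c: "cut s c" "c = t \<or> (\<forall>u\<in>closed_segment c t. \<not> bad s u)" by blast
    then have "card {y. B s c y} = card {y. B s t y}"
      using card_constant_between[of c t "B s"] unfolding bad_def by blast
    moreover have "card {y. B s c y} \<le> card {y. A' s y}"
      by (rule card_mono[OF finA']) (use c in \<open>auto simp: A'_def\<close>)
    ultimately show ?thesis using N[of s] AB by simp
  qed
  then show ?case by blast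
qed

lemma definable_family_depends:
  assumes "definable_family A"
  shows "\<exists>n. depends_below n A"
proof -
  obtain n where n: "depends_below n (\<lambda>x. A (\<lambda>i. x (Suc i)) (x 0))"
    using assms unfolding definable_family_def definable_def defN_def by blast
  have "depends_below n A"
    unfolding depends_below_def
  proof (intro allI impI ext)
    fix x y :: "nat \<Rightarrow> real" and t assume "\<forall>i<n. x i = y i"
    then show "A x t = A y t"
      using depends_belowD[OF n, of "case_nat t x" "case_nat t y"] by (auto split: nat.splits)
  qed
  then show ?thesis by blast
qed

theorem finite_fibres_bounded:
  assumes "definable_family A" "\<And>s. finite {t. A s t}"
  shows "\<exists>N. \<forall>s. card {t. A s t} \<le> N"
  using finite_fibres_bounded_aux definable_family_depends assms by blast

theorem uniform_interval_union:
  assumes "definable_family A"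
  shows "\<exists>h. \<forall>s. interval_union h {t. A s t}"
proof -
  define Fr where "Fr s y \<longleftrightarrow> (\<forall>e. e > 0 \<longrightarrow> (\<exists>u. y - e < u \<and> u < y + e \<and> A s u) \<and>
    (\<exists>u. y - e < u \<and> u < y + e \<and> \<not> A s u))" for s y
  have "definable_family Fr"
    unfolding Fr_def by (intro def_intros definable_app[OF assms])
  moreover have Fr: "{y. Fr s y} = frontier {t. A s t}" for s
  proof -
    have *: "dist y u < e \<longleftrightarrow> y - e < u \<and> u < y + e" for y u e :: real
      by (auto simp: dist_real_def)
    show ?thesis unfolding set_eq_iff mem_Collect_eq frontier_straddle Fr_def * by auto
  qed
  moreover have "finite (frontier {t. A s t})" for s
    by (intro tame1_finite_frontier tame1_fibre assms)
  ultimately obtain N where "\<And>s. card (frontier {t. A s t}) \<le> N"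
    using finite_fibres_bounded[of Fr] by auto
  then show ?thesis
    using interval_union_if_card_frontier \<open>\<And>s. finite (frontier {t. A s t})\<close> by blast
qed

end

section \<open>Definable sets are Borel\<close>

abbreviation \<Omega> :: "(nat \<Rightarrow> real) measure" where
  "\<Omega> \<equiv> Pi\<^sub>M UNIV (\<lambda>_. borel)"

text \<open>\<open>G x t\<close> marks the exceptional points of the slice in direction
  \<open>n\<close>: those in the slice but not interior to it. \<open>P x\<close> holds if a
  rational interval around \<open>x n\<close> lies in the slice, or if \<open>x n\<close> is
  exceptional. In the latter case, finiteness gives a rational window without other exceptional
  points, and comparison with all rational \<open>s\<close> identifies the one in the window with
  \<open>x n\<close>. The measurability hypotheses concern predicates that ignore
  \<open>x n\<close>, and countably many of them are combined.\<close>

lemma borel_pred_from_slices: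
  fixes P :: "(nat \<Rightarrow> real) \<Rightarrow> bool" and n :: nat
  defines "G \<equiv> \<lambda>x t. P (x(n := t)) \<and> \<not> (\<exists>q r. q < t \<and> t < r \<and> (\<forall>u. q < u \<and> u < r \<longrightarrow> P (x(n := u))))"
  assumes fin: "\<And>x. finite {t. G x t}"
    and I: "\<And>q r. Measurable.pred \<Omega> (\<lambda>x. \<forall>u. q < u \<and> u < r \<longrightarrow> P (x(n := u)))"
    and U: "\<And>q r. Measurable.pred \<Omega> (\<lambda>x. \<exists>!t. q < t \<and> t < r \<and> G x t)"
    and L: "\<And>q r s. Measurable.pred \<Omega> (\<lambda>x. \<exists>t. q < t \<and> t < r \<and> t \<le> s \<and> G x t)"
  shows "Measurable.pred \<Omega> P"
proof -
  have [measurable]: "(\<lambda>x. x n) \<in> borel_measurable \<Omega>" by measurable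
  note [measurable] = I U L
  let ?R = "real_of_rat"
  have iff: "P x \<longleftrightarrow>
    (\<exists>q r. ?R q < x n \<and> x n < ?R r \<and> (\<forall>u. ?R q < u \<and> u < ?R r \<longrightarrow> P (x(n := u)))) \<or>
    (\<exists>q r. ?R q < x n \<and> x n < ?R r \<and> (\<exists>!t. ?R q < t \<and> t < ?R r \<and> G x t) \<and>
      (\<forall>s. (\<exists>t. ?R q < t \<and> t < ?R r \<and> t \<le> ?R s \<and> G x t) = (x n \<le> ?R s)))" (is "_ \<longleftrightarrow> ?A x \<or> ?B x") for x
  proof
    assume P: "P x"
    show "?A x \<or> ?B x"
    proof (cases "G x (x n)")
      case False
      then obtain q r where qr: "q < x n" "x n < r" "\<forall>u. q < u \<and> u < r \<longrightarrow> P (x(n := u))"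
        using P unfolding G_def by auto
      obtain q' where q': "q < ?R q'" "?R q' < x n" using of_rat_dense[OF qr(1)] by blast
      obtain r' where r': "x n < ?R r'" "?R r' < r" using of_rat_dense[OF qr(2)] by blast
      have "?A x" using q' r' qr(3) by (meson less_trans)
      then show ?thesis ..
    next
      case True
      have "\<exists>e>0. \<forall>t. G x t \<longrightarrow> t \<noteq> x n \<longrightarrow> e \<le> dist (x n) t"
        using finite_set_avoid[OF fin[of x], of "x n"] by auto
      then obtain e where e: "e > 0" "\<And>t. G x t \<Longrightarrow> t \<noteq> x n \<Longrightarrow> e \<le> \<bar>x n - t\<bar>"
        by (auto simp: dist_real_def)
      obtain q' where q': "x n - e < ?R q'" "?R q' < x n" using of_rat_dense[of "x n - e" "x n"] e by auto
      obtain r' where r': "x n < ?R r'" "?R r' < x n + e" using of_rat_dense[of "x n" "x n + e"] e by auto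
      have only: "?R q' < t \<and> t < ?R r' \<and> G x t \<longleftrightarrow> t = x n" for t
        using e(2)[of t] q' r' True by (cases "t = x n") (auto simp: abs_if split: if_splits)
      have "\<exists>!t. ?R q' < t \<and> t < ?R r' \<and> G x t" unfolding only by simp
      moreover have "(\<exists>t. ?R q' < t \<and> t < ?R r' \<and> t \<le> ?R s \<and> G x t) = (x n \<le> ?R s)" for s
        using only by metis
      ultimately have "?B x" using q' r' by blast
      then show ?thesis ..
    qed
  next
    assume "?A x \<or> ?B x"
    then show "P x"
    proof
      assume "?A x"
      then show "P x" by (metis fun_upd_triv)
    next
      assume "?B x"
      then obtain q r where qr: "?R q < x n" "x n < ?R r" "\<exists>!t. ?R q < t \<and> t < ?R r \<and> G x t"
        "\<And>s. (\<exists>t. ?R q < t \<and> t < ?R r \<and> t \<le> ?R s \<and> G x t) = (x n \<le> ?R s)" by blast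
      then obtain t where t: "?R q < t \<and> t < ?R r \<and> G x t"
        and t': "\<And>u. ?R q < u \<and> u < ?R r \<and> G x u \<Longrightarrow> u = t" by blast
      have *: "t \<le> ?R s \<longleftrightarrow> x n \<le> ?R s" for s using qr(4)[of s] t t' by blast
      have "t = x n"
      proof (rule ccontr)
        assume "t \<noteq> x n"
        then consider "t < x n" | "x n < t" by linarith
        then show False
        proof cases
          case 1
          then obtain s where "t < ?R s" "?R s < x n" using of_rat_dense by blast
          then show False using *[of s] by linarith
        next
          case 2
          then obtain s where "x n < ?R s" "?R s < t" using of_rat_dense by blast
          then show False using *[of s] by linarith
        qed
      qed
      then show "P x" using t unfolding G_def by simp
    qed
  qed
  have "P = (\<lambda>x. ?A x \<or> ?B x)" using iff by (rule ext)
  moreover have "Measurable.pred \<Omega> (\<lambda>x. ?A x \<or> ?B x)" by measurable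
  ultimately show ?thesis by simp
qed

lemma depends_below_comp: "depends_below n B \<Longrightarrow> depends_below n (\<lambda>x. F (B x))"
  unfolding depends_below_def by metis

context o_minimal_semialgebraic
begin

text \<open>Induction on the number of entries. The exceptional points of a slice lie in its
  frontier, which is finite, and the auxiliary predicates of \<open>borel_pred_from_slices\<close>
  are definable with one entry less.\<close>

theorem definable_borel:
  assumes "definable P"
  shows "Measurable.pred \<Omega> P"
proof -
  obtain n where "depends_below n P" using assms unfolding definable_def defN_def by blast
  then show ?thesis using assms
  proof (induction n arbitrary: P)
    case 0
    then have "P x = P (\<lambda>_. 0)" for x by (intro depends_belowD[OF 0(1)]) auto
    then have "P = (\<lambda>x. P (\<lambda>_. 0))" by auto
    then show ?case by (metis measurable_const UNIV_I space_count_space)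
  next
    case (Suc n)
    define B where "B x t \<longleftrightarrow> P (x(n := t))" for x t
    define G where "G x t \<longleftrightarrow> B x t \<and>
      \<not> (\<exists>q r. q < t \<and> t < r \<and> (\<forall>u. q < u \<and> u < r \<longrightarrow> B x u))" for x t
    have defB: "definable_family B"
      unfolding B_def fun_upd_def by (intro def_intros definable_subst[OF Suc.prems(2)])
    have defG: "definable_family G"
      unfolding G_def by (intro def_intros definable_app[OF defB])
    have depB: "depends_below n B"
      unfolding depends_below_def B_def
      by (auto intro!: depends_belowD[OF Suc.prems(1)] simp: less_Suc_eq fun_eq_iff)
    then have depG: "depends_below n G"
      unfolding depends_below_def G_def by (metis (no_types, lifting))
    have fin: "finite {t. G x t}" for x
    proof (rule finite_subset)
      show "{t. G x t} \<subseteq> frontier {t. B x t}"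
      proof
        fix t assume t: "t \<in> {t. G x t}"
        have "t \<notin> interior {t. B x t}"
        proof
          assume "t \<in> interior {t. B x t}"
          then obtain e where e: "e > 0" "ball t e \<subseteq> {t. B x t}" by (auto simp: mem_interior)
          have "\<forall>u. t - e < u \<and> u < t + e \<longrightarrow> B x u"
            using e(2) by (auto simp: ball_def dist_real_def subset_iff abs_less_iff)
          then show False using t e(1) unfolding G_def mem_Collect_eq
            by (metis diff_less_eq less_add_same_cancel1)
        qed
        then show "t \<in> frontier {t. B x t}"
          using t closure_subset unfolding frontier_def G_def by blast
      qed
      show "finite (frontier {t. B x t})" by (intro tame1_finite_frontier tame1_fibre defB)
    qed
    have step: "Measurable.pred \<Omega> Q" if "definable Q" "depends_below n Q" for Q
      using Suc.IH that by blast
    show ?case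
    proof (rule borel_pred_from_slices[where n = n])
      show "finite {t. P (x(n := t)) \<and> \<not> (\<exists>q r. q < t \<and> t < r \<and> (\<forall>u. q < u \<and> u < r \<longrightarrow> P (x(n := u))))}" for x
        using fin[of x] unfolding G_def B_def .
      fix q r s :: real
      show "Measurable.pred \<Omega> (\<lambda>x. \<forall>u. q < u \<and> u < r \<longrightarrow> P (x(n := u)))"
        unfolding B_def[symmetric]
        by (rule step, intro def_intros definable_app[OF defB])
          (rule depends_below_comp[OF depB])
      show "Measurable.pred \<Omega> (\<lambda>x. \<exists>!t. q < t \<and> t < r \<and> P (x(n := t)) \<and>
          \<not> (\<exists>q r. q < t \<and> t < r \<and> (\<forall>u. q < u \<and> u < r \<longrightarrow> P (x(n := u)))))"
        unfolding B_def[symmetric] G_def[symmetric]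
        by (rule step, intro def_intros definable_app[OF defG])
          (rule depends_below_comp[OF depG])
      show "Measurable.pred \<Omega> (\<lambda>x. \<exists>t. q < t \<and> t < r \<and> t \<le> s \<and> P (x(n := t)) \<and>
          \<not> (\<exists>q r. q < t \<and> t < r \<and> (\<forall>u. q < u \<and> u < r \<longrightarrow> P (x(n := u)))))"
        unfolding B_def[symmetric] G_def[symmetric]
        by (rule step, intro def_intros definable_app[OF defG])
          (rule depends_below_comp[OF depG])
    qed
  qed
qed

end

section \<open>Counting measure, Lebesgue measure and slices\<close>

text \<open>Built as a Borel measure on the line, so that it can take the place of
  \<open>lborel\<close> in any factor of a product.\<close>

definition int_measure :: "real measure" where
  "int_measure = distr (count_space (UNIV :: int set)) borel real_of_int"

lemma sets_int_measure [simp, measurable_cong]: "sets int_measure = sets borel"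
  and space_int_measure [simp]: "space int_measure = UNIV"
  by (simp_all add: int_measure_def)

lemma emeasure_int_measure:
  "A \<in> sets borel \<Longrightarrow> emeasure int_measure A = emeasure (count_space UNIV) {z. real_of_int z \<in> A}"
  by (simp add: int_measure_def emeasure_distr vimage_def)

lemma emeasure_int_measure_finite:
  assumes "A \<in> sets borel" "A \<subseteq> {-R..R}"
  shows "emeasure int_measure A < \<infinity>"
proof -
  have "{z. real_of_int z \<in> A} \<subseteq> {\<lfloor>-R\<rfloor>..\<lceil>R\<rceil>}"
    using assms(2) by (auto simp: subset_iff) (linarith | simp add: le_ceiling_iff floor_le_iff; force)+
  then have "finite {z. real_of_int z \<in> A}" by (rule finite_subset) simp
  then show ?thesis by (simp add: emeasure_int_measure[OF assms(1)] of_nat_less_top)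
qed

lemma sigma_finite_int_measure: "sigma_finite_measure int_measure"
proof
  show "\<exists>A. countable A \<and> A \<subseteq> sets int_measure \<and> \<Union>A = space int_measure \<and>
      (\<forall>a\<in>A. emeasure int_measure a \<noteq> \<infinity>)"
  proof (intro exI[of _ "range (\<lambda>k::nat. {-real k..real k})"] conjI ballI)
    have "\<exists>k::nat. x \<in> {-real k..real k}" for x :: real
    proof -
      obtain k :: nat where "\<bar>x\<bar> \<le> k" using real_arch_simple by blast
      then show ?thesis by (intro exI[of _ k]) auto
    qed
    then show "\<Union>(range (\<lambda>k::nat. {-real k..real k})) = space int_measure" by auto
    fix a assume "a \<in> range (\<lambda>k::nat. {-real k..real k})"
    then obtain k :: nat where "a = {-real k..real k}" by blast
    then have "emeasure int_measure a < \<infinity>" by (intro emeasure_int_measure_finite[of _ "real k"]) auto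
    then show "emeasure int_measure a \<noteq> \<infinity>" by simp
  qed auto
qed

text \<open>The ends \<open>a\<close> and \<open>b\<close> may or may not belong to
  \<open>J\<close>. The integers in \<open>[a, b]\<close> give the upper bound and those in
  \<open>(a, b)\<close> the lower bound, each with an error of 1 against
  \<open>b - a\<close>.\<close>

lemma int_measure_interval:
  fixes J :: "real set"
  assumes "is_interval J" "bounded J"
  shows "emeasure int_measure J \<le> emeasure lborel J + 1" "emeasure lborel J \<le> emeasure int_measure J + 1"
proof -
  have *: "emeasure int_measure J \<le> emeasure lborel J + 1 \<and> emeasure lborel J \<le> emeasure int_measure J + 1"
  proof (cases "J = {}")
    case False
    define a b where "a = Inf J" and "b = Sup J"
    have bdd: "bdd_below J" "bdd_above J" using assms(2) bounded_imp_bdd_below bounded_imp_bdd_above by auto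
    have sub: "J \<subseteq> {a..b}" using bdd cInf_lower cSup_upper by (auto simp: a_def b_def)
    have sup: "{a<..<b} \<subseteq> J"
    proof
      fix x assume "x \<in> {a<..<b}"
      then obtain y z where "y \<in> J" "y < x" "z \<in> J" "x < z"
        using False bdd by (auto simp: a_def b_def cInf_less_iff less_cSup_iff)
      then show "x \<in> J" using assms(1) unfolding is_interval_1 by (meson less_imp_le)
    qed
    have ab: "a \<le> b" using sub False by force
    have J[measurable]: "J \<in> sets borel"
      using assms(1) by (intro real_interval_borel_measurable)
    have "emeasure lborel J \<le> emeasure lborel {a..b}" "emeasure lborel {a<..<b} \<le> emeasure lborel J"
      using sub sup J by (auto intro!: emeasure_mono)
    then have leb: "emeasure lborel J = ennreal (b - a)" using ab by simp
    define N where "N = {z. real_of_int z \<in> J}"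
    have N1: "N \<subseteq> {\<lceil>a\<rceil>..\<lfloor>b\<rfloor>}" using sub by (auto simp: N_def ceiling_le_iff le_floor_iff)
    have N2: "{\<lfloor>a\<rfloor> + 1..\<lceil>b\<rceil> - 1} \<subseteq> N"
    proof
      fix z assume "z \<in> {\<lfloor>a\<rfloor> + 1..\<lceil>b\<rceil> - 1}"
      then have "a < real_of_int z" "real_of_int z < b" by auto linarith+
      then show "z \<in> N" using sup by (auto simp: N_def)
    qed
    have fin: "finite N" using N1 finite_subset by blast
    have nu: "emeasure int_measure J = ennreal (card N)"
      using fin emeasure_int_measure[OF J] by (simp add: N_def ennreal_of_nat_eq_real_of_nat)
    have "card N \<le> card {\<lceil>a\<rceil>..\<lfloor>b\<rfloor>}" by (intro card_mono N1) simp
    then have c1: "real (card N) \<le> b - a + 1" using ab by simp linarith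
    have "card {\<lfloor>a\<rfloor> + 1..\<lceil>b\<rceil> - 1} \<le> card N" by (intro card_mono N2 fin)
    then have c2: "b - a \<le> real (card N) + 1" by simp linarith
    have "ennreal (card N) \<le> ennreal (b - a + 1)" "ennreal (b - a) \<le> ennreal (card N + 1)"
      using c1 c2 by (auto intro!: ennreal_leI simp del: ennreal_plus)
    then show ?thesis using ab by (simp add: leb nu add.commute)
  qed (simp add: emeasure_int_measure)
  then show "emeasure int_measure J \<le> emeasure lborel J + 1"
    "emeasure lborel J \<le> emeasure int_measure J + 1" by auto
qed

text \<open>The error \<open>h\<close> is charged only when \<open>U\<close> is nonempty. For a
  slice this means that its base point lies in the projection, so integrating the error yields
  \<open>h\<close> times the volume of the projection.\<close>

lemma emeasure_interval_union_le:
  assumes U: "interval_union h U" "bounded U"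
    and M: "sets M = sets borel" "sets N = sets borel"
    and le: "\<And>J. is_interval J \<Longrightarrow> bounded J \<Longrightarrow> emeasure M J \<le> emeasure N J + 1"
  shows "emeasure M U \<le> emeasure N U + of_nat h * indicator {A. A \<noteq> {}} U"
proof -
  obtain J where J: "\<And>k. k < h \<Longrightarrow> is_interval (J k)" "disjoint_family_on J {..<h}" "U = (\<Union>k<h. J k)"
    using U(1) unfolding interval_union_def by blast
  have Jb: "J k \<in> sets borel" if "k < h" for k
    using J(1)[OF that] by (intro real_interval_borel_measurable)
  have sub: "J k \<subseteq> U" if "k < h" for k using J(3) that by blast
  have "emeasure L U = (\<Sum>k<h. emeasure L (J k))" if "sets L = sets borel" for L
    using J Jb that by (subst sum_emeasure) auto
  moreover have "(\<Sum>k<h. emeasure M (J k)) \<le> (\<Sum>k<h. emeasure N (J k) + 1)"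
    by (intro sum_mono le J bounded_subset[OF U(2) sub]) auto
  ultimately have "emeasure M U \<le> emeasure N U + h"
    using M by (simp add: sum.distrib)
  then show ?thesis by (cases "U = {}") auto
qed

lemma (in product_sigma_finite) emeasure_PiM_insert:
  assumes "finite I" "i \<notin> I" "X \<in> sets (Pi\<^sub>M (insert i I) M)" "space (M i) = UNIV"
  shows "emeasure (Pi\<^sub>M (insert i I) M) X =
      (\<integral>\<^sup>+w. emeasure (M i) {t. w(i := t) \<in> X} \<partial>Pi\<^sub>M I M)"
    and "(\<lambda>w. emeasure (M i) {t. w(i := t) \<in> X}) \<in> borel_measurable (Pi\<^sub>M I M)"
    and "w \<in> space (Pi\<^sub>M I M) \<Longrightarrow> {t. w(i := t) \<in> X} \<in> sets (M i)"
proof -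
  have S: "{t. w(i := t) \<in> X} \<in> sets (M i)" if "w \<in> space (Pi\<^sub>M I M)" for w
    using measurable_sets[OF measurable_component_update[OF that assms(2)] assms(3)]
    by (simp add: vimage_def assms(4))
  then show "w \<in> space (Pi\<^sub>M I M) \<Longrightarrow> {t. w(i := t) \<in> X} \<in> sets (M i)" by blast
  have *: "(\<integral>\<^sup>+t. indicator X (w(i := t)) \<partial>M i) = emeasure (M i) {t. w(i := t) \<in> X}"
    if "w \<in> space (Pi\<^sub>M I M)" for w
  proof -
    have "(\<lambda>t. indicator X (w(i := t))) = (indicator {t. w(i := t) \<in> X} :: _ \<Rightarrow> ennreal)"
      by (auto simp: indicator_def)
    then show ?thesis using S[OF that] by simp
  qed
  have "emeasure (Pi\<^sub>M (insert i I) M) X = (\<integral>\<^sup>+x. indicator X x \<partial>Pi\<^sub>M (insert i I) M)"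
    using assms by simp
  also have "\<dots> = (\<integral>\<^sup>+w. \<integral>\<^sup>+t. indicator X (w(i := t)) \<partial>M i \<partial>Pi\<^sub>M I M)"
    by (rule product_nn_integral_insert) (use assms in auto)
  also have "\<dots> = (\<integral>\<^sup>+w. emeasure (M i) {t. w(i := t) \<in> X} \<partial>Pi\<^sub>M I M)"
    by (intro nn_integral_cong *)
  finally show "emeasure (Pi\<^sub>M (insert i I) M) X =
      (\<integral>\<^sup>+w. emeasure (M i) {t. w(i := t) \<in> X} \<partial>Pi\<^sub>M I M)" .
  have "(\<lambda>w. \<integral>\<^sup>+t. indicator X (w(i := t)) \<partial>M i) \<in> borel_measurable (Pi\<^sub>M I M)"
    using measurable_compose[OF measurable_add_dim[of i I M] borel_measurable_indicator[OF assms(3)]]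
    by (intro M.borel_measurable_nn_integral) (simp add: case_prod_unfold)
  then show "(\<lambda>w. emeasure (M i) {t. w(i := t) \<in> X}) \<in> borel_measurable (Pi\<^sub>M I M)"
    by (rule measurable_cong[THEN iffD1, rotated]) (rule *)
qed

section \<open>Product measures and images under linear forms\<close>

abbreviation Leb :: "'i set \<Rightarrow> ('i \<Rightarrow> real) measure" where
  "Leb I \<equiv> Pi\<^sub>M I (\<lambda>_. lborel)"

text \<open>Interpolates between Lebesgue measure (\<open>A\<close> empty) and the counting measure
  of the integer points (\<open>A\<close> the full index set).\<close>

definition mixed :: "nat set \<Rightarrow> nat \<Rightarrow> real measure" where
  "mixed A i = (if i \<in> A then int_measure else lborel)"

lemma sets_mixed [simp, measurable_cong]: "sets (mixed A i) = sets borel"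
  and space_mixed [simp]: "space (mixed A i) = UNIV"
  by (simp_all add: mixed_def)

lemma mixed_empty: "mixed {} = (\<lambda>_. lborel)"
  by (simp add: mixed_def fun_eq_iff)

lemma sets_PiM_mixed: "sets (Pi\<^sub>M I (mixed A)) = sets (Pi\<^sub>M I (\<lambda>_. borel))"
  by (intro sets_PiM_cong) auto

interpretation mixed: product_sigma_finite "mixed A" for A
proof
  show "\<exists>C. countable C \<and> C \<subseteq> sets (mixed A i) \<and> \<Union>C = space (mixed A i) \<and>
      (\<forall>a\<in>C. emeasure (mixed A i) a \<noteq> \<infinity>)" for i
    using sigma_finite_int_measure sigma_finite_lborel unfolding sigma_finite_measure_def mixed_def
    by (cases "i \<in> A") (simp_all add: sigma_finite_measure_def)
qed

text \<open>Choosing one interval in each coordinate projection splits \<open>F\<close> into at most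
  \<open>h ^ n\<close> pieces. On a piece, coordinate \<open>i\<close> varies by at most the measure
  of its projection, so the linear form varies by at most \<open>D\<close> and its values fit into
  an interval of length \<open>D\<close>.\<close>

lemma emeasure_box_union:
  fixes F :: "(nat \<Rightarrow> real) set"
  assumes U: "\<And>i. i < n \<Longrightarrow> interval_union h ((\<lambda>z. z i) ` F)" "\<And>i. i < n \<Longrightarrow> bounded ((\<lambda>z. z i) ` F)"
    and S: "S = (\<lambda>z. \<Sum>i<n. c i * z i) ` F" "S \<in> sets borel"
  shows "emeasure lborel S \<le> of_nat (h ^ n) * (\<Sum>i<n. ennreal \<bar>c i\<bar> * emeasure lborel ((\<lambda>z. z i) ` F))"
proof -
  define U where "U i = (\<lambda>z. z i) ` F" for i
  obtain J where J: "\<And>i k. i < n \<Longrightarrow> k < h \<Longrightarrow> is_interval (J i k)"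
    "\<And>i. i < n \<Longrightarrow> U i = (\<Union>k<h. J i k)"
    using U(1) unfolding interval_union_def U_def by metis
  have Jb: "J i k \<in> sets borel" if "i < n" "k < h" for i k
    using J(1)[OF that] by (intro real_interval_borel_measurable)
  have Ub: "U i \<in> sets borel" if "i < n" for i using J(2) Jb that by auto
  have Ufin: "emeasure lborel (U i) < \<infinity>" if "i < n" for i
    using emeasure_bounded_finite[OF U(2)[OF that]] unfolding U_def .
  define D where "D = (\<Sum>i<n. \<bar>c i\<bar> * measure lborel (U i))"
  have "emeasure lborel (U i) = ennreal (measure lborel (U i))" if "i < n" for i
    using Ufin[OF that] by (intro emeasure_eq_ennreal_measure) simp
  then have D: "ennreal D = (\<Sum>i<n. ennreal \<bar>c i\<bar> * emeasure lborel (U i))"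
    unfolding D_def by (subst sum_ennreal[symmetric]) (auto simp: ennreal_mult intro!: sum.cong)
  have "D \<ge> 0" unfolding D_def by (intro sum_nonneg) auto
  define P where "P = {..<n} \<rightarrow>\<^sub>E {..<h}"
  have finP: "finite P" unfolding P_def by (intro finite_PiE) auto
  define T where "T \<phi> = (\<lambda>z. \<Sum>i<n. c i * z i) ` {z\<in>F. \<forall>i<n. z i \<in> J i (\<phi> i)}" for \<phi>
  have cover: "S \<subseteq> (\<Union>\<phi>\<in>P. T \<phi>)"
  proof
    fix s assume "s \<in> S"
    then obtain z where z: "z \<in> F" "s = (\<Sum>i<n. c i * z i)" by (auto simp: S)
    have "\<exists>k<h. z i \<in> J i k" if "i < n" for i using J(2)[OF that] z(1) by (auto simp: U_def)
    then obtain \<phi> where \<phi>: "\<And>i. i < n \<Longrightarrow> \<phi> i < h \<and> z i \<in> J i (\<phi> i)" by metis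
    then have "restrict \<phi> {..<n} \<in> P" "s \<in> T (restrict \<phi> {..<n})" using z by (auto simp: P_def T_def)
    then show "s \<in> (\<Union>\<phi>\<in>P. T \<phi>)" by blast
  qed
  have diam: "\<bar>x - y\<bar> \<le> D" if xy: "\<phi> \<in> P" "x \<in> T \<phi>" "y \<in> T \<phi>" for \<phi> x y
  proof -
    obtain u v where uv: "x = (\<Sum>i<n. c i * u i)" "y = (\<Sum>i<n. c i * v i)"
      "\<And>i. i < n \<Longrightarrow> u i \<in> J i (\<phi> i) \<and> v i \<in> J i (\<phi> i)"
      using xy(2,3) by (auto simp: T_def)
    have "x - y = (\<Sum>i<n. c i * (u i - v i))"
      unfolding uv by (simp add: sum_subtractf right_diff_distrib)
    also have "\<bar>\<dots>\<bar> \<le> (\<Sum>i<n. \<bar>c i\<bar> * \<bar>u i - v i\<bar>)"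
      by (rule order_trans[OF sum_abs]) (simp add: abs_mult)
    also have "\<dots> \<le> D"
      unfolding D_def
    proof (intro sum_mono mult_left_mono)
      fix i assume i: "i \<in> {..<n}"
      then have k: "\<phi> i < h" using xy(1) by (auto simp: P_def)
      have "{min (u i) (v i)..max (u i) (v i)} \<subseteq> J i (\<phi> i)"
        using J(1)[of i "\<phi> i"] uv(3)[of i] i k unfolding is_interval_1 min_def max_def
        by (auto split: if_splits)
      also have "\<dots> \<subseteq> U i" using J(2) i k by auto
      finally have "measure lborel {min (u i) (v i)..max (u i) (v i)} \<le> measure lborel (U i)"
        using Ub Ufin i by (intro measure_mono_fmeasurable) (auto simp: fmeasurable_def)
      then show "\<bar>u i - v i\<bar> \<le> measure lborel (U i)"
        by (simp add: min_def max_def abs_if split: if_splits)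
    qed auto
    finally show ?thesis .
  qed
  have "\<exists>s. T \<phi> \<subseteq> {s..s + D}" if "\<phi> \<in> P" for \<phi>
  proof (cases "T \<phi> = {}")
    case False
    then obtain x where x: "x \<in> T \<phi>" by blast
    then have bdd: "bdd_below (T \<phi>)" using diam[OF that _ x] 
      by (intro bdd_belowI[of _ "x - D"]) (fastforce simp: abs_le_iff)
    have "Inf (T \<phi>) \<le> y" "y - D \<le> Inf (T \<phi>)" if "y \<in> T \<phi>" for y
      using that bdd False diam[OF \<open>\<phi> \<in> P\<close> that]
      by (auto intro!: cInf_lower cInf_greatest) (fastforce simp: abs_le_iff)
    then show ?thesis by (intro exI[of _ "Inf (T \<phi>)"]) (fastforce simp: algebra_simps)
  qed auto
  then obtain s where s: "\<And>\<phi>. \<phi> \<in> P \<Longrightarrow> T \<phi> \<subseteq> {s \<phi>..s \<phi> + D}" by metis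
  have "emeasure lborel S \<le> emeasure lborel (\<Union>\<phi>\<in>P. {s \<phi>..s \<phi> + D})"
  proof (intro emeasure_mono)
    show "S \<subseteq> (\<Union>\<phi>\<in>P. {s \<phi>..s \<phi> + D})" using cover s by blast
    show "(\<Union>\<phi>\<in>P. {s \<phi>..s \<phi> + D}) \<in> sets lborel" using finP by auto
  qed
  also have "\<dots> \<le> (\<Sum>\<phi>\<in>P. emeasure lborel {s \<phi>..s \<phi> + D})"
    by (intro emeasure_subadditive_finite finP) auto
  also have "\<dots> = of_nat (card P) * ennreal D" using \<open>D \<ge> 0\<close> by simp
  also have "card P = h ^ n" by (simp add: P_def card_PiE)
  finally show ?thesis unfolding D U_def .
qed

text \<open>Needed because a unit row with index \<open>k\<close> may select a coordinate other than
  \<open>k\<close>.\<close>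

lemma emeasure_PiM_reindex:
  fixes I :: "'a set" and f :: "'a \<Rightarrow> 'b" and X :: "('a \<Rightarrow> real) set"
  assumes "finite I" "inj_on f I" "X \<in> sets (Leb I)"
  shows "emeasure (Leb I) X =
    emeasure (Leb (f ` I)) {w \<in> space (Leb (f ` I)). (\<lambda>k\<in>I. w (f k)) \<in> X}"
proof -
  have P: "product_sigma_finite (\<lambda>_::'a. lborel :: real measure)"
    and Q: "product_sigma_finite (\<lambda>_::'b. lborel :: real measure)" by standard
  let ?g = "\<lambda>w :: 'b \<Rightarrow> real. \<lambda>k\<in>I. w (f k)"
  have g: "?g \<in> measurable (Leb (f ` I)) (Leb I)"
    by (intro measurable_restrict measurable_component_singleton) auto
  have "distr (Leb (f ` I)) (Leb I) ?g = Leb I"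
  proof (rule product_sigma_finite.PiM_eqI[OF P])
    fix A :: "_ \<Rightarrow> real set" assume A: "\<And>i. i \<in> I \<Longrightarrow> A i \<in> sets lborel"
    let ?h = "the_inv_into I f"
    have inv: "?h (f k) = k" if "k \<in> I" for k using assms(2) that by (rule the_inv_into_f_f)
    have "?g -` Pi\<^sub>E I A \<inter> space (Leb (f ` I)) = Pi\<^sub>E (f ` I) (\<lambda>j. A (?h j))"
      by (auto simp: space_PiM PiE_iff inv)
    then have "emeasure (distr (Leb (f ` I)) (Leb I) ?g) (Pi\<^sub>E I A) =
      emeasure (Leb (f ` I)) (Pi\<^sub>E (f ` I) (\<lambda>j. A (?h j)))"
      using A assms(1) by (subst emeasure_distr[OF g]) (auto intro!: sets_PiM_I_finite)
    also have "\<dots> = (\<Prod>j\<in>f ` I. emeasure lborel (A (?h j)))"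
      using A assms(1) by (intro product_sigma_finite.emeasure_PiM[OF Q]) (auto simp: inv)
    also have "\<dots> = (\<Prod>k\<in>I. emeasure lborel (A k))"
      by (subst prod.reindex[OF assms(2)]) (auto simp: inv intro!: prod.cong)
    finally show "emeasure (distr (Leb (f ` I)) (Leb I) ?g) (Pi\<^sub>E I A) =
      (\<Prod>k\<in>I. emeasure lborel (A k))" .
  qed (use assms in auto)
  then have "emeasure (Leb I) X =
    emeasure (distr (Leb (f ` I)) (Leb I) ?g) X" by simp
  also have "\<dots> = emeasure (Leb (f ` I)) (?g -` X \<inter> space (Leb (f ` I)))"
    by (rule emeasure_distr[OF g assms(3)])
  finally show ?thesis by (simp add: vimage_def Int_def conj_commute)
qed

text \<open>With all indices this is the image of \<open>Z\<close> under the matrix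
  \<open>p\<close>; with fewer, the coordinate projections of that image; with unit rows, the
  coordinate projections of \<open>Z\<close> itself.\<close>

definition linear_image :: "nat \<Rightarrow> (nat \<Rightarrow> real) set \<Rightarrow> nat set \<Rightarrow> (nat \<Rightarrow> nat \<Rightarrow> real) \<Rightarrow> (nat \<Rightarrow> real) set" where
  "linear_image n Z I p = (\<lambda>z. \<lambda>k\<in>I. \<Sum>l<n. p k l * z l) ` Z"

definition unit_row :: "nat \<Rightarrow> nat \<Rightarrow> real" where
  "unit_row i l = (if l = i then 1 else 0)"

lemma sum_unit_row: "i < n \<Longrightarrow> (\<Sum>l<n. unit_row i l * z l) = z i"
  by (simp add: unit_row_def if_distrib[of "\<lambda>c. c * _"] cong: if_cong)

lemma linear_image_cong:
  "(\<And>k l. k \<in> I \<Longrightarrow> l < n \<Longrightarrow> p k l = q k l) \<Longrightarrow> linear_image n Z I p = linear_image n Z I q"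
  unfolding linear_image_def by (intro image_cong refl restrict_ext) auto

lemma restrict_fun_upd_iff:
  assumes "w \<in> extensional I" "i \<notin> I"
  shows "w(i := t) = (\<lambda>k\<in>insert i I. g k) \<longleftrightarrow> w = restrict g I \<and> t = g i"
  using assms by (auto simp: fun_eq_iff restrict_def extensional_def)

text \<open>The set whose image is taken on the right does not involve row \<open>i\<close>. Hence
  this row can be changed while the base point \<open>w\<close> is kept.\<close>

lemma fibre_linear_image:
  assumes "w \<in> extensional I" "i \<notin> I"
  shows "{t. w(i := t) \<in> linear_image n Z (insert i I) p} =
    (\<lambda>z. \<Sum>l<n. p i l * z l) ` {z\<in>Z. w = (\<lambda>k\<in>I. \<Sum>l<n. p k l * z l)}"
  unfolding linear_image_def image_iff restrict_fun_upd_iff[OF assms] by auto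

text \<open>The interface between definability and counting: one \<open>h\<close> bounds the pieces
  of all slices for all matrices \<open>p\<close>.\<close>

locale sliced_set =
  fixes n h :: nat and Z :: "(nat \<Rightarrow> real) set"
  assumes meas: "\<And>I p. I \<subseteq> {..<n} \<Longrightarrow> linear_image n Z I p \<in> sets (Pi\<^sub>M I (\<lambda>_. borel))"
    and slices: "\<And>I i p w. insert i I \<subseteq> {..<n} \<Longrightarrow> i \<notin> I \<Longrightarrow> w \<in> extensional I \<Longrightarrow>
        interval_union h {t. w(i := t) \<in> linear_image n Z (insert i I) p}"
    and bdd: "\<exists>R. \<forall>z\<in>Z. \<forall>l<n. \<bar>z l\<bar> \<le> R"
begin

section \<open>Exchanging counting measure for Lebesgue measure\<close>

abbreviation X :: "nat set \<Rightarrow> (nat \<Rightarrow> nat \<Rightarrow> real) \<Rightarrow> (nat \<Rightarrow> real) set" where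
  "X \<equiv> linear_image n Z"

definition mixed_vol :: "nat set \<Rightarrow> nat set \<Rightarrow> (nat \<Rightarrow> nat \<Rightarrow> real) \<Rightarrow> ennreal" where
  "mixed_vol A I p = emeasure (Pi\<^sub>M I (mixed A)) (X I p)"

abbreviation leb_vol :: "nat set \<Rightarrow> (nat \<Rightarrow> nat \<Rightarrow> real) \<Rightarrow> ennreal" where
  "leb_vol \<equiv> mixed_vol {}"

lemma meas_mixed: "I \<subseteq> {..<n} \<Longrightarrow> X I p \<in> sets (Pi\<^sub>M I (mixed A))"
  using meas by (simp add: sets_PiM_mixed)

lemma bounded_slice:
  assumes "w \<in> extensional I" "i \<notin> I"
  shows "bounded {t. w(i := t) \<in> X (insert i I) p}"
proof -
  obtain R where R: "\<And>z l. z \<in> Z \<Longrightarrow> l < n \<Longrightarrow> \<bar>z l\<bar> \<le> R" using bdd by blast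
  have "\<bar>\<Sum>l<n. p i l * z l\<bar> \<le> (\<Sum>l<n. \<bar>p i l\<bar> * R)" if "z \<in> Z" for z
    by (rule order_trans[OF sum_abs], intro sum_mono) (auto simp: abs_mult intro!: mult_left_mono R that)
  then show ?thesis
    unfolding fibre_linear_image[OF assms] bounded_iff by (intro exI[of _ "\<Sum>l<n. \<bar>p i l\<bar> * R"]) auto
qed

text \<open>In direction \<open>i\<close>, count and length of a slice differ by at most
  \<open>h\<close>, and a slice is nonempty exactly over the projection \<open>X I p\<close>. Both
  inequalities follow by integration over the base points.\<close>

lemma mixed_vol_swap:
  assumes "insert i I \<subseteq> {..<n}" "i \<notin> I" "i \<notin> A"
  shows "mixed_vol (insert i A) (insert i I) p \<le> mixed_vol A (insert i I) p + h * mixed_vol A I p"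
    and "mixed_vol A (insert i I) p \<le> mixed_vol (insert i A) (insert i I) p + h * mixed_vol A I p"
proof -
  have fin: "finite I" "I \<subseteq> {..<n}" using assms(1) finite_subset by auto
  have eqA: "Pi\<^sub>M I (mixed (insert i A)) = Pi\<^sub>M I (mixed A)"
    using assms(2) by (intro PiM_cong) (auto simp: mixed_def)
  define T where "T w = {t. w(i := t) \<in> X (insert i I) p}" for w
  have volB: "mixed_vol B (insert i I) p = (\<integral>\<^sup>+w. emeasure (mixed B i) (T w) \<partial>Pi\<^sub>M I (mixed B))"
    and measB: "(\<lambda>w. emeasure (mixed B i) (T w)) \<in> borel_measurable (Pi\<^sub>M I (mixed B))" for B
    unfolding mixed_vol_def T_def
    by (rule mixed.emeasure_PiM_insert; use fin assms meas_mixed in simp)+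
  have ne: "indicator {A. A \<noteq> {}} (T w) = (indicator (X I p) w :: ennreal)"
    if "w \<in> space (Pi\<^sub>M I (mixed A))" for w
  proof -
    have "w \<in> extensional I" using that by (simp add: space_PiM PiE_def)
    then have "T w \<noteq> {} \<longleftrightarrow> w \<in> X I p"
      unfolding T_def fibre_linear_image[OF \<open>w \<in> extensional I\<close> assms(2)]
      by (auto simp: linear_image_def)
    then show ?thesis by (simp add: indicator_def)
  qed
  have iu: "interval_union h (T w)" "bounded (T w)" if "w \<in> space (Pi\<^sub>M I (mixed A))" for w
    using slices[OF assms(1,2), of w p] bounded_slice[of w I i p] that assms(2)
    by (auto simp: T_def space_PiM PiE_def)
  have add: "(\<integral>\<^sup>+w. f w + of_nat h * indicator (X I p) w \<partial>Pi\<^sub>M I (mixed A)) =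
      (\<integral>\<^sup>+w. f w \<partial>Pi\<^sub>M I (mixed A)) + h * mixed_vol A I p"
    if "f \<in> borel_measurable (Pi\<^sub>M I (mixed A))" for f :: "_ \<Rightarrow> ennreal"
    using that meas_mixed[OF fin(2), of p A] unfolding mixed_vol_def
    by (subst nn_integral_add) (auto simp: nn_integral_cmult_indicator)
  have i: "mixed (insert i A) i = int_measure" "mixed A i = lborel"
    using assms(3) by (auto simp: mixed_def)
  have "mixed_vol (insert i A) (insert i I) p \<le>
      (\<integral>\<^sup>+w. emeasure (mixed A i) (T w) + of_nat h * indicator (X I p) w \<partial>Pi\<^sub>M I (mixed A))"
    unfolding volB eqA i
  proof (intro nn_integral_mono)
    fix w assume w: "w \<in> space (Pi\<^sub>M I (mixed A))"
    show "emeasure int_measure (T w) \<le> emeasure lborel (T w) + of_nat h * indicator (X I p) w"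
      using emeasure_interval_union_le[OF iu[OF w], of int_measure lborel] int_measure_interval
      unfolding ne[OF w] by simp
  qed
  then show "mixed_vol (insert i A) (insert i I) p \<le> mixed_vol A (insert i I) p + h * mixed_vol A I p"
    unfolding add[OF measB] volB .
  have "mixed_vol A (insert i I) p \<le>
      (\<integral>\<^sup>+w. emeasure (mixed (insert i A) i) (T w) + of_nat h * indicator (X I p) w \<partial>Pi\<^sub>M I (mixed A))"
    unfolding volB i
  proof (intro nn_integral_mono)
    fix w assume w: "w \<in> space (Pi\<^sub>M I (mixed A))"
    show "emeasure lborel (T w) \<le> emeasure int_measure (T w) + of_nat h * indicator (X I p) w"
      using emeasure_interval_union_le[OF iu[OF w], of lborel int_measure] int_measure_interval
      unfolding ne[OF w] by simp
  qed
  then show "mixed_vol A (insert i I) p \<le> mixed_vol (insert i A) (insert i I) p + h * mixed_vol A I p"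
    unfolding add[OF measB[of "insert i A", unfolded eqA]] volB[of "insert i A"] eqA .
qed

text \<open>A crude bound that removes counting from the error terms: each exchange adds
  \<open>h\<close> times a term over a smaller index set, hence one factor \<open>1 + h\<close> per
  element of \<open>A\<close>.\<close>

lemma mixed_vol_le_leb_vol:
  assumes "finite A" "A \<subseteq> I" "I \<subseteq> {..<n}"
  shows "mixed_vol A I p \<le> of_nat ((1 + h) ^ card A) * (\<Sum>J | J \<subseteq> I. leb_vol J p)"
  using assms
proof (induction A arbitrary: I rule: finite_induct)
  case empty
  then have "finite I" using finite_subset by blast
  then have "leb_vol I p \<le> (\<Sum>J | J \<subseteq> I. leb_vol J p)" by (intro member_le_sum) auto
  then show ?case by simp
next
  case (insert i A)
  let ?I = "I - {i}" and ?c = "of_nat ((1 + h) ^ card A) :: ennreal"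
  have finI: "finite I" using insert.prems(2) finite_subset by blast
  have I: "insert i ?I = I" using insert.prems by auto
  have "mixed_vol (insert i A) I p \<le> mixed_vol A I p + h * mixed_vol A ?I p"
    using mixed_vol_swap(1)[of i ?I A p] insert.prems insert.hyps unfolding I by auto
  also have "\<dots> \<le> ?c * (\<Sum>J | J \<subseteq> I. leb_vol J p) + h * (?c * (\<Sum>J | J \<subseteq> ?I. leb_vol J p))"
    using insert.prems insert.hyps by (intro add_mono mult_left_mono insert.IH) auto
  also have "\<dots> \<le> ?c * (\<Sum>J | J \<subseteq> I. leb_vol J p) + h * (?c * (\<Sum>J | J \<subseteq> I. leb_vol J p))"
    using finI by (intro add_mono mult_left_mono sum_mono2) auto
  also have "\<dots> = of_nat ((1 + h) ^ card (insert i A)) * (\<Sum>J | J \<subseteq> I. leb_vol J p)"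
    using insert.hyps by (simp add: algebra_simps)
  finally show ?case .
qed

text \<open>The exchange in coordinate \<open>i\<close> costs \<open>h\<close> times a mixed volume
  over \<open>I - {i}\<close>. By the crude bound this involves only proper subsets of
  \<open>I\<close>, so the main term \<open>leb_vol I p\<close> does not enter the error.\<close>

lemma mixed_vol_close_to_leb_vol:
  fixes p :: "nat \<Rightarrow> nat \<Rightarrow> real"
  assumes "finite A" "A \<subseteq> I" "I \<subseteq> {..<n}"
  defines "E \<equiv> of_nat (h * (1 + h) ^ n) * (\<Sum>J | J \<subset> I. leb_vol J p)"
  shows "mixed_vol A I p \<le> leb_vol I p + of_nat (card A) * E" "leb_vol I p \<le> mixed_vol A I p + of_nat (card A) * E"
proof -
  have finI: "finite I" using assms finite_subset by blast
  then have fin: "finite {J. J \<subset> I}" by (intro finite_subset[of "{J. J \<subset> I}" "Pow I"]) auto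
  have "mixed_vol A I p \<le> leb_vol I p + of_nat (card A) * E \<and> leb_vol I p \<le> mixed_vol A I p + of_nat (card A) * E"
    using assms(1,2)
  proof (induction A rule: finite_induct)
    case (insert i A)
    let ?I = "I - {i}"
    have I: "insert i ?I = I" using insert.prems by auto
    have "A \<subseteq> {..<n}" using insert.prems assms(3) by auto
    then have cA: "card A \<le> n" using card_mono[of "{..<n}" A] by simp
    have "h * mixed_vol A ?I p \<le> h * (of_nat ((1 + h) ^ card A) * (\<Sum>J | J \<subseteq> ?I. leb_vol J p))"
      using insert assms(3) by (intro mult_left_mono mixed_vol_le_leb_vol) auto
    also have "\<dots> \<le> h * (of_nat ((1 + h) ^ n) * (\<Sum>J | J \<subset> I. leb_vol J p))"
      using insert.prems fin cA
      by (intro mult_mono mult_left_mono sum_mono2 of_nat_mono power_increasing) auto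
    also have "\<dots> = E" by (simp add: E_def mult.assoc)
    finally have E: "h * mixed_vol A ?I p \<le> E" .
    have "mixed_vol (insert i A) I p \<le> mixed_vol A I p + h * mixed_vol A ?I p"
      "mixed_vol A I p \<le> mixed_vol (insert i A) I p + h * mixed_vol A ?I p"
      using mixed_vol_swap[of i ?I A p] insert.prems insert.hyps assms(3) unfolding I by auto
    then have 1: "mixed_vol (insert i A) I p \<le> mixed_vol A I p + E" "mixed_vol A I p \<le> mixed_vol (insert i A) I p + E"
      using E by (meson add_left_mono order_trans)+
    have IH: "mixed_vol A I p \<le> leb_vol I p + of_nat (card A) * E" "leb_vol I p \<le> mixed_vol A I p + of_nat (card A) * E"
      using insert by auto
    have "mixed_vol (insert i A) I p \<le> leb_vol I p + of_nat (card A) * E + E"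
      using 1(1) IH(1) by (meson add_right_mono order_trans)
    moreover have "leb_vol I p \<le> mixed_vol (insert i A) I p + E + of_nat (card A) * E"
      using 1(2) IH(2) by (meson add_right_mono order_trans)
    ultimately show ?case using insert.hyps by (simp add: algebra_simps)
  qed simp
  then show "mixed_vol A I p \<le> leb_vol I p + of_nat (card A) * E" "leb_vol I p \<le> mixed_vol A I p + of_nat (card A) * E"
    by auto
qed

text \<open>Over a base point \<open>w\<close>, the slice in direction \<open>k\<close> is the image
  of a set \<open>F\<close> under row \<open>k\<close>, while the coordinate projections of the same
  \<open>F\<close> are the slices for unit rows. \<open>emeasure_box_union\<close> compares them,
  and integration over \<open>w\<close> gives the claim.\<close>

lemma leb_vol_replace_row:
  assumes "I \<subseteq> {..<n}" "k \<in> I" and b: "\<And>l. l < n \<Longrightarrow> \<bar>p k l\<bar> \<le> b"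
  shows "leb_vol I p \<le> of_nat (h ^ n) * (ennreal b * (\<Sum>i<n. leb_vol I (p(k := unit_row i))))"
proof -
  let ?K = "I - {k}"
  interpret L: product_sigma_finite "\<lambda>_::nat. lborel :: real measure" by standard
  have I: "insert k ?K = I" "?K \<subseteq> {..<n}" "finite ?K" using assms finite_subset by auto
  define T where "T q w = {t. w(k := t) \<in> X (insert k ?K) q}" for q w
  have lamT: "leb_vol I q = (\<integral>\<^sup>+w. emeasure lborel (T q w) \<partial>Leb ?K)"
    and measT: "(\<lambda>w. emeasure lborel (T q w)) \<in> borel_measurable (Leb ?K)"
    and setsT: "w \<in> space (Leb ?K) \<Longrightarrow> T q w \<in> sets lborel" for q w
    using L.emeasure_PiM_insert[of ?K k "X I q", unfolded I] I meas_mixed[OF assms(1), of q "{}"]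
    unfolding mixed_vol_def T_def mixed_empty by auto
  have le: "emeasure lborel (T p w) \<le>
      of_nat (h ^ n) * (ennreal b * (\<Sum>i<n. emeasure lborel (T (p(k := unit_row i)) w)))"
    if "w \<in> space (Leb ?K)" for w
  proof -
    have w: "w \<in> extensional ?K" using that by (simp add: space_PiM PiE_def)
    define F where "F = {z\<in>Z. w = (\<lambda>k\<in>?K. \<Sum>l<n. p k l * z l)}"
    have Tq: "T (p(k := r)) w = (\<lambda>z. \<Sum>l<n. r l * z l) ` F" for r
    proof -
      have "(\<lambda>j\<in>?K. \<Sum>l<n. (p(k := r)) j l * z l) = (\<lambda>j\<in>?K. \<Sum>l<n. p j l * z l)" for z
        by (rule restrict_ext) auto
      then show ?thesis unfolding T_def F_def by (subst fibre_linear_image[OF w]) auto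
    qed
    have Ti: "T (p(k := unit_row i)) w = (\<lambda>z. z i) ` F" if "i < n" for i
      unfolding Tq using sum_unit_row[OF that] by simp
    have "emeasure lborel (T p w) \<le>
        of_nat (h ^ n) * (\<Sum>i<n. ennreal \<bar>p k i\<bar> * emeasure lborel ((\<lambda>z. z i) ` F))"
    proof (rule emeasure_box_union)
      fix i assume i: "i < n"
      show "interval_union h ((\<lambda>z. z i) ` F)" "bounded ((\<lambda>z. z i) ` F)"
        using slices[of k ?K w "p(k := unit_row i)"] bounded_slice[OF w, of k "p(k := unit_row i)"] I w assms
        unfolding Ti[OF i, symmetric] T_def by auto
    next
      show "T p w = (\<lambda>z. \<Sum>i<n. p k i * z i) ` F" using Tq[of "p k"] by simp
      show "T p w \<in> sets borel" using setsT[OF \<open>w \<in> space _\<close>] by simp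
    qed
    also have "\<dots> \<le> of_nat (h ^ n) * (\<Sum>i<n. ennreal b * emeasure lborel ((\<lambda>z. z i) ` F))"
      by (intro mult_left_mono sum_mono mult_right_mono ennreal_leI b) auto
    also have "(\<Sum>i<n. ennreal b * emeasure lborel ((\<lambda>z. z i) ` F)) =
        ennreal b * (\<Sum>i<n. emeasure lborel (T (p(k := unit_row i)) w))"
      by (simp add: sum_distrib_left Ti)
    finally show ?thesis .
  qed
  have "leb_vol I p \<le> (\<integral>\<^sup>+w. of_nat (h ^ n) *
      (ennreal b * (\<Sum>i<n. emeasure lborel (T (p(k := unit_row i)) w))) \<partial>Leb ?K)"
    unfolding lamT by (intro nn_integral_mono le)
  also have "\<dots> = of_nat (h ^ n) * (ennreal b * (\<Sum>i<n. leb_vol I (p(k := unit_row i))))"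
    unfolding lamT using measT by (simp add: nn_integral_cmult nn_integral_sum)
  finally show ?thesis .
qed

text \<open>Extended-real counterpart of \<open>proj_vol\<close>, without completion. For
  \<open>j = 0\<close> it measures a subset of a one-point space and is 0 if \<open>Z\<close> is
  empty, whereas \<open>proj_vol\<close> is 1.\<close>

definition coord_vol :: "nat \<Rightarrow> ennreal" where
  "coord_vol j = (\<Sum>I | I \<subseteq> {..<n} \<and> card I = j.
     emeasure (Leb I) ((\<lambda>x. restrict x I) ` Z))"

lemma linear_image_unit_rows:
  assumes "\<And>k. k \<in> I \<Longrightarrow> f k < n"
  shows "X I (\<lambda>k. unit_row (f k)) = (\<lambda>z. \<lambda>k\<in>I. z (f k)) ` Z"
  unfolding linear_image_def using assms by (intro image_cong refl restrict_ext) (simp add: sum_unit_row)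

text \<open>For injective \<open>f\<close> this is a coordinate projection after renaming. Otherwise
  two coordinates of the image coincide, slices along one of them are at most points, and the volume
  is 0.\<close>

lemma leb_vol_unit_rows:
  assumes I: "I \<subseteq> {..<n}" and f: "\<And>k. k \<in> I \<Longrightarrow> f k < n"
  shows "leb_vol I (\<lambda>k. unit_row (f k)) \<le> coord_vol (card I)"
proof (cases "inj_on f I")
  case True
  have finI: "finite I" using I finite_subset by blast
  have fI: "f ` I \<subseteq> {..<n}" using f by auto
  let ?W = "{w \<in> space (Leb (f ` I)). (\<lambda>k\<in>I. w (f k)) \<in> X I (\<lambda>k. unit_row (f k))}"
  have "leb_vol I (\<lambda>k. unit_row (f k)) = emeasure (Leb (f ` I))
      ?W"
    unfolding mixed_vol_def mixed_empty using meas_mixed[OF I, of _ "{}"]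
    by (intro emeasure_PiM_reindex finI True) (simp add: mixed_empty)
  also have "?W =
      (\<lambda>x. restrict x (f ` I)) ` Z"
  proof (intro equalityI subsetI)
    fix w assume "w \<in> ?W"
    then have w: "w \<in> extensional (f ` I)" and "(\<lambda>k\<in>I. w (f k)) \<in> X I (\<lambda>k. unit_row (f k))"
      by (auto simp: space_PiM PiE_def)
    then have "(\<lambda>k\<in>I. w (f k)) \<in> (\<lambda>z. \<lambda>k\<in>I. z (f k)) ` Z"
      using linear_image_unit_rows[of I f] f by simp
    then obtain z where z: "z \<in> Z" "(\<lambda>k\<in>I. w (f k)) = (\<lambda>k\<in>I. z (f k))" by blast
    have "w = restrict z (f ` I)"
    proof (rule extensionalityI[OF w])
      fix j assume "j \<in> f ` I"
      then obtain k where k: "k \<in> I" "j = f k" by blast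
      then show "w j = restrict z (f ` I) j" using fun_cong[OF z(2), of k] by simp
    qed simp
    then show "w \<in> (\<lambda>x. restrict x (f ` I)) ` Z" using z by blast
  next
    fix w assume "w \<in> (\<lambda>x. restrict x (f ` I)) ` Z"
    then obtain z where "z \<in> Z" "w = restrict z (f ` I)" by blast
    moreover have "(\<lambda>k\<in>I. restrict z (f ` I) (f k)) = (\<lambda>k\<in>I. z (f k))" by (rule restrict_ext) auto
    ultimately show "w \<in> ?W"
      using linear_image_unit_rows[of I f] f by (auto simp: space_PiM)
  qed
  also have "emeasure (Leb (f ` I)) ((\<lambda>x. restrict x (f ` I)) ` Z) \<le> coord_vol (card I)"
    unfolding coord_vol_def using fI card_image[OF True]
    by (intro member_le_sum[of "f ` I" _ "\<lambda>I. emeasure (Leb I) ((\<lambda>x. restrict x I) ` Z)"]) auto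
  finally show ?thesis .
next
  case False
  then obtain k k' where k: "k \<in> I" "k' \<in> I" "k \<noteq> k'" "f k = f k'" unfolding inj_on_def by blast
  let ?K = "I - {k}" and ?p = "\<lambda>k. unit_row (f k)"
  interpret L: product_sigma_finite "\<lambda>_::nat. lborel :: real measure" by standard
  have I': "insert k ?K = I" "?K \<subseteq> {..<n}" "finite ?K" using I k(1) finite_subset by auto
  have "leb_vol I ?p = (\<integral>\<^sup>+w. emeasure lborel {t. w(k := t) \<in> X I ?p} \<partial>Leb ?K)"
    using L.emeasure_PiM_insert(1)[of ?K k "X I ?p", unfolded I'] I' meas_mixed[OF I, of ?p "{}"]
    unfolding mixed_vol_def mixed_empty by auto
  also have "\<dots> = (\<integral>\<^sup>+w. 0 \<partial>Leb ?K)"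
  proof (intro nn_integral_cong)
    fix w :: "nat \<Rightarrow> real"
    have "{t. w(k := t) \<in> X I ?p} \<subseteq> {w k'}"
    proof
      fix t assume "t \<in> {t. w(k := t) \<in> X I ?p}"
      then have "w(k := t) \<in> (\<lambda>z. \<lambda>k\<in>I. z (f k)) ` Z"
        using linear_image_unit_rows[of I f] f by simp
      then obtain z where z: "w(k := t) = (\<lambda>k\<in>I. z (f k))" by blast
      show "t \<in> {w k'}" using fun_cong[OF z, of k] fun_cong[OF z, of k'] k by simp
    qed
    then have "emeasure lborel {t. w(k := t) \<in> X I ?p} \<le> emeasure lborel {w k'}"
      by (intro emeasure_mono) auto
    then show "emeasure lborel {t. w(k := t) \<in> X I ?p} = 0" by simp
  qed
  finally show ?thesis by simp
qed

text \<open>\<open>K\<close> contains the rows that are still to be replaced. Each replacement costs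
  the factor \<open>h ^ n * b k\<close> and leads to a sum over \<open>n\<close> unit rows.\<close>

lemma leb_vol_le_coord_vol_aux:
  assumes "finite K" "K \<subseteq> I" "I \<subseteq> {..<n}"
    and "\<And>k. k \<in> I - K \<Longrightarrow> \<exists>i<n. p k = unit_row i"
    and "\<And>k l. k \<in> K \<Longrightarrow> l < n \<Longrightarrow> \<bar>p k l\<bar> \<le> b k"
    and "\<And>k. k \<in> K \<Longrightarrow> b k \<ge> 0"
  shows "leb_vol I p \<le> of_nat ((h ^ n * n) ^ card K) * ennreal (\<Prod>k\<in>K. b k) * coord_vol (card I)"
  using assms
proof (induction K arbitrary: p rule: finite_induct)
  case empty
  then obtain f where f: "\<And>k. k \<in> I \<Longrightarrow> f k < n \<and> p k = unit_row (f k)" by (metis Diff_empty)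
  have "leb_vol I p = leb_vol I (\<lambda>k. unit_row (f k))"
    unfolding mixed_vol_def by (subst linear_image_cong[of I n p]) (use f in auto)
  then show ?case using leb_vol_unit_rows[OF empty(2), of f] f by simp
next
  case (insert k K)
  let ?c = "of_nat ((h ^ n * n) ^ card K) * ennreal (\<Prod>k\<in>K. b k) * coord_vol (card I)"
  have b: "0 \<le> b k" using insert.prems by auto
  have "leb_vol I p \<le> of_nat (h ^ n) * (ennreal (b k) * (\<Sum>i<n. leb_vol I (p(k := unit_row i))))"
    using insert.prems by (intro leb_vol_replace_row) auto
  also have "\<dots> \<le> of_nat (h ^ n) * (ennreal (b k) * (\<Sum>i<n. ?c))"
  proof (intro mult_left_mono sum_mono insert.IH)
    fix i j assume i: "i \<in> {..<n}" and j: "j \<in> I - K"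
    show "\<exists>i'<n. (p(k := unit_row i)) j = unit_row i'"
      using i j insert.prems(3)[of j] by (cases "j = k") auto
  qed (use insert.prems insert.hyps in auto)
  also have "\<dots> = of_nat ((h ^ n * n) ^ card (insert k K)) * ennreal (\<Prod>k\<in>insert k K. b k) * coord_vol (card I)"
    using insert.hyps b insert.prems(5) by (simp add: ennreal_mult prod_nonneg mult_ac)
  finally show ?case .
qed

lemma leb_vol_le_coord_vol:
  assumes "I \<subseteq> {..<n}" and "\<And>k l. k \<in> I \<Longrightarrow> l < n \<Longrightarrow> \<bar>p k l\<bar> \<le> b k"
    and "\<And>k. k \<in> I \<Longrightarrow> b k \<ge> 0"
  shows "leb_vol I p \<le> of_nat ((h ^ n * n) ^ card I) * ennreal (\<Prod>k\<in>I. b k) * coord_vol (card I)"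
  using assms finite_subset[OF assms(1)] by (intro leb_vol_le_coord_vol_aux) auto

end

section \<open>Linear change of variables\<close>

definition lmap :: "nat \<Rightarrow> (nat \<Rightarrow> nat \<Rightarrow> real) \<Rightarrow> (nat \<Rightarrow> real) \<Rightarrow> nat \<Rightarrow> real" where
  "lmap n B x = (\<lambda>i\<in>{..<n}. \<Sum>l<n. B i l * x l)"

definition fdet :: "nat \<Rightarrow> (nat \<Rightarrow> nat \<Rightarrow> real) \<Rightarrow> real" where
  "fdet n B = Determinant.det (Matrix.mat n n (\<lambda>(i, l). B i l))"

lemma fdet_mult:
  assumes "\<And>i l. i < n \<Longrightarrow> l < n \<Longrightarrow> C i l = (\<Sum>m<n. B i m * E m l)"
  shows "fdet n C = fdet n B * fdet n E"
proof -
  have "Matrix.mat n n (\<lambda>(i, l). C i l) = Matrix.mat n n (\<lambda>(i, l). B i l) * Matrix.mat n n (\<lambda>(i, l). E i l)"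
    by (rule eq_matI) (auto simp: scalar_prod_def atLeast0LessThan assms)
  then show ?thesis unfolding fdet_def by (simp add: det_mult[of _ n])
qed

text \<open>In the Leibniz formula, a permutation other than the identity moves at least two
  indices, hence one other than \<open>k\<close>, and that row has a zero there.\<close>

lemma fdet_replace_row:
  assumes k: "k < n"
  shows "fdet n (\<lambda>i l. if i = k then p l else if i = l then 1 else 0) = p k"
proof -
  let ?A = "Matrix.mat n n (\<lambda>(i, l). if i = k then p l else if i = l then 1 else 0 :: real)"
  let ?P = "{\<pi>. \<pi> permutes {0..<n}}"
  let ?f = "\<lambda>\<pi>. signof \<pi> * (\<Prod>i = 0..<n. ?A $$ (i, \<pi> i))"
  have "?f \<pi> = 0" if "\<pi> \<in> ?P - {id}" for \<pi>
  proof -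
    have \<pi>: "\<pi> permutes {0..<n}" "\<pi> \<noteq> id" using that by auto
    have "\<exists>i. i < n \<and> i \<noteq> k \<and> \<pi> i \<noteq> i"
    proof (rule ccontr)
      assume *: "\<not> ?thesis"
      then have fix1: "\<pi> i = i" if "i \<noteq> k" for i
        using that \<pi>(1) by (cases "i < n") (auto simp: permutes_def)
      have "\<pi> k = k" using fix1[of "\<pi> k"] permutes_inj[OF \<pi>(1)] by (metis injD)
      then show False using fix1 \<pi>(2) by (metis eq_id_iff)
    qed
    then obtain i where i: "i < n" "i \<noteq> k" "\<pi> i \<noteq> i" by blast
    moreover have "\<pi> i < n" using permutes_in_image[OF \<pi>(1), of i] i by simp
    ultimately have "?A $$ (i, \<pi> i) = 0" by simp
    then have "(\<Prod>i = 0..<n. ?A $$ (i, \<pi> i)) = 0" using i(1) by (intro prod_zero) auto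
    then show ?thesis by simp
  qed
  then have "sum ?f ?P = sum ?f {id}"
    by (intro sum.mono_neutral_right finite_permutations) (auto simp: permutes_id)
  also have "(\<Prod>i = 0..<n. ?A $$ (i, id i)) = (\<Prod>i = 0..<n. if i = k then p k else 1)"
    by (intro prod.cong) auto
  then have "sum ?f {id} = p k" using k by (simp add: sign_id)
  finally show ?thesis unfolding fdet_def by (subst det_def'[of _ n]) auto
qed

lemma fdet_zero_if_dependent_rows:
  assumes "i0 < n" "v i0 \<noteq> 0" "\<And>l. l < n \<Longrightarrow> (\<Sum>i<n. v i * B i l) = 0"
  shows "fdet n B = 0"
proof -
  let ?A = "Matrix.mat n n (\<lambda>(i, l). B i l)"
  have "transpose_mat ?A *\<^sub>v vec n v = 0\<^sub>v n"
    by (rule eq_vecI) (auto simp: scalar_prod_def atLeast0LessThan mult.commute assms(3))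
  moreover have "vec n v \<noteq> 0\<^sub>v n"
    using assms(1,2) by (metis index_vec index_zero_vec(1))
  ultimately have "Determinant.det (transpose_mat ?A) = 0"
    by (subst det_0_iff_vec_prod_zero[of _ n]) (auto intro!: exI[of _ "vec n v"])
  then show ?thesis unfolding fdet_def by (simp add: det_transpose[of _ n])
qed

section \<open>Transformation of Lebesgue measure under invertible matrices\<close>

abbreviation lebn :: "nat \<Rightarrow> (nat \<Rightarrow> real) measure" where
  "lebn n \<equiv> Leb {..<n}"

lemma lmap_measurable: "lmap n B \<in> measurable (lebn n) (lebn n)"
  unfolding lmap_def by (intro measurable_restrict) measurable

text \<open>Stated with preimages, whose measurability follows from that of the map itself.\<close>

definition scales_volume :: "nat \<Rightarrow> (nat \<Rightarrow> nat \<Rightarrow> real) \<Rightarrow> bool" where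
  "scales_volume n B \<longleftrightarrow> (\<forall>X\<in>sets (lebn n).
     emeasure (lebn n) X = ennreal \<bar>fdet n B\<bar> * emeasure (lebn n) (lmap n B -` X \<inter> space (lebn n)))"

lemma lmap_mult:
  assumes "\<And>i l. i < n \<Longrightarrow> l < n \<Longrightarrow> C i l = (\<Sum>m<n. B i m * E m l)"
  shows "lmap n C x = lmap n B (lmap n E x)"
  unfolding lmap_def
proof (rule restrict_ext)
  fix i assume i: "i \<in> {..<n}"
  have "(\<Sum>l<n. C i l * x l) = (\<Sum>l<n. \<Sum>m<n. B i m * (E m l * x l))"
    using i assms by (intro sum.cong refl) (simp add: sum_distrib_right mult.assoc)
  also have "\<dots> = (\<Sum>m<n. B i m * (\<Sum>l<n. E m l * x l))"
    by (subst sum.swap) (simp add: sum_distrib_left)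
  finally show "(\<Sum>l<n. C i l * x l) = (\<Sum>m<n. B i m * (\<lambda>i\<in>{..<n}. \<Sum>l<n. E i l * x l) m)" by simp
qed

lemma scales_volume_mult:
  assumes B: "scales_volume n B" and E: "scales_volume n E"
    and C: "\<And>i l. i < n \<Longrightarrow> l < n \<Longrightarrow> C i l = (\<Sum>m<n. B i m * E m l)"
  shows "scales_volume n C"
  unfolding scales_volume_def
proof
  fix X assume X: "X \<in> sets (lebn n)"
  let ?Y = "lmap n B -` X \<inter> space (lebn n)"
  have Y: "?Y \<in> sets (lebn n)" by (rule measurable_sets[OF lmap_measurable X])
  have "emeasure (lebn n) X = ennreal \<bar>fdet n B\<bar> *
      (ennreal \<bar>fdet n E\<bar> * emeasure (lebn n) (lmap n E -` ?Y \<inter> space (lebn n)))"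
    using B E X Y unfolding scales_volume_def by metis
  also have "lmap n E -` ?Y \<inter> space (lebn n) = lmap n C -` X \<inter> space (lebn n)"
    using measurable_space[OF lmap_measurable[of n E]] lmap_mult[of n C B E, OF C] by auto
  also have "ennreal \<bar>fdet n B\<bar> * (ennreal \<bar>fdet n E\<bar> * emeasure (lebn n) (lmap n C -` X \<inter> space (lebn n))) =
      ennreal \<bar>fdet n C\<bar> * emeasure (lebn n) (lmap n C -` X \<inter> space (lebn n))"
  proof -
    have "fdet n C = fdet n B * fdet n E" by (rule fdet_mult) (rule C)
    then show ?thesis by (simp add: abs_mult ennreal_mult mult.assoc)
  qed
  finally show "emeasure (lebn n) X =
      ennreal \<bar>fdet n C\<bar> * emeasure (lebn n) (lmap n C -` X \<inter> space (lebn n))" .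
qed

definition replace_row :: "nat \<Rightarrow> (nat \<Rightarrow> real) \<Rightarrow> nat \<Rightarrow> nat \<Rightarrow> real" where
  "replace_row k p i l = (if i = k then p l else if i = l then 1 else 0)"

lemma sum_replace_row:
  assumes "k < n" "l < n"
  shows "(\<Sum>m<n. b m * replace_row k p m l) = (if l = k then 0 else b l) + b k * p l"
proof -
  have "(\<Sum>m<n. b m * replace_row k p m l) =
      b k * p l + (\<Sum>m\<in>{..<n} - {k}. b m * (if m = l then 1 else 0))"
    using assms(1) by (subst sum.remove[of _ k]) (auto simp: replace_row_def)
  also have "(\<Sum>m\<in>{..<n} - {k}. b m * (if m = l then 1 else 0)) =
      (\<Sum>m\<in>{..<n} - {k}. if m = l then b m else 0)"
    by (intro sum.cong) auto
  also have "\<dots> = (if l = k then 0 else b l)" using assms by simp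
  finally show ?thesis by simp
qed

text \<open>The map changes only coordinate \<open>k\<close>, and on lines in this direction it is
  affine with slope \<open>p k\<close>; Fubini reduces the claim to the line.\<close>

lemma scales_volume_replace_row:
  assumes k: "k < n" and p: "p k \<noteq> 0"
  shows "scales_volume n (replace_row k p)"
  unfolding scales_volume_def
proof
  fix X assume X: "X \<in> sets (lebn n)"
  let ?K = "{..<n} - {k}"
  interpret L: product_sigma_finite "\<lambda>_::nat. lborel :: real measure" by standard
  have I: "insert k ?K = {..<n}" "finite ?K" using k by auto
  define T where "T X w = {t. w(k := t) \<in> X}" for X :: "(nat \<Rightarrow> real) set" and w
  have fub: "emeasure (lebn n) X = (\<integral>\<^sup>+w. emeasure lborel (T X w) \<partial>Leb ?K)"
    and meas: "(\<lambda>w. emeasure lborel (T X w)) \<in> borel_measurable (Leb ?K)"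
    and setsT: "w \<in> space (Leb ?K) \<Longrightarrow> T X w \<in> sets lborel"
    if "X \<in> sets (lebn n)" for X w
    using L.emeasure_PiM_insert[of ?K k X, unfolded I] I that unfolding T_def by auto
  let ?Y = "lmap n (replace_row k p) -` X \<inter> space (lebn n)"
  have Y: "?Y \<in> sets (lebn n)" by (rule measurable_sets[OF lmap_measurable X])
  have eq: "emeasure lborel (T X w) = ennreal \<bar>p k\<bar> * emeasure lborel (T ?Y w)"
    if w: "w \<in> space (Leb ?K)" for w
  proof -
    define c where "c = (\<Sum>l\<in>?K. p l * w l)"
    have upd: "lmap n (replace_row k p) (w(k := t)) = w(k := c + p k * t)" for t
    proof
      fix i
      have ext: "w i = undefined" if "i \<ge> n" using w that by (auto simp: space_PiM PiE_def extensional_def)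
      have "(\<Sum>l<n. replace_row k p i l * (w(k := t)) l) = (w(k := c + p k * t)) i" if i: "i < n"
      proof (cases "i = k")
        case True
        then show ?thesis using k
          by (subst sum.remove[of _ k]) (auto simp: replace_row_def c_def)
      next
        case False
        then have "(\<Sum>l<n. replace_row k p i l * (w(k := t)) l) = (\<Sum>l<n. if l = i then (w(k := t)) l else 0)"
          by (intro sum.cong) (auto simp: replace_row_def)
        then show ?thesis using i False by simp
      qed
      then show "lmap n (replace_row k p) (w(k := t)) i = (w(k := c + p k * t)) i"
        using ext k by (auto simp: lmap_def)
    qed
    have "w(k := t) \<in> space (lebn n)" for t
      using w k by (auto simp: space_PiM PiE_def extensional_def)
    then have TY: "T ?Y w = {t. c + p k * t \<in> T X w}" unfolding T_def by (auto simp: upd)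
    have "emeasure lborel (T X w) = (\<integral>\<^sup>+t. indicator (T X w) t \<partial>lborel)"
      using setsT[OF X w] by simp
    also have "\<dots> = \<bar>p k\<bar> * (\<integral>\<^sup>+t. indicator (T X w) (c + p k * t) \<partial>lborel)"
      by (rule nn_integral_real_affine) (use setsT[OF X w] p in auto)
    also have "(\<lambda>t. indicator (T X w) (c + p k * t)) = (indicator (T ?Y w) :: _ \<Rightarrow> ennreal)"
      unfolding TY by (auto simp: indicator_def)
    finally show ?thesis using setsT[OF Y w] by simp
  qed
  have "emeasure (lebn n) X = (\<integral>\<^sup>+w. ennreal \<bar>p k\<bar> * emeasure lborel (T ?Y w) \<partial>Leb ?K)"
    unfolding fub[OF X] by (intro nn_integral_cong eq)
  also have "\<dots> = ennreal \<bar>p k\<bar> * emeasure (lebn n) ?Y"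
    unfolding fub[OF Y] using meas[OF Y] by (intro nn_integral_cmult)
  finally show "emeasure (lebn n) X = ennreal \<bar>fdet n (replace_row k p)\<bar> * emeasure (lebn n) ?Y"
    using fdet_replace_row[OF k, of p] by (simp add: replace_row_def[abs_def])
qed

text \<open>Elimination by columns factors \<open>B\<close> into matrices of the form
  \<open>replace_row k p\<close> with nonzero pivot. \<open>j\<close> is the number of leading rows
  that already agree with the identity; the induction runs downwards from \<open>n\<close>.\<close>

lemma scales_volume_aux:
  assumes "j \<le> n" "fdet n B \<noteq> 0" "\<And>i l. i < j \<Longrightarrow> l < n \<Longrightarrow> B i l = (if i = l then 1 else 0)"
  shows "scales_volume n B"
  using assms
proof (induction j arbitrary: B rule: inc_induct)
  case base
  have "Matrix.mat n n (\<lambda>(i, l). B i l) = 1\<^sub>m n"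
    using base(2) by (intro eq_matI) auto
  then have det: "fdet n B = 1" by (simp add: fdet_def)
  have "lmap n B x = x" if "x \<in> space (lebn n)" for x
  proof
    fix i
    have "(\<Sum>l<n. B i l * x l) = (\<Sum>l<n. if l = i then x l else 0)" if "i < n"
      using base(2) that by (intro sum.cong) auto
    then show "lmap n B x i = x i"
      using that by (auto simp: lmap_def space_PiM PiE_def extensional_def)
  qed
  then have "lmap n B -` X \<inter> space (lebn n) = X" if "X \<in> sets (lebn n)" for X
    using sets.sets_into_space[OF that] by auto
  then show ?case unfolding scales_volume_def by (simp add: det)
next
  case (step k)
  have pivot: "scales_volume n C"
    if C: "fdet n C \<noteq> 0" "\<And>i l. i < k \<Longrightarrow> l < n \<Longrightarrow> C i l = (if i = l then 1 else 0)" "C k k \<noteq> 0" for C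
  proof -
    \<comment> \<open>This is \<open>C\<close> times the inverse of
      \<open>replace_row k (C k)\<close>: row \<open>k\<close> becomes a unit row, and the unit rows
      above are kept.\<close>
    define C' where "C' i l = (if l = k then C i k / C k k else C i l - C i k / C k k * C k l)" for i l
    have CC': "C i l = (\<Sum>m<n. C' i m * replace_row k (C k) m l)" if "i < n" "l < n" for i l
      unfolding sum_replace_row[OF step(2) that(2)] using C(3) by (auto simp: C'_def)
    have "fdet n C' \<noteq> 0" using fdet_mult[of n C C' "replace_row k (C k)", OF CC'] C(1) by auto
    then have "scales_volume n C'"
    proof (rule step.IH)
      fix i l assume il: "i < Suc k" "l < n"
      then consider "i = k" | "i < k" by linarith
      then show "C' i l = (if i = l then 1 else 0)"
      proof cases
        case 2
        then have "C i k = 0" using C(2)[of i k] step(2) by simp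
        then show ?thesis using C(2)[of i l] 2 il by (auto simp: C'_def)
      qed (use C(3) in \<open>auto simp: C'_def\<close>)
    qed
    then show ?thesis
      by (rule scales_volume_mult[OF _ scales_volume_replace_row CC']) (use step(2) C(3) in auto)
  qed
  show ?case
  proof (cases "B k k = 0")
    case False
    then show ?thesis using pivot step.prems by blast
  next
    case True
    have "\<exists>q. k < q \<and> q < n \<and> B k q \<noteq> 0"
    proof (rule ccontr)
      assume no: "\<not> ?thesis"
      \<comment> \<open>Without a nonzero entry from the diagonal on, row \<open>k\<close> is a
        combination of the unit rows above it; \<open>v\<close> is this relation.\<close>
      define v where "v i = (if i = k then 1 else if i < k then - B k i else 0)" for i
      have "(\<Sum>i<n. v i * B i l) = 0" if l: "l < n" for l
      proof -
        have "(\<Sum>i<n. v i * B i l) = B k l + (\<Sum>i\<in>{..<n} - {k}. v i * B i l)"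
          using step(2) by (subst sum.remove[of _ k]) (auto simp: v_def)
        also have "(\<Sum>i\<in>{..<n} - {k}. v i * B i l) = (\<Sum>i\<in>{..<n} - {k}. if i = l then (if i < k then - B k i else 0) else 0)"
          using step.prems(2) l by (intro sum.cong) (auto simp: v_def)
        also have "\<dots> = (if l < k then - B k l else 0)" using l by auto
        also have "B k l + \<dots> = 0" using no True l by (cases l k rule: linorder_cases) auto
        finally show ?thesis .
      qed
      then have "fdet n B = 0"
        using fdet_zero_if_dependent_rows[of k n v B] step(2) by (simp add: v_def)
      then show False using step.prems(1) by simp
    qed
    then obtain q where q: "k < q" "q < n" "B k q \<noteq> 0" by blast
    \<comment> \<open>\<open>r\<close> adds column \<open>q\<close> to column \<open>k\<close>,
      which makes the pivot \<open>B k q\<close>; \<open>s\<close> undoes this. Rows above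
      \<open>k\<close> vanish in column \<open>q\<close> and are unaffected.\<close>
    define r s where "r l = (if l = q \<or> l = k then 1 else 0 :: real)"
      and "s l = (if l = q then 1 else if l = k then -1 else 0 :: real)" for l
    define C where "C i l = B i l + (if l = k then B i q else 0)" for i l
    have CB: "C i l = (\<Sum>m<n. B i m * replace_row q r m l)" if "i < n" "l < n" for i l
      unfolding sum_replace_row[OF q(2) that(2)] using q by (auto simp: C_def r_def)
    have BC: "B i l = (\<Sum>m<n. C i m * replace_row q s m l)" if "i < n" "l < n" for i l
      unfolding sum_replace_row[OF q(2) that(2)] using q by (auto simp: C_def s_def)
    have "fdet n (replace_row q r) = r q"
      using fdet_replace_row[OF q(2), of r] by (simp add: replace_row_def[abs_def])
    then have "fdet n C \<noteq> 0" using fdet_mult[of n C B "replace_row q r", OF CB] step.prems(1) by (simp add: r_def)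
    moreover have "C i l = (if i = l then 1 else 0)" if "i < k" "l < n" for i l
      using step.prems(2)[OF that] step.prems(2)[of i q] that q by (auto simp: C_def)
    moreover have "C k k \<noteq> 0" using True q by (simp add: C_def)
    ultimately have "scales_volume n C" by (rule pivot)
    then show ?thesis
      by (rule scales_volume_mult[OF _ scales_volume_replace_row BC]) (use q in \<open>auto simp: s_def\<close>)
  qed
qed

theorem emeasure_lmap_vimage:
  assumes "fdet n B \<noteq> 0" "X \<in> sets (lebn n)"
  shows "emeasure (lebn n) X =
    ennreal \<bar>fdet n B\<bar> * emeasure (lebn n) (lmap n B -` X \<inter> space (lebn n))"
  using scales_volume_aux[of 0 n B] assms unfolding scales_volume_def by simp

lemma fdet_inverse:
  assumes "fdet n B \<noteq> 0"
  obtains p where "\<And>i l. i < n \<Longrightarrow> l < n \<Longrightarrow> (\<Sum>m<n. B i m * p m l) = (if i = l then 1 else 0)"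
    and "\<And>i l. i < n \<Longrightarrow> l < n \<Longrightarrow> (\<Sum>m<n. p i m * B m l) = (if i = l then 1 else 0)"
proof -
  let ?A = "Matrix.mat n n (\<lambda>(i, l). B i l)"
  have A: "?A \<in> carrier_mat n n" by simp
  define p where "p i l = adj_mat ?A $$ (i, l) / fdet n B" for i l
  have adj: "adj_mat ?A \<in> carrier_mat n n" "?A * adj_mat ?A = fdet n B \<cdot>\<^sub>m 1\<^sub>m n"
    "adj_mat ?A * ?A = fdet n B \<cdot>\<^sub>m 1\<^sub>m n"
    using adj_mat[OF A] by (auto simp: fdet_def)
  show thesis
  proof
    fix i l assume il: "i < n" "l < n"
    have "(?A * adj_mat ?A) $$ (i, l) = (\<Sum>m<n. B i m * adj_mat ?A $$ (m, l))"
      using il adj(1) by (simp add: scalar_prod_def atLeast0LessThan)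
    then show "(\<Sum>m<n. B i m * p m l) = (if i = l then 1 else 0)"
      using il assms unfolding adj(2) p_def by (simp flip: sum_divide_distrib add: field_simps)
    have "(adj_mat ?A * ?A) $$ (i, l) = (\<Sum>m<n. adj_mat ?A $$ (i, m) * B m l)"
      using il adj(1) by (simp add: scalar_prod_def atLeast0LessThan)
    then show "(\<Sum>m<n. p i m * B m l) = (if i = l then 1 else 0)"
      using il assms unfolding adj(3) p_def by (simp flip: sum_divide_distrib add: field_simps)
  qed
qed

section \<open>Reduced lattice bases\<close>

definition ip :: "nat \<Rightarrow> (nat \<Rightarrow> real) \<Rightarrow> (nat \<Rightarrow> real) \<Rightarrow> real" where
  "ip d x y = (\<Sum>l<d. x l * y l)"

definition comb :: "nat \<Rightarrow> (nat \<Rightarrow> nat \<Rightarrow> real) \<Rightarrow> (nat \<Rightarrow> real) \<Rightarrow> nat \<Rightarrow> real" where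
  "comb k b y = (\<lambda>l. \<Sum>i<k. y i * b i l)"

definition proj_orth :: "nat \<Rightarrow> (nat \<Rightarrow> real) \<Rightarrow> (nat \<Rightarrow> real) \<Rightarrow> nat \<Rightarrow> real" where
  "proj_orth d u x = (\<lambda>l. x l - ip d x u / ip d u u * u l)"

lemma enorm_sq: "(enorm d x)\<^sup>2 = ip d x x"
  by (simp add: enorm_def L2_set_def ip_def sum_nonneg power2_eq_square)

lemma enorm_nonneg [simp]: "enorm d x \<ge> 0"
  by (simp add: enorm_def L2_set_nonneg)

lemma enorm_cong: "(\<And>l. l < d \<Longrightarrow> x l = y l) \<Longrightarrow> enorm d x = enorm d y"
  unfolding enorm_def by (intro L2_set_cong) auto

lemma enorm_eq_0: "enorm d x = 0 \<longleftrightarrow> (\<forall>l<d. x l = 0)"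
  by (auto simp: enorm_def L2_set_eq_0_iff)

lemma enorm_add: "enorm d (\<lambda>l. x l + y l) \<le> enorm d x + enorm d y"
  unfolding enorm_def by (rule L2_set_triangle_ineq)

lemma enorm_scale: "enorm d (\<lambda>l. c * x l) = \<bar>c\<bar> * enorm d x"
proof -
  have "(\<Sum>l<d. (c * x l)\<^sup>2) = c\<^sup>2 * (\<Sum>l<d. (x l)\<^sup>2)"
    by (simp add: power_mult_distrib sum_distrib_left)
  then show ?thesis by (simp add: enorm_def L2_set_def real_sqrt_mult)
qed

lemma enorm_comb: "enorm d (comb k b y) \<le> (\<Sum>i<k. \<bar>y i\<bar> * enorm d (b i))"
proof (induction k)
  case 0
  have "enorm d (comb 0 b y) = 0" by (simp add: comb_def enorm_eq_0)
  then show ?case by simp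
next
  case (Suc k)
  have "enorm d (comb (Suc k) b y) \<le> enorm d (comb k b y) + enorm d (\<lambda>l. y k * b k l)"
    using enorm_add[of d "comb k b y" "\<lambda>l. y k * b k l"] by (simp add: comb_def)
  then show ?case using Suc by (simp add: enorm_scale)
qed

lemma comb_Suc: "comb (Suc k) b y = (\<lambda>l. y 0 * b 0 l + comb k (\<lambda>i. b (Suc i)) (\<lambda>i. y (Suc i)) l)"
  unfolding comb_def by (simp only: sum.lessThan_Suc_shift)

lemma comb_unit: "i < k \<Longrightarrow> comb k b (\<lambda>j. if j = i then c else 0) = (\<lambda>l. c * b i l)"
  unfolding comb_def by (auto simp: if_distrib[of "\<lambda>c. c * _"] cong: if_cong)

lemma lin_indep_iff_comb:
  "lin_indep d k b \<longleftrightarrow> (\<forall>y. enorm d (comb k b y) = 0 \<longrightarrow> (\<forall>i<k. y i = 0))"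
  unfolding lin_indep_def comb_def enorm_eq_0 ..

lemma lin_indep_nonzero:
  assumes "lin_indep d k b" "i < k"
  shows "enorm d (b i) > 0"
proof -
  have "enorm d (b i) \<noteq> 0"
  proof
    assume "enorm d (b i) = 0"
    then have "enorm d (comb k b (\<lambda>j. if j = i then 1 else 0)) = 0"
      unfolding comb_unit[OF assms(2)] by simp
    then show False using assms unfolding lin_indep_iff_comb by fastforce
  qed
  then show ?thesis using enorm_nonneg[of d "b i"] by linarith
qed

lemma ip_lin: "ip d (\<lambda>l. x l + c * y l) u = ip d x u + c * ip d y u"
  by (simp add: ip_def distrib_right sum.distrib sum_distrib_left mult.assoc)

lemma proj_orth_comb: "proj_orth d u (comb k b y) = comb k (\<lambda>i. proj_orth d u (b i)) y"
proof
  fix l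
  have "ip d (comb k b y) u = (\<Sum>i<k. y i * ip d (b i) u)"
    unfolding ip_def comb_def sum_distrib_right sum_distrib_left
    by (subst sum.swap) (simp add: mult.assoc)
  then show "proj_orth d u (comb k b y) l = comb k (\<lambda>i. proj_orth d u (b i)) y l"
    by (simp add: proj_orth_def comb_def sum_subtractf sum_divide_distrib sum_distrib_right
        right_diff_distrib mult.assoc)
qed

lemma proj_orth_lin:
  "proj_orth d u (\<lambda>l. x l + c * y l) = (\<lambda>l. proj_orth d u x l + c * proj_orth d u y l)"
  unfolding proj_orth_def ip_lin by (rule ext) (simp add: algebra_simps add_divide_distrib)

lemma pythagoras:
  assumes "enorm d u > 0"
  shows "(enorm d x)\<^sup>2 = (enorm d (proj_orth d u x))\<^sup>2 + (ip d x u)\<^sup>2 / (enorm d u)\<^sup>2"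
proof -
  define t where "t = ip d x u / ip d u u"
  have u: "ip d u u > 0" using assms by (simp flip: enorm_sq)
  have "ip d (proj_orth d u x) (proj_orth d u x) = (\<Sum>l<d. x l * x l - 2 * t * (x l * u l) + t\<^sup>2 * (u l * u l))"
    unfolding ip_def proj_orth_def t_def[unfolded ip_def, symmetric]
    by (intro sum.cong) (auto simp: algebra_simps power2_eq_square)
  also have "\<dots> = ip d x x - 2 * t * ip d x u + t\<^sup>2 * ip d u u"
    by (simp add: sum.distrib sum_subtractf sum_distrib_left ip_def)
  also have "\<dots> = ip d x x - (ip d x u)\<^sup>2 / ip d u u"
    using u by (simp add: t_def power2_eq_square field_simps)
  finally show ?thesis by (simp add: enorm_sq)
qed

lemma enorm_proj_orth_le:
  assumes "enorm d u > 0"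
  shows "enorm d (proj_orth d u x) \<le> enorm d x"
  by (rule power2_le_imp_le) (use pythagoras[OF assms, of x] in auto)

lemma proj_orth_self: "enorm d u > 0 \<Longrightarrow> proj_orth d u u = (\<lambda>_. 0)"
  by (auto simp: proj_orth_def simp flip: enorm_sq)

text \<open>A relation between the projections becomes a relation between the original vectors when
  \<open>b 0\<close> receives the coefficient \<open>- t\<close>.\<close>

lemma lin_indep_proj_orth:
  assumes "lin_indep d (Suc k) b"
  shows "lin_indep d k (\<lambda>i. proj_orth d (b 0) (b (Suc i)))"
  unfolding lin_indep_iff_comb
proof (intro allI impI)
  fix y i assume 0: "enorm d (comb k (\<lambda>i. proj_orth d (b 0) (b (Suc i))) y) = 0" and i: "i < k"
  define x where "x = comb k (\<lambda>i. b (Suc i)) y"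
  define t where "t = ip d x (b 0) / ip d (b 0) (b 0)"
  have "enorm d (proj_orth d (b 0) x) = 0" using 0 by (simp add: x_def proj_orth_comb)
  moreover have "comb (Suc k) b (case_nat (- t) y) = proj_orth d (b 0) x"
    unfolding comb_Suc by (auto simp: proj_orth_def x_def t_def)
  ultimately have "\<forall>j<Suc k. case_nat (- t) y j = 0"
    using assms unfolding lin_indep_iff_comb by metis
  then show "y i = 0" using i by (metis Suc_less_eq old.nat.simps(5))
qed

text \<open>Projecting orthogonally to \<open>b 0\<close> keeps the other coefficients, which
  induction bounds; \<open>y 0\<close> is then bounded through the remainder. Here \<open>c\<close>
  may depend on \<open>b\<close>; the lemma provides the discreteness of the lattice.\<close>

lemma coefficient_bound:
  assumes "lin_indep d k b"
  shows "\<exists>c>0. \<forall>y. \<forall>i<k. \<bar>y i\<bar> \<le> c * enorm d (comb k b y)"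
  using assms
proof (induction k arbitrary: b)
  case (Suc k)
  let ?u = "b 0" and ?b = "\<lambda>i. b (Suc i)"
  have u: "enorm d ?u > 0" using lin_indep_nonzero[OF Suc.prems, of 0] by simp
  obtain c where c: "c > 0" "\<And>y i. i < k \<Longrightarrow>
      \<bar>y i\<bar> \<le> c * enorm d (comb k (\<lambda>i. proj_orth d ?u (?b i)) y)"
    using Suc.IH[OF lin_indep_proj_orth[OF Suc.prems]] by blast
  define S where "S = (\<Sum>i<k. c * enorm d (?b i))"
  have S: "S \<ge> 0" unfolding S_def using c by (intro sum_nonneg) auto
  define c' where "c' = c + (1 + S) / enorm d ?u"
  have "\<bar>y i\<bar> \<le> c' * enorm d (comb (Suc k) b y)" if "i < Suc k" for y i
  proof -
    define x where "x = comb (Suc k) b y"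
    let ?y = "\<lambda>i. y (Suc i)"
    have x: "x = (\<lambda>l. comb k ?b ?y l + y 0 * ?u l)" by (simp add: x_def comb_Suc add.commute)
    have "proj_orth d ?u x = comb k (\<lambda>i. proj_orth d ?u (?b i)) ?y"
      unfolding x proj_orth_lin proj_orth_self[OF u] by (simp add: proj_orth_comb)
    then have tail: "\<bar>y (Suc j)\<bar> \<le> c * enorm d x" if "j < k" for j
      using c(2)[OF that, of ?y] enorm_proj_orth_le[OF u, of x] c(1)
      by (metis mult_left_mono less_imp_le order_trans)
    have "\<bar>y 0\<bar> * enorm d ?u = enorm d (\<lambda>l. x l + (-1) * comb k ?b ?y l)"
      by (simp add: x flip: enorm_scale)
    also have "\<dots> \<le> enorm d x + enorm d (comb k ?b ?y)"
      using enorm_add[of d x "\<lambda>l. (-1) * comb k ?b ?y l"] enorm_scale[of d "-1" "comb k ?b ?y"] by simp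
    also have "enorm d (comb k ?b ?y) \<le> (\<Sum>i<k. \<bar>?y i\<bar> * enorm d (?b i))" by (rule enorm_comb)
    also have "\<dots> \<le> (\<Sum>i<k. c * enorm d x * enorm d (?b i))"
      by (intro sum_mono mult_right_mono tail) auto
    also have "\<dots> = S * enorm d x" unfolding S_def sum_distrib_right by (simp add: mult_ac)
    finally have y0: "\<bar>y 0\<bar> \<le> (1 + S) / enorm d ?u * enorm d x" using u by (simp add: field_simps)
    have "0 \<le> (1 + S) / enorm d ?u * enorm d x" "0 \<le> c * enorm d x" using S u c by auto
    then show ?thesis using y0 tail that unfolding x_def[symmetric] c'_def distrib_right
      by (cases i) (auto intro: add_increasing add_increasing2)
  qed
  moreover have "c' > 0" unfolding c'_def using c S u by (intro add_pos_nonneg) auto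
  ultimately show ?case by blast
qed (auto intro!: exI[of _ 1])

section \<open>Elementary integer row operations\<close>

definition row_add :: "nat \<Rightarrow> nat \<Rightarrow> int \<Rightarrow> (nat \<Rightarrow> nat \<Rightarrow> real) \<Rightarrow> nat \<Rightarrow> nat \<Rightarrow> real" where
  "row_add i j m b = b(i := \<lambda>l. b i l + of_int m * b j l)"

text \<open>Generated by single row operations, so that invariance of the lattice and of
  independence is checked for one operation at a time.\<close>

inductive equiv_basis :: "nat \<Rightarrow> (nat \<Rightarrow> nat \<Rightarrow> real) \<Rightarrow> (nat \<Rightarrow> nat \<Rightarrow> real) \<Rightarrow> bool" for k b where
  self: "equiv_basis k b b"
| row: "equiv_basis k b b' \<Longrightarrow> i < k \<Longrightarrow> j < k \<Longrightarrow> i \<noteq> j \<Longrightarrow> equiv_basis k b (row_add i j m b')"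

lemma equiv_basis_trans:
  assumes "equiv_basis k b' b''" "equiv_basis k b b'"
  shows "equiv_basis k b b''"
  using assms by (induction rule: equiv_basis.induct) (auto intro: equiv_basis.row)

lemma comb_row_add:
  assumes "i < k" "j < k" "i \<noteq> j"
  shows "comb k (row_add i j m b) y = comb k b (y(j := y j + of_int m * y i))"
proof
  fix l
  have "comb k (row_add i j m b) y l = y i * (b i l + of_int m * b j l) + (\<Sum>q\<in>{..<k} - {i}. y q * b q l)"
    unfolding comb_def using assms(1) by (subst sum.remove[of _ i]) (auto simp: row_add_def)
  moreover have "(\<Sum>q\<in>{..<k} - {i}. y q * b q l) = comb k b y l - y i * b i l"
    unfolding comb_def using assms(1) by (subst (2) sum.remove[of _ i]) auto
  moreover have "comb k b (y(j := y j + of_int m * y i)) l = of_int m * y i * b j l + comb k b y l"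
    unfolding comb_def using assms(2)
    by (subst (1 2) sum.remove[of _ j]) (auto simp: algebra_simps)
  ultimately show "comb k (row_add i j m b) y l = comb k b (y(j := y j + of_int m * y i)) l"
    by (simp add: algebra_simps)
qed

lemma lin_indep_equiv_basis:
  assumes "equiv_basis k b b'" "lin_indep d k b"
  shows "lin_indep d k b'"
  using assms
proof (induction rule: equiv_basis.induct)
  case (row b' i j m)
  show ?case
    unfolding lin_indep_iff_comb comb_row_add[OF row.hyps(2-4)]
  proof (intro allI impI)
    fix y q assume "enorm d (comb k b' (y(j := y j + of_int m * y i))) = 0" "q < k"
    then have "\<forall>q<k. (y(j := y j + of_int m * y i)) q = 0"
      using row unfolding lin_indep_iff_comb by blast
    then have "y i = 0" "y j + of_int m * y i = 0" "q \<noteq> j \<Longrightarrow> y q = 0"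
      using row.hyps \<open>q < k\<close> by (auto dest: spec[of _ i] spec[of _ j])
    then show "y q = 0" by (cases "q = j") auto
  qed
qed

lemma int_comb_equiv_basis:
  assumes "equiv_basis k b b'"
  shows "(\<exists>z'::nat \<Rightarrow> int. comb k b' (\<lambda>i. of_int (z i)) = comb k b (\<lambda>i. of_int (z' i)))"
    and "(\<exists>z'::nat \<Rightarrow> int. comb k b (\<lambda>i. of_int (z i)) = comb k b' (\<lambda>i. of_int (z' i)))"
  using assms
proof (induction arbitrary: z rule: equiv_basis.induct)
  case (row b' i j m)
  {
    case 1
    have "comb k (row_add i j m b') (\<lambda>i. of_int (z i)) = comb k b' (\<lambda>q. of_int ((z(j := z j + m * z i)) q))"
      unfolding comb_row_add[OF row.hyps(2-4)] by (rule arg_cong[where f = "comb k b'"]) auto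
    then show ?case using row.IH(1) by metis
  next
    case 2
    obtain z' :: "nat \<Rightarrow> int" where z': "comb k b (\<lambda>i. of_int (z i)) = comb k b' (\<lambda>i. of_int (z' i))"
      using row.IH(2) by blast
    have "comb k (row_add i j m b') (\<lambda>q. of_int ((z'(j := z' j - m * z' i)) q)) = comb k b' (\<lambda>i. of_int (z' i))"
      unfolding comb_row_add[OF row.hyps(2-4)] using row.hyps(4)
      by (intro arg_cong[where f = "comb k b'"]) auto
    then show ?case using z' by metis
  }
qed auto

lemma equiv_basis_to_front:
  assumes "i < k"
  shows "\<exists>b'. equiv_basis k b b' \<and> b' 0 = b i"
proof (cases "i = 0")
  case False
  \<comment> \<open>Row 0 becomes \<open>b 0 + b i\<close>, then row \<open>i\<close> becomes
    \<open>- b 0\<close>, then row 0 becomes \<open>b i\<close>: a swap up to sign.\<close>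
  let ?b1 = "row_add 0 i 1 b"
  let ?b2 = "row_add i 0 (-1) ?b1"
  let ?b3 = "row_add 0 i 1 ?b2"
  have "equiv_basis k b ?b3"
    using assms False by (intro equiv_basis.intros) auto
  moreover have "?b3 0 = b i" using False by (auto simp: row_add_def)
  ultimately show ?thesis by blast
qed (auto intro: equiv_basis.self)

text \<open>Orthogonal projection is linear, so a row operation on projected vectors is the
  projection of the same operation on the vectors with index shifted by one, which leaves
  \<open>b 0\<close> alone.\<close>

lemma equiv_basis_lift:
  assumes "equiv_basis k (\<lambda>i. proj_orth d (b 0) (b (Suc i))) c"
  shows "\<exists>b'. equiv_basis (Suc k) b b' \<and> b' 0 = b 0 \<and> (\<forall>i. c i = proj_orth d (b 0) (b' (Suc i)))"
  using assms
proof (induction rule: equiv_basis.induct)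
  case self
  then show ?case using equiv_basis.self by blast
next
  case (row c i j m)
  then obtain b' where b': "equiv_basis (Suc k) b b'" "b' 0 = b 0" "\<And>i. c i = proj_orth d (b 0) (b' (Suc i))"
    by blast
  have "equiv_basis (Suc k) b (row_add (Suc i) (Suc j) m b')"
    using b'(1) row.hyps by (intro equiv_basis.row) auto
  moreover have "row_add (Suc i) (Suc j) m b' 0 = b 0"
    "\<And>q. row_add i j m c q = proj_orth d (b 0) (row_add (Suc i) (Suc j) m b' (Suc q))"
    using b' by (auto simp: row_add_def proj_orth_lin)
  ultimately show ?case by blast
qed

text \<open>Subtracting the nearest integer multiple of \<open>b 0\<close> leaves a component along
  \<open>b 0\<close> of at most half its length and does not affect the projections orthogonal to
  \<open>b 0\<close>.\<close>

lemma size_reduce: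
  assumes u: "enorm d (b 0) > 0" and "j \<le> k"
  shows "\<exists>b'. equiv_basis (Suc k) b b' \<and> b' 0 = b 0 \<and>
    (\<forall>i. proj_orth d (b 0) (b' (Suc i)) = proj_orth d (b 0) (b (Suc i))) \<and>
    (\<forall>i<j. \<bar>ip d (b' (Suc i)) (b 0)\<bar> \<le> (enorm d (b 0))\<^sup>2 / 2)"
  using assms(2)
proof (induction j)
  case 0
  then show ?case using equiv_basis.self by blast
next
  case (Suc j)
  then obtain b' where b': "equiv_basis (Suc k) b b'" "b' 0 = b 0"
    "\<And>i. proj_orth d (b 0) (b' (Suc i)) = proj_orth d (b 0) (b (Suc i))"
    "\<And>i. i < j \<Longrightarrow> \<bar>ip d (b' (Suc i)) (b 0)\<bar> \<le> (enorm d (b 0))\<^sup>2 / 2" by auto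
  define t where "t = ip d (b' (Suc j)) (b 0) / (enorm d (b 0))\<^sup>2"
  define m where "m = - round t"
  let ?b = "row_add (Suc j) 0 m b'"
  have "equiv_basis (Suc k) b ?b" using b'(1) Suc.prems by (intro equiv_basis.row) auto
  moreover have "ip d (?b (Suc j)) (b 0) = (t - round t) * (enorm d (b 0))\<^sup>2"
  proof -
    have "ip d (?b (Suc j)) (b 0) = ip d (b' (Suc j)) (b 0) + of_int m * ip d (b 0) (b 0)"
      using ip_lin[of d "b' (Suc j)" "of_int m" "b 0" "b 0"] by (simp add: row_add_def b'(2))
    moreover have "ip d (b' (Suc j)) (b 0) = t * (enorm d (b 0))\<^sup>2" using u by (simp add: t_def)
    ultimately show ?thesis by (simp add: m_def enorm_sq[symmetric] left_diff_distrib)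
  qed
  then have "\<bar>ip d (?b (Suc j)) (b 0)\<bar> \<le> 1 / 2 * (enorm d (b 0))\<^sup>2"
    using mult_right_mono[OF of_int_round_abs_le[of t], of "(enorm d (b 0))\<^sup>2"]
    by (simp add: abs_mult abs_minus_commute)
  moreover have "?b 0 = b 0" "\<And>i. proj_orth d (b 0) (?b (Suc i)) = proj_orth d (b 0) (b (Suc i))"
    "\<And>i. i \<noteq> j \<Longrightarrow> ?b (Suc i) = b' (Suc i)"
    using b' by (auto simp: row_add_def proj_orth_lin proj_orth_self[OF u])
  ultimately show ?case
    using b'(4) by (intro exI[of _ ?b]) (auto simp: less_Suc_eq)
qed

text \<open>The first vector of the reduced basis is almost as short as any vector that occurs in an
  equivalent basis. After size reduction every other basis vector has therefore a comparably
  large component orthogonal to the first one, and induction applies to these components.\<close>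

lemma reduced_basis_exists:
  "\<exists>c\<ge>0. \<forall>b. lin_indep d k b \<longrightarrow> (\<exists>b'. equiv_basis k b b' \<and>
     (\<forall>y. \<forall>i<k. \<bar>y i\<bar> * enorm d (b' i) \<le> c * enorm d (comb k b' y)))"
proof (induction k)
  case 0
  then show ?case by (intro exI[of _ 0]) (auto intro: equiv_basis.self)
next
  case (Suc k)
  then obtain c where c: "c \<ge> 0" "\<And>b. lin_indep d k b \<Longrightarrow> \<exists>b'. equiv_basis k b b' \<and>
     (\<forall>y. \<forall>i<k. \<bar>y i\<bar> * enorm d (b' i) \<le> c * enorm d (comb k b' y))" by blast
  \<comment> \<open>\<open>1 + 2 * c * k\<close> comes from the coefficient of the first vector and
    \<open>2 * c\<close> from the others; the factor 2 is that of \<open>tail_norm\<close>.\<close>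
  define c' where "c' = 1 + 2 * c * k + 2 * c"
  have "\<exists>b'. equiv_basis (Suc k) b b' \<and>
     (\<forall>y. \<forall>i<Suc k. \<bar>y i\<bar> * enorm d (b' i) \<le> c' * enorm d (comb (Suc k) b' y))"
    if b: "lin_indep d (Suc k) b" for b
  proof -
    define N where "N = {enorm d (b' i) | b' i. equiv_basis (Suc k) b b' \<and> i < Suc k}"
    obtain C where C: "C > 0" "\<And>y i. i < Suc k \<Longrightarrow> \<bar>y i\<bar> \<le> C * enorm d (comb (Suc k) b y)"
      using coefficient_bound[OF b] by blast
    \<comment> \<open>A vector of an equivalent basis is a nonzero integer combination of
      \<open>b\<close>, so one of its coefficients has absolute value at least 1.\<close>
    have low: "1 / C \<le> v" if vN: "v \<in> N" for v
    proof -
      obtain b' i where v: "v = enorm d (b' i)" "equiv_basis (Suc k) b b'" "i < Suc k"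
        using vN unfolding N_def by blast
      obtain z :: "nat \<Rightarrow> int" where
        "comb (Suc k) b' (\<lambda>j. of_int (if j = i then 1 else 0)) = comb (Suc k) b (\<lambda>i. of_int (z i))"
        using int_comb_equiv_basis(1)[OF v(2), of "\<lambda>j. if j = i then 1 else 0"] by blast
      moreover have "comb (Suc k) b' (\<lambda>j. of_int (if j = i then 1 else 0)) = b' i"
        using comb_unit[OF v(3), of b' 1] by (simp add: if_distrib[of real_of_int] cong: if_cong)
      ultimately have z: "b' i = comb (Suc k) b (\<lambda>i. of_int (z i))" by simp
      have "enorm d (b' i) > 0" by (rule lin_indep_nonzero[OF lin_indep_equiv_basis[OF v(2) b] v(3)])
      moreover have "enorm d (comb (Suc k) b (\<lambda>i. of_int (z i))) = 0" if "\<forall>j<Suc k. z j = 0"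
        using that unfolding enorm_eq_0 comb_def by simp
      ultimately obtain j where j: "j < Suc k" "z j \<noteq> 0" using z by fastforce
      then have "1 \<le> \<bar>real_of_int (z j)\<bar>" by linarith
      also have "\<dots> \<le> C * v" using C(2)[OF j(1), of "\<lambda>i. of_int (z i)"] by (simp add: v(1) z)
      finally show ?thesis using C(1) by (simp add: field_simps)
    qed
    have "N \<noteq> {}" unfolding N_def using equiv_basis.self by blast
    moreover have bdd: "bdd_below N" using low by (rule bdd_belowI)
    ultimately have "Inf N \<ge> 1 / C" using low by (intro cInf_greatest)
    then have "Inf N > 0" using C(1) by (meson less_le_trans zero_less_divide_1_iff)
    \<comment> \<open>The slack replaces attainment of the infimum. Any factor above 1 with square
      at most 3 gives the constant 2 in \<open>tail_norm\<close>.\<close>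
    then have "Inf N < 11 / 10 * Inf N" by simp
    then obtain v where v: "v \<in> N" "v < 11 / 10 * Inf N"
      using cInf_less_iff[OF \<open>N \<noteq> {}\<close> bdd, of "11 / 10 * Inf N"] by blast
    have short: "v \<le> 11 / 10 * w" if "w \<in> N" for w
      using cInf_lower[OF that bdd] v(2) by linarith
    obtain b1 i where b1: "equiv_basis (Suc k) b b1" "i < Suc k" "v = enorm d (b1 i)"
      using v(1) unfolding N_def by blast
    obtain b2 where "equiv_basis (Suc k) b1 b2" "b2 0 = b1 i"
      using equiv_basis_to_front[OF b1(2)] by blast
    then have b2: "equiv_basis (Suc k) b b2" "enorm d (b2 0) = v"
      using b1 equiv_basis_trans by auto
    define u where "u = b2 0"
    have ind2: "lin_indep d (Suc k) b2" using lin_indep_equiv_basis b2(1) b by blast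
    have u: "enorm d u > 0" unfolding u_def using lin_indep_nonzero[OF ind2, of 0] by simp
    obtain e where e: "equiv_basis k (\<lambda>i. proj_orth d (b2 0) (b2 (Suc i))) e"
      "\<And>y i. i < k \<Longrightarrow> \<bar>y i\<bar> * enorm d (e i) \<le> c * enorm d (comb k e y)"
      using c(2)[OF lin_indep_proj_orth[OF ind2]] by blast
    obtain b3 where b3: "equiv_basis (Suc k) b2 b3" "b3 0 = u" "\<And>i. e i = proj_orth d u (b3 (Suc i))"
      using equiv_basis_lift[OF e(1)] unfolding u_def by blast
    obtain b4 where b4: "equiv_basis (Suc k) b3 b4" "b4 0 = u"
      "\<And>i. e i = proj_orth d u (b4 (Suc i))"
      "\<And>i. i < k \<Longrightarrow> \<bar>ip d (b4 (Suc i)) u\<bar> \<le> (enorm d u)\<^sup>2 / 2"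
      using size_reduce[of d b3 k k] u b3 by auto
    have eqv: "equiv_basis (Suc k) b b4"
      using equiv_basis_trans b2(1) b3(1) b4(1) by blast
    have tail_norm: "enorm d (b4 (Suc i)) \<le> 2 * enorm d (e i)" if i: "i < k" for i
    proof -
      let ?x = "b4 (Suc i)"
      have "(ip d ?x u)\<^sup>2 \<le> ((enorm d u)\<^sup>2 / 2)\<^sup>2"
        using b4(4)[OF i] by (metis abs_ge_zero power2_abs power_mono)
      then have "(ip d ?x u)\<^sup>2 / (enorm d u)\<^sup>2 \<le> ((enorm d u)\<^sup>2 / 2)\<^sup>2 / (enorm d u)\<^sup>2"
        by (intro divide_right_mono) auto
      also have "\<dots> = (enorm d u)\<^sup>2 / 4" using u by (simp add: power2_eq_square)
      finally have x: "(enorm d ?x)\<^sup>2 \<le> (enorm d (e i))\<^sup>2 + (enorm d u)\<^sup>2 / 4"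
        using pythagoras[OF u, of ?x] by (simp add: b4(3))
      have "enorm d ?x \<in> N" unfolding N_def using eqv i by blast
      then have "enorm d u \<le> 11 / 10 * enorm d ?x" using short b2(2) by (simp add: u_def)
      then have "(enorm d u)\<^sup>2 \<le> (11 / 10 * enorm d ?x)\<^sup>2" using u by (intro power_mono) auto
      then have "(enorm d u)\<^sup>2 \<le> 121 / 100 * (enorm d ?x)\<^sup>2" by (simp add: power_mult_distrib power2_eq_square)
      then have "(enorm d ?x)\<^sup>2 \<le> 4 * (enorm d (e i))\<^sup>2"
        using x zero_le_power2[of "enorm d (e i)"] by linarith
      then have "(enorm d ?x)\<^sup>2 \<le> (2 * enorm d (e i))\<^sup>2" by (simp add: power_mult_distrib)
      then show ?thesis by (rule power2_le_imp_le) simp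
    qed
    have "\<bar>y i\<bar> * enorm d (b4 i) \<le> c' * enorm d (comb (Suc k) b4 y)" if "i < Suc k" for y i
    proof -
      define x where "x = comb (Suc k) b4 y"
      let ?b = "\<lambda>i. b4 (Suc i)" and ?y = "\<lambda>i. y (Suc i)"
      have x: "x = (\<lambda>l. comb k ?b ?y l + y 0 * u l)" by (simp add: x_def comb_Suc add.commute b4(2))
      have "proj_orth d u x = comb k e ?y"
        unfolding x proj_orth_lin proj_orth_self[OF u] proj_orth_comb b4(3)[symmetric] by simp
      then have ey: "\<bar>y (Suc j)\<bar> * enorm d (e j) \<le> c * enorm d x" if "j < k" for j
        using e(2)[OF that, of ?y] mult_left_mono[OF enorm_proj_orth_le[OF u, of x] c(1)] by simp
      have tail: "\<bar>y (Suc j)\<bar> * enorm d (?b j) \<le> 2 * c * enorm d x" if "j < k" for j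
        using mult_left_mono[OF tail_norm[OF that], of "\<bar>y (Suc j)\<bar>"] ey[OF that] by simp
      have "\<bar>y 0\<bar> * enorm d u = enorm d (\<lambda>l. x l + (-1) * comb k ?b ?y l)"
        by (simp add: x flip: enorm_scale)
      also have "\<dots> \<le> enorm d x + enorm d (comb k ?b ?y)"
        using enorm_add[of d x "\<lambda>l. (-1) * comb k ?b ?y l"] enorm_scale[of d "-1" "comb k ?b ?y"] by simp
      also have "enorm d (comb k ?b ?y) \<le> (\<Sum>i<k. \<bar>?y i\<bar> * enorm d (?b i))" by (rule enorm_comb)
      also have "\<dots> \<le> (\<Sum>i<k. 2 * c * enorm d x)"
        by (intro sum_mono tail) auto
      also have "\<dots> = 2 * c * k * enorm d x" by simp
      finally have y0: "\<bar>y 0\<bar> * enorm d u \<le> (1 + 2 * c * k) * enorm d x" by (simp add: distrib_right)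
      have "0 \<le> (1 + 2 * c * k) * enorm d x" "0 \<le> 2 * c * enorm d x" using c by auto
      then show ?thesis using y0 tail that unfolding x_def[symmetric] c'_def distrib_right[of _ "2 * c"]
        by (cases i) (auto simp: b4(2) intro: add_increasing add_increasing2)
    qed
    then show ?thesis using eqv by blast
  qed
  moreover have "c' \<ge> 0" using c(1) by (simp add: c'_def)
  ultimately show ?case by blast
qed

text \<open>Row operations disturb the value \<open>undefined\<close> beyond \<open>n\<close>;
  restriction brings the vectors back into \<open>Rn n\<close>.\<close>

lemma lattice_basis_equiv:
  assumes b: "lattice_basis n b \<Lambda>" and eqv: "equiv_basis n b b'"
  shows "lattice_basis n (\<lambda>i. restrict (b' i) {..<n}) \<Lambda>"
proof -
  let ?r = "\<lambda>i. restrict (b' i) {..<n}"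
  have comb: "restrict (comb n ?r y) {..<n} = restrict (comb n b' y) {..<n}" for y
    by (auto simp: comb_def restrict_def)
  have "lin_indep n n b'" using lin_indep_equiv_basis[OF eqv] b by (simp add: lattice_basis_def)
  then have "lin_indep n n ?r" by (simp add: lin_indep_def)
  moreover have "\<Lambda> = {restrict (comb n b (\<lambda>i. of_int (z i))) {..<n} | z :: nat \<Rightarrow> int. True}"
    using b by (simp add: lattice_basis_def comb_def)
  then have "\<Lambda> = {restrict (comb n b' (\<lambda>i. of_int (z i))) {..<n} | z :: nat \<Rightarrow> int. True}"
    using int_comb_equiv_basis[OF eqv] by (auto; metis)
  then have "\<Lambda> = {restrict (comb n ?r (\<lambda>i. of_int (z i))) {..<n} | z :: nat \<Rightarrow> int. True}"
    by (simp add: comb)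
  ultimately show ?thesis by (simp add: lattice_basis_def comb_def Rn_def)
qed

lemma reduced_lattice_basis:
  "\<exists>c\<ge>0. \<forall>\<Lambda>. full_lattice n \<Lambda> \<longrightarrow> (\<exists>b. lattice_basis n b \<Lambda> \<and>
     (\<forall>y. \<forall>i<n. \<bar>y i\<bar> * enorm n (b i) \<le> c * enorm n (comb n b y)))"
proof -
  obtain c where c: "c \<ge> 0" "\<And>b. lin_indep n n b \<Longrightarrow> \<exists>b'. equiv_basis n b b' \<and>
     (\<forall>y. \<forall>i<n. \<bar>y i\<bar> * enorm n (b' i) \<le> c * enorm n (comb n b' y))"
    using reduced_basis_exists[of n n] by blast
  have "\<exists>b. lattice_basis n b \<Lambda> \<and>
     (\<forall>y. \<forall>i<n. \<bar>y i\<bar> * enorm n (b i) \<le> c * enorm n (comb n b y))" if \<Lambda>: "full_lattice n \<Lambda>" for \<Lambda>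
  proof -
    obtain b where b: "lattice_basis n b \<Lambda>" using \<Lambda> unfolding full_lattice_def by blast
    then obtain b' where b': "equiv_basis n b b'"
      "\<And>y i. i < n \<Longrightarrow> \<bar>y i\<bar> * enorm n (b' i) \<le> c * enorm n (comb n b' y)"
      using c(2)[of b] unfolding lattice_basis_def by blast
    let ?r = "\<lambda>i. restrict (b' i) {..<n}"
    have "enorm n (?r i) = enorm n (b' i)" "enorm n (comb n ?r y) = enorm n (comb n b' y)" for i y
      by (auto intro!: enorm_cong simp: comb_def)
    then show ?thesis using lattice_basis_equiv[OF b b'(1)] b'(2) by (intro exI[of _ ?r]) auto
  qed
  then show ?thesis using c(1) by blast
qed

section \<open>Successive minima and norms of basis vectors\<close>

lemma lattice_basis_mem:
  assumes "lattice_basis n b \<Lambda>" "i < n"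
  shows "b i \<in> \<Lambda>" "b i \<in> Rn n"
proof -
  show Rn: "b i \<in> Rn n" using assms by (simp add: lattice_basis_def)
  have "b i = (\<lambda>l\<in>{..<n}. \<Sum>j<n. of_int (if j = i then 1 else 0) * b j l)"
  proof
    fix l
    show "b i l = (\<lambda>l\<in>{..<n}. \<Sum>j<n. of_int (if j = i then 1 else 0) * b j l) l"
      using fun_cong[OF comb_unit[OF assms(2), of b 1], of l] Rn
      by (auto simp: comb_def Rn_def PiE_def extensional_def if_distrib[of real_of_int] cong: if_cong)
  qed
  then show "b i \<in> \<Lambda>" unfolding lattice_basis_mem_iff[OF assms(1)]
    by (rule exI[of _ "\<lambda>j. if j = i then 1 else 0"])
qed

lemma lattice_minimum_pos:
  assumes "lattice_basis n b \<Lambda>"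
  shows "\<exists>r>0. \<forall>x\<in>\<Lambda>. enorm n x \<noteq> 0 \<longrightarrow> r \<le> enorm n x"
proof -
  obtain c where c: "c > 0" "\<And>y i. i < n \<Longrightarrow> \<bar>y i\<bar> \<le> c * enorm n (comb n b y)"
    using coefficient_bound[of n n b] assms unfolding lattice_basis_def by blast
  have "1 / c \<le> enorm n x" if x: "x \<in> \<Lambda>" "enorm n x \<noteq> 0" for x
  proof -
    obtain z :: "nat \<Rightarrow> int" where z: "x = (\<lambda>l\<in>{..<n}. \<Sum>i<n. of_int (z i) * b i l)"
      using x(1) unfolding lattice_basis_mem_iff[OF assms] by blast
    then have e: "enorm n x = enorm n (comb n b (\<lambda>i. of_int (z i)))"
      by (intro enorm_cong) (simp add: comb_def)
    have "\<exists>i<n. z i \<noteq> 0"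
    proof (rule ccontr)
      assume "\<not> (\<exists>i<n. z i \<noteq> 0)"
      then show False using x(2) unfolding enorm_eq_0 by (auto simp: z)
    qed
    then obtain i where i: "i < n" "z i \<noteq> 0" by blast
    then have "1 \<le> \<bar>real_of_int (z i)\<bar>" by linarith
    also have "\<dots> \<le> c * enorm n x" using c(2)[OF i(1), of "\<lambda>i. of_int (z i)"] by (simp add: e)
    finally show ?thesis using c(1) by (simp add: field_simps)
  qed
  then show ?thesis using c(1) by (intro exI[of _ "1 / c"]) auto
qed

lemma lin_indep_reindex:
  assumes "lin_indep d n b" "inj_on f {..<j}" "f ` {..<j} \<subseteq> {..<n}"
  shows "lin_indep d j (\<lambda>k. b (f k))"
  unfolding lin_indep_def
proof (intro allI impI)
  fix c k assume c: "\<forall>l<d. (\<Sum>i<j. c i * b (f i) l) = 0" and k: "k < j"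
  define c' where "c' i = (if i \<in> f ` {..<j} then c (the_inv_into {..<j} f i) else 0)" for i
  have c'f: "c' (f i) = c i" if "i < j" for i
    using that assms(2) by (simp add: c'_def the_inv_into_f_f)
  have "(\<Sum>i<n. c' i * b i l) = (\<Sum>i<j. c i * b (f i) l)" for l
  proof -
    have "(\<Sum>i<n. c' i * b i l) = (\<Sum>i\<in>f ` {..<j}. c' i * b i l)"
      using assms(3) by (intro sum.mono_neutral_right) (auto simp: c'_def)
    also have "\<dots> = (\<Sum>i<j. c i * b (f i) l)"
      by (subst sum.reindex[OF assms(2)]) (auto intro!: sum.cong simp: c'f)
    finally show ?thesis .
  qed
  then have "\<forall>i<n. c' i = 0" using c assms(1) unfolding lin_indep_def by simp
  then show "c k = 0" using c'f[OF k] assms(3) k by auto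
qed

text \<open>\<open>Inf\<close> is meaningful only for a nonempty set bounded below. The bound is a
  positive lower bound for the norms of nonzero lattice vectors, applied to \<open>v 0\<close>,
  which exists as \<open>i\<close> is at least 1; the basis itself gives an element.\<close>

lemma
  assumes b: "lattice_basis n b \<Lambda>" and i: "1 \<le> i"
  shows succ_min_le: "lin_indep n i v \<Longrightarrow> (\<And>k. k < i \<Longrightarrow> v k \<in> \<Lambda> \<and> v k \<in> Rn n \<and> enorm n (v k) \<le> R)
      \<Longrightarrow> succ_min n \<Lambda> i \<le> R"
    and succ_min_pos: "i \<le> n \<Longrightarrow> succ_min n \<Lambda> i > 0"
proof -
  define A where "A = {r. \<exists>v. (\<forall>k<i. v k \<in> {x \<in> Rn n. enorm n x \<le> r} \<inter> \<Lambda>) \<and> lin_indep n i v}"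
  obtain r where r: "r > 0" "\<And>x. x \<in> \<Lambda> \<Longrightarrow> enorm n x \<noteq> 0 \<Longrightarrow> r \<le> enorm n x"
    using lattice_minimum_pos[OF b] by blast
  have low: "r \<le> s" if s: "s \<in> A" for s
  proof -
    obtain v where v: "\<forall>k<i. v k \<in> {x \<in> Rn n. enorm n x \<le> s} \<inter> \<Lambda>" "lin_indep n i v"
      using s unfolding A_def by blast
    have "enorm n (v 0) > 0" using lin_indep_nonzero[OF v(2)] i by simp
    then have "r \<le> enorm n (v 0)" using r(2)[of "v 0"] v(1) i by force
    also have "\<dots> \<le> s" using v(1) i by auto
    finally show ?thesis .
  qed
  show "succ_min n \<Lambda> i \<le> R"
    if "lin_indep n i v" "\<And>k. k < i \<Longrightarrow> v k \<in> \<Lambda> \<and> v k \<in> Rn n \<and> enorm n (v k) \<le> R"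
  proof -
    have "R \<in> A" unfolding A_def using that by blast
    then show ?thesis unfolding succ_min_def A_def[symmetric] using low
      by (intro cInf_lower bdd_belowI[of _ r]) auto
  qed
  show "succ_min n \<Lambda> i > 0" if "i \<le> n"
  proof -
    let ?R = "\<Sum>k<n. enorm n (b k)"
    have "lin_indep n i (\<lambda>k. b (id k))"
    proof (rule lin_indep_reindex[of n n])
      show "lin_indep n n b" using b by (simp add: lattice_basis_def)
    qed (use that in auto)
    moreover have "enorm n (b k) \<le> ?R" if "k < i" for k
      using that \<open>i \<le> n\<close> by (intro member_le_sum) auto
    ultimately have "?R \<in> A" unfolding A_def
      using lattice_basis_mem[OF b] that by (intro CollectI exI[of _ b]) auto
    then have "r \<le> Inf A" using low by (intro cInf_greatest) auto
    then show ?thesis using r(1) unfolding succ_min_def A_def[symmetric] by linarith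
  qed
qed

text \<open>Induction on \<open>card J\<close> by removing a longest vector \<open>b q\<close>: the
  vectors of \<open>J\<close> are independent and none is longer, so the minimum with index
  \<open>card J\<close> is at most the norm of \<open>b q\<close>.\<close>

lemma prod_succ_min_le:
  assumes b: "lattice_basis n b \<Lambda>" and J: "J \<subseteq> {..<n}"
  shows "(\<Prod>i = 1..card J. succ_min n \<Lambda> i) \<le> (\<Prod>k\<in>J. enorm n (b k))"
  using J
proof (induction "card J" arbitrary: J)
  case 0
  then have "J = {}" using finite_subset[OF 0(2)] by auto
  then show ?case by simp
next
  case (Suc j)
  have fin: "finite J" using finite_subset[OF Suc.prems] by simp
  have "J \<noteq> {}" using Suc.hyps(2) by auto
  define R where "R = Max ((\<lambda>k. enorm n (b k)) ` J)"
  have "R \<in> (\<lambda>k. enorm n (b k)) ` J" unfolding R_def using fin \<open>J \<noteq> {}\<close> by (intro Max_in) auto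
  then obtain q where q: "q \<in> J" "R = enorm n (b q)" by blast
  have max: "enorm n (b k) \<le> R" if "k \<in> J" for k unfolding R_def using fin that by (intro Max_ge) auto
  obtain f where f: "bij_betw f {..<card J} J" using ex_bij_betw_nat_finite[OF fin] by (auto simp: atLeast0LessThan)
  have fJ: "f k \<in> J" if "k < card J" for k using f that by (auto simp: bij_betw_def)
  have ind: "lin_indep n (card J) (\<lambda>k. b (f k))"
  proof (rule lin_indep_reindex[of n n])
    show "lin_indep n n b" using b by (simp add: lattice_basis_def)
    show "inj_on f {..<card J}" "f ` {..<card J} \<subseteq> {..<n}" using f Suc.prems by (auto simp: bij_betw_def)
  qed
  have le: "succ_min n \<Lambda> (card J) \<le> R"
  proof (rule succ_min_le[OF b _ ind])
    fix k assume "k < card J"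
    then have "f k \<in> J" "f k < n" using fJ Suc.prems by auto
    then show "b (f k) \<in> \<Lambda> \<and> b (f k) \<in> Rn n \<and> enorm n (b (f k)) \<le> R"
      using lattice_basis_mem[OF b] max by blast
  qed (use Suc.hyps(2) in simp)
  have cJ: "card J = Suc j" "card (J - {q}) = j" using Suc.hyps(2) q fin by auto
  have "card J \<le> n" using card_mono[OF _ Suc.prems] by simp
  then have pos: "succ_min n \<Lambda> i \<ge> 0" if "1 \<le> i" "i \<le> card J" for i
    using succ_min_pos[OF b that(1)] that by simp
  have "(\<Prod>i = 1..card J. succ_min n \<Lambda> i) = (\<Prod>i = 1..j. succ_min n \<Lambda> i) * succ_min n \<Lambda> (card J)"
    unfolding cJ by simp
  also have "\<dots> \<le> (\<Prod>k\<in>J - {q}. enorm n (b k)) * R"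
    using Suc.hyps(1)[of "J - {q}"] Suc.prems cJ le pos
    by (intro mult_mono prod_nonneg) auto
  also have "\<dots> = (\<Prod>k\<in>J. enorm n (b k))"
    using q fin by (subst prod.remove[of J q]) (auto simp: mult.commute)
  finally show ?case .
qed

section \<open>Fibres of a definable family\<close>

context o_minimal_semialgebraic
begin

text \<open>A block of \<open>n\<close> quantifiers in the de Bruijn convention: entries below
  \<open>n\<close> are the bound vector, and outer variables are shifted by
  \<open>n\<close>.\<close>

lemma definable_ex_vector:
  assumes "definable (\<lambda>x. Q (\<lambda>i. x (n + i)) x)"
    and "\<And>x z z'. (\<And>i. i < n \<Longrightarrow> z i = z' i) \<Longrightarrow> Q x z = Q x z'"
  shows "definable (\<lambda>x. \<exists>z :: nat \<Rightarrow> real. Q x z)"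
  using assms
proof (induction n arbitrary: Q)
  case 0
  have "(\<exists>z. Q x z) = Q x x" for x using 0(2)[where z' = x] by auto
  then show ?case using 0(1) by simp
next
  case (Suc n)
  define Q' where "Q' x z \<longleftrightarrow> (\<exists>t. Q x (z(n := t)))" for x z
  have "definable (\<lambda>x. \<exists>z. Q' x z)"
  proof (rule Suc.IH)
    \<comment> \<open>The innermost quantifier places its variable at entry 0 and shifts the rest;
      \<open>?f\<close> moves it to position \<open>n\<close>, where it extends the vector.\<close>
    let ?f = "\<lambda>i x. if i < n then x (Suc i) else if i = n then x 0 else x i"
    have poly: "polynomial (?f i)" for i by (intro def_intros)
    have "definable (\<lambda>x. Q (\<lambda>i. x (Suc n + i)) (\<lambda>i. ?f i x))"
      using definable_subst[OF Suc.prems(1), of ?f, OF poly] by simp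
    moreover have "Q (\<lambda>i. x (Suc n + i)) (\<lambda>i. ?f i x) =
        Q (\<lambda>i. x (Suc (n + i))) ((\<lambda>i. x (Suc i))(n := x 0))" for x
      unfolding add_Suc by (rule Suc.prems(2)) auto
    ultimately show "definable (\<lambda>x. Q' (\<lambda>i. x (n + i)) x)"
      unfolding Q'_def by (intro definable_ex) simp
    fix x z z' :: "nat \<Rightarrow> real" assume "\<And>i. i < n \<Longrightarrow> z i = z' i"
    then have "Q x (z(n := t)) = Q x (z'(n := t))" for t by (intro Suc.prems(2)) auto
    then show "Q' x z = Q' x z'" unfolding Q'_def by simp
  qed
  moreover have "(\<exists>z. Q' x z) = (\<exists>z. Q x z)" for x
    unfolding Q'_def by (metis fun_upd_triv)
  ultimately show ?case by simp
qed

lemma definable_mem: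
  assumes "Z \<in> S k" "k \<ge> 1"
  shows "definable (\<lambda>x. restrict x {..<k} \<in> Z)"
proof -
  have "restrict x {..<k} = x" if "x \<in> Rn k" for x
    using that by (auto simp: Rn_def PiE_def extensional_def restrict_def)
  then have "{x \<in> Rn k. restrict x {..<k} \<in> Z} = Z" using subset_Rn[OF assms(2,1)] by auto
  moreover have "depends_below k (\<lambda>x. restrict x {..<k} \<in> Z)"
    unfolding depends_below_def by (metis lessThan_iff restrict_ext)
  ultimately have "defN k (\<lambda>x. restrict x {..<k} \<in> Z)" using assms by (simp add: defN_def)
  then show ?thesis unfolding definable_def by blast
qed

section \<open>Linear images of fibres: measurability and uniform slices\<close>

context
  fixes m n :: nat and Z :: "(nat \<Rightarrow> real) set"
  assumes Z: "Z \<in> S (m + n)" and m: "m \<ge> 1"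
begin

lemma append_pt_cong:
  "(\<And>i. i < m \<Longrightarrow> T i = T' i) \<Longrightarrow> (\<And>i. i < n \<Longrightarrow> x i = x' i) \<Longrightarrow> append_pt m n T x = append_pt m n T' x'"
  unfolding append_pt_def by (intro restrict_ext) auto

lemma definable_append_pt:
  assumes "\<And>i. polynomial (f i)" "\<And>i. polynomial (g i)"
  shows "definable (\<lambda>x. append_pt m n (\<lambda>i. f i x) (\<lambda>i. g i x) \<in> Z)"
proof -
  have poly: "polynomial (\<lambda>x. if i < m then f i x else g (i - m) x)" for i
    by (intro def_intros assms)
  have "definable (\<lambda>x. restrict (\<lambda>i. if i < m then f i x else g (i - m) x) {..<m + n} \<in> Z)"
    using definable_subst[OF definable_mem[OF Z] poly] m by simp
  then show ?thesis by (simp add: append_pt_def)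
qed

text \<open>Parameters of the family: the entries of \<open>T\<close>, then the \<open>n \<times> n\<close> matrix \<open>p\<close> row by row, then
  the values \<open>w\<close> prescribed for the linear forms with index in \<open>I\<close>.\<close>

definition slice :: "nat set \<Rightarrow> nat \<Rightarrow> (nat \<Rightarrow> real) \<Rightarrow> real \<Rightarrow> bool" where
  "slice I i s t \<longleftrightarrow> (\<exists>z. append_pt m n s z \<in> Z \<and>
     (\<forall>k\<in>I. (\<Sum>l<n. s (m + (k * n + l)) * z l) = s (m + n * n + k)) \<and>
     (\<Sum>l<n. s (m + (i * n + l)) * z l) = t)"

lemma definable_slice:
  assumes "finite I"
  shows "definable_family (slice I i)"
  unfolding slice_def definable_family_def
proof (rule definable_ex_vector)
  show "definable (\<lambda>x. append_pt m n (\<lambda>i. x (n + Suc i)) x \<in> Z \<and>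
     (\<forall>k\<in>I. (\<Sum>l<n. x (n + Suc (m + (k * n + l))) * x l) = x (n + Suc (m + n * n + k))) \<and>
     (\<Sum>l<n. x (n + Suc (m + (i * n + l))) * x l) = x (n + 0))"
    using assms by (intro def_intros definable_append_pt)
  fix x z z' :: "nat \<Rightarrow> real" assume z: "\<And>i. i < n \<Longrightarrow> z i = z' i"
  show "(append_pt m n (\<lambda>i. x (Suc i)) z \<in> Z \<and>
     (\<forall>k\<in>I. (\<Sum>l<n. x (Suc (m + (k * n + l))) * z l) = x (Suc (m + n * n + k))) \<and>
     (\<Sum>l<n. x (Suc (m + (i * n + l))) * z l) = x 0) =
     (append_pt m n (\<lambda>i. x (Suc i)) z' \<in> Z \<and>
     (\<forall>k\<in>I. (\<Sum>l<n. x (Suc (m + (k * n + l))) * z' l) = x (Suc (m + n * n + k))) \<and>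
     (\<Sum>l<n. x (Suc (m + (i * n + l))) * z' l) = x 0)"
    using z append_pt_cong[of "\<lambda>i. x (Suc i)" "\<lambda>i. x (Suc i)" z z'] by simp
qed

lemma fibre_restrict:
  assumes "append_pt m n T z \<in> Z"
  shows "restrict z {..<n} \<in> fiber m n Z T"
proof -
  have "append_pt m n T (restrict z {..<n}) = append_pt m n T z"
    by (rule append_pt_cong) auto
  then show ?thesis using assms by (simp add: fiber_def restrict_mem_Rn)
qed

lemma image_fiber_eq:
  assumes "\<And>z. P (restrict z {..<n}) = P z" "\<And>z. g (restrict z {..<n}) = g z"
  shows "g ` {z \<in> fiber m n Z T. P z} = {t. \<exists>z. append_pt m n T z \<in> Z \<and> P z \<and> g z = t}"
proof (intro equalityI subsetI)
  fix t assume "t \<in> {t. \<exists>z. append_pt m n T z \<in> Z \<and> P z \<and> g z = t}"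
  then obtain z where "append_pt m n T z \<in> Z" "P z" "g z = t" by blast
  then have "restrict z {..<n} \<in> {z \<in> fiber m n Z T. P z}" "t = g (restrict z {..<n})"
    using fibre_restrict assms by auto
  then show "t \<in> g ` {z \<in> fiber m n Z T. P z}" by blast
qed (auto simp: fiber_def)

lemma linear_image_fiber_measurable:
  assumes I: "I \<subseteq> {..<n}"
  shows "linear_image n (fiber m n Z T) I p \<in> sets (Pi\<^sub>M I (\<lambda>_. borel))"
proof -
  have finI: "finite I" using I finite_subset by blast
  define Q where "Q w \<longleftrightarrow> (\<exists>z. append_pt m n T z \<in> Z \<and> (\<forall>k\<in>I. (\<Sum>l<n. p k l * z l) = w k))" for w
  have "definable Q" unfolding Q_def
  proof (rule definable_ex_vector)
    show "definable (\<lambda>x. append_pt m n T x \<in> Z \<and> (\<forall>k\<in>I. (\<Sum>l<n. p k l * x l) = x (n + k)))"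
      using finI by (intro def_intros definable_append_pt)
    fix x z z' :: "nat \<Rightarrow> real" assume z: "\<And>i. i < n \<Longrightarrow> z i = z' i"
    show "(append_pt m n T z \<in> Z \<and> (\<forall>k\<in>I. (\<Sum>l<n. p k l * z l) = x k)) =
        (append_pt m n T z' \<in> Z \<and> (\<forall>k\<in>I. (\<Sum>l<n. p k l * z' l) = x k))"
      using z append_pt_cong[of T T z z'] by simp
  qed
  then have Q: "Measurable.pred \<Omega> Q" by (rule definable_borel)
  \<comment> \<open>Points with index set \<open>I\<close> are extended by 0 to full sequences,
    along which the Borel predicate \<open>Q\<close> is pulled back.\<close>
  have "(\<lambda>w i. if i \<in> I then w i else 0) \<in> measurable (Pi\<^sub>M I (\<lambda>_. borel)) \<Omega>"
  proof (rule measurable_PiM_single')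
    fix i show "(\<lambda>w. if i \<in> I then w i else 0) \<in> measurable (Pi\<^sub>M I (\<lambda>_. borel)) (borel :: real measure)"
      by (cases "i \<in> I") (auto intro: measurable_component_singleton)
  qed (auto simp: space_PiM)
  from measurable_compose[OF this Q]
  have "{w \<in> space (Pi\<^sub>M I (\<lambda>_. borel)). Q (\<lambda>i. if i \<in> I then w i else 0)} \<in> sets (Pi\<^sub>M I (\<lambda>_. borel))"
    by (simp add: pred_def)
  also have "{w \<in> space (Pi\<^sub>M I (\<lambda>_. borel)). Q (\<lambda>i. if i \<in> I then w i else 0)} =
      linear_image n (fiber m n Z T) I p"
  proof -
    let ?g = "\<lambda>z. \<lambda>k\<in>I. \<Sum>l<n. p k l * z l"
    have "?g ` {z \<in> fiber m n Z T. True} = {t. \<exists>z. append_pt m n T z \<in> Z \<and> True \<and> ?g z = t}"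
      by (rule image_fiber_eq) (auto intro: restrict_ext)
    then have "w \<in> linear_image n (fiber m n Z T) I p \<longleftrightarrow>
        (\<exists>z. append_pt m n T z \<in> Z \<and> ?g z = w)" for w
      unfolding linear_image_def by simp
    moreover have "(\<lambda>k\<in>I. f k) = w \<longleftrightarrow> w \<in> space (Pi\<^sub>M I (\<lambda>_. borel)) \<and> (\<forall>k\<in>I. f k = w k)"
      for f w :: "nat \<Rightarrow> real"
      by (auto simp: space_PiM PiE_def extensional_def restrict_def fun_eq_iff)
    moreover have "(\<forall>k\<in>I. f k = (if k \<in> I then w k else 0)) = (\<forall>k\<in>I. f k = w k)"
      for f w :: "nat \<Rightarrow> real" by simp
    ultimately show ?thesis unfolding Q_def set_eq_iff mem_Collect_eq by simp blast
  qed
  finally show ?thesis .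
qed

text \<open>\<open>T\<close>, \<open>p\<close> and \<open>w\<close> are packed into one parameter
  sequence \<open>s\<close>, so for each pair \<open>(I, i)\<close> a single bound covers them all;
  the maximum over the finitely many pairs is \<open>h\<close>.\<close>

lemma uniform_slices:
  "\<exists>h. \<forall>T I i p w. insert i I \<subseteq> {..<n} \<longrightarrow> i \<notin> I \<longrightarrow> w \<in> extensional I \<longrightarrow>
     interval_union h {t. w(i := t) \<in> linear_image n (fiber m n Z T) (insert i I) p}"
proof -
  have "\<exists>h. \<forall>s. interval_union h {t. slice I i s t}" if "I \<subseteq> {..<n}" for I i
    using that by (intro uniform_interval_union definable_slice) (auto intro: finite_subset)
  then obtain H where H: "\<And>I i s. I \<subseteq> {..<n} \<Longrightarrow> interval_union (H I i) {t. slice I i s t}"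
    by metis
  define h where "h = Max (case_prod H ` (Pow {..<n} \<times> {..<n}))"
  have Hh: "H I i \<le> h" if "I \<subseteq> {..<n}" "i < n" for I i
    unfolding h_def using that by (intro Max_ge) auto
  have "interval_union h {t. w(i := t) \<in> linear_image n (fiber m n Z T) (insert i I) p}"
    if I: "insert i I \<subseteq> {..<n}" "i \<notin> I" "w \<in> extensional I" for T I i p w
  proof -
    define s where "s j = (if j < m then T j else if j < m + n * n then p ((j - m) div n) ((j - m) mod n)
      else w (j - m - n * n))" for j
    have s1: "append_pt m n s z = append_pt m n T z" for z
      by (rule append_pt_cong) (auto simp: s_def)
    have s2: "s (m + (k * n + l)) = p k l" if "k < n" "l < n" for k l
    proof -
      have "k * n + l < Suc k * n" using that by simp
      also have "\<dots> \<le> n * n" using that by (intro mult_right_mono) auto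
      finally show ?thesis using that by (simp add: s_def)
    qed
    have s3: "s (m + n * n + k) = w k" for k by (simp add: s_def)
    have "{t. w(i := t) \<in> linear_image n (fiber m n Z T) (insert i I) p} =
        {t. \<exists>z. append_pt m n T z \<in> Z \<and> w = (\<lambda>k\<in>I. \<Sum>l<n. p k l * z l) \<and> (\<Sum>l<n. p i l * z l) = t}"
      unfolding fibre_linear_image[OF I(3,2)] by (rule image_fiber_eq) auto
    also have "\<dots> = {t. slice I i s t}"
    proof -
      have "w = (\<lambda>k\<in>I. f k) \<longleftrightarrow> (\<forall>k\<in>I. f k = w k)" for f
        using I(3) by (auto simp: extensional_def restrict_def fun_eq_iff)
      moreover have "(\<Sum>l<n. s (m + (k * n + l)) * z l) = (\<Sum>l<n. p k l * z l)" if "k < n" for k z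
        using that by (intro sum.cong) (auto simp: s2)
      moreover have "k < n" if "k \<in> insert i I" for k using I(1) that by auto
      ultimately show ?thesis unfolding slice_def s1 s3 by (simp cong: ball_cong)
    qed
    finally show ?thesis using interval_union_mono[OF H[of I i s] Hh[of I i]] I by simp
  qed
  then show ?thesis by blast
qed

end

end

text \<open>Each integer point has mass 1 as a product of one-point sets, and the points with a
  non-integral coordinate lie in finitely many null sets.\<close>

lemma emeasure_int_points:
  assumes Y: "Y \<in> sets (Pi\<^sub>M {..<n} (\<lambda>_. borel))" and bdd: "\<And>y i. y \<in> Y \<Longrightarrow> i < n \<Longrightarrow> \<bar>y i\<bar> \<le> R"
  shows "finite {y\<in>Y. \<forall>i<n. y i \<in> \<int>}"
    and "emeasure (Pi\<^sub>M {..<n} (mixed {..<n})) Y = of_nat (card {y\<in>Y. \<forall>i<n. y i \<in> \<int>})"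
proof -
  let ?M = "Pi\<^sub>M {..<n} (mixed {..<n})" and ?D = "{y\<in>Y. \<forall>i<n. y i \<in> \<int>}"
  have ext: "y \<in> extensional {..<n}" if "y \<in> Y" for y
    using sets.sets_into_space[OF Y] that by (auto simp: space_PiM PiE_def)
  have Y': "Y \<in> sets ?M" using Y by (simp add: sets_PiM_mixed)
  have "?D \<subseteq> {..<n} \<rightarrow>\<^sub>E (real_of_int ` {\<lfloor>-R\<rfloor>..\<lceil>R\<rceil>})"
  proof
    fix y assume y: "y \<in> ?D"
    have "y i \<in> real_of_int ` {\<lfloor>-R\<rfloor>..\<lceil>R\<rceil>}" if i: "i < n" for i
    proof -
      obtain z where z: "y i = real_of_int z" using y i by (auto elim: Ints_cases)
      have "\<bar>real_of_int z\<bar> \<le> R" using bdd[of y i] y i by (simp add: z)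
      then have "z \<in> {\<lfloor>-R\<rfloor>..\<lceil>R\<rceil>}" by (simp add: floor_le_iff le_ceiling_iff) linarith
      then show ?thesis using z by blast
    qed
    then show "y \<in> {..<n} \<rightarrow>\<^sub>E (real_of_int ` {\<lfloor>-R\<rfloor>..\<lceil>R\<rceil>})" using ext[of y] y by (simp add: PiE_iff)
  qed
  then show fin: "finite ?D" by (rule finite_subset) (auto intro!: finite_PiE)
  have box: "{y} = Pi\<^sub>E {..<n} (\<lambda>i. {y i})" if "y \<in> Y" for y
    using PiE_singleton[OF ext[OF that]] by simp
  have point: "emeasure ?M {y} = 1" "{y} \<in> sets ?M" if y: "y \<in> ?D" for y
  proof -
    have "emeasure (mixed {..<n} i) {y i} = 1" if i: "i < n" for i
    proof -
      obtain z where z: "y i = real_of_int z" using y i by (auto elim: Ints_cases)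
      have "{z'. real_of_int z' \<in> {y i}} = {z}" using z by auto
      then show ?thesis using i by (simp add: mixed_def emeasure_int_measure)
    qed
    moreover have "emeasure ?M (Pi\<^sub>E {..<n} (\<lambda>i. {y i})) = (\<Prod>i<n. emeasure (mixed {..<n} i) {y i})"
      by (intro mixed.emeasure_PiM) auto
    ultimately show "emeasure ?M {y} = 1" using box[of y] y by simp
    have "Pi\<^sub>E {..<n} (\<lambda>i. {y i}) \<in> sets ?M" by (intro sets_PiM_I_finite) auto
    then show "{y} \<in> sets ?M" using box[of y] y by simp
  qed
  have null: "emeasure ?M {y\<in>space ?M. y i \<notin> \<int>} = 0" if i: "i < n" for i
  proof -
    have Z: "(-\<int> :: real set) \<in> sets borel" by simp
    have "emeasure int_measure (-\<int>) = 0" by (subst emeasure_int_measure) auto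
    then have "emeasure (mixed {..<n} i) (-\<int>) = 0" using i by (simp add: mixed_def)
    moreover have "{y\<in>space ?M. y i \<notin> \<int>} = Pi\<^sub>E {..<n} (\<lambda>j. if j = i then -\<int> else UNIV)"
    proof (rule Set.set_eqI)
      fix y :: "nat \<Rightarrow> real"
      have "(\<forall>j\<in>{..<n}. y j \<in> (if j = i then -\<int> else UNIV)) \<longleftrightarrow> y i \<notin> \<int>" using i by auto
      then show "y \<in> {y\<in>space ?M. y i \<notin> \<int>} \<longleftrightarrow> y \<in> Pi\<^sub>E {..<n} (\<lambda>j. if j = i then -\<int> else UNIV)"
        by (auto simp: space_PiM PiE_iff)
    qed
    ultimately show ?thesis using i
      by (simp, subst mixed.emeasure_PiM) (auto intro!: prod_zero bexI[of _ i])
  qed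
  have setsN: "{y\<in>space ?M. y i \<notin> \<int>} \<in> sets ?M" if "i < n" for i
  proof -
    have "(\<lambda>y. y i) \<in> measurable ?M borel"
      using measurable_component_singleton[of i "{..<n}" "mixed {..<n}"] that
      by (simp add: measurable_cong_sets[OF refl sets_mixed])
    then have "(\<lambda>y. y i) -` (-\<int>) \<inter> space ?M \<in> sets ?M" by (rule measurable_sets) simp
    then show ?thesis by (simp add: vimage_def Int_def conj_commute)
  qed
  have D: "?D \<in> sets ?M" "emeasure ?M ?D = of_nat (card ?D)"
  proof -
    have "emeasure ?M ?D = (\<Sum>y\<in>?D. emeasure ?M {y})"
      by (intro emeasure_eq_sum_singleton fin point)
    then show "emeasure ?M ?D = of_nat (card ?D)" using point by simp
    have "(\<Union>y\<in>?D. {y}) \<in> sets ?M" by (intro sets.finite_UN fin point)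
    then show "?D \<in> sets ?M" by (simp only: UN_singleton)
  qed
  have U: "(\<Union>i<n. {y\<in>space ?M. y i \<notin> \<int>}) \<in> null_sets ?M"
    using null setsN by (intro null_sets_UN') (auto simp: null_sets_def)
  have "emeasure ?M Y = emeasure ?M ?D"
  proof (rule antisym)
    have "emeasure ?M Y \<le> emeasure ?M (?D \<union> (\<Union>i<n. {y\<in>space ?M. y i \<notin> \<int>}))"
    proof (rule emeasure_mono)
      show "Y \<subseteq> ?D \<union> (\<Union>i<n. {y\<in>space ?M. y i \<notin> \<int>})"
        using sets.sets_into_space[OF Y'] by blast
      show "?D \<union> (\<Union>i<n. {y\<in>space ?M. y i \<notin> \<int>}) \<in> sets ?M"
        by (intro sets.Un D(1) null_setsD2[OF U])
    qed
    also have "\<dots> \<le> emeasure ?M ?D + emeasure ?M (\<Union>i<n. {y\<in>space ?M. y i \<notin> \<int>})"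
      by (rule emeasure_subadditive[OF D(1) null_setsD2[OF U]])
    finally show "emeasure ?M Y \<le> emeasure ?M ?D" by (simp only: null_setsD1[OF U] add_0_right)
    show "emeasure ?M ?D \<le> emeasure ?M Y" by (rule emeasure_mono[OF _ Y']) blast
  qed
  then show "emeasure ?M Y = of_nat (card ?D)" using D(2) by (rule trans)
qed

section \<open>The counting estimate\<close>

lemma fdet_lattice_basis:
  assumes b: "lattice_basis n b \<Lambda>"
  shows "\<bar>fdet n (\<lambda>i l. b l i)\<bar> = lattice_det n \<Lambda>" "fdet n (\<lambda>i l. b l i) \<noteq> 0"
proof -
  let ?A = "Matrix.mat n n (\<lambda>(i, l). b l i)"
  have A: "?A = transpose_mat (Matrix.mat n n (\<lambda>(i, l). b i l))" by (rule eq_matI) auto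
  show "\<bar>fdet n (\<lambda>i l. b l i)\<bar> = lattice_det n \<Lambda>"
    unfolding lattice_det_eq[OF b] basis_det_def fdet_def A by (simp add: det_transpose[of _ n])
  show "fdet n (\<lambda>i l. b l i) \<noteq> 0"
  proof
    assume "fdet n (\<lambda>i l. b l i) = 0"
    then obtain v where v: "v \<in> carrier_vec n" "v \<noteq> 0\<^sub>v n" "?A *\<^sub>v v = 0\<^sub>v n"
      unfolding fdet_def by (subst (asm) det_0_iff_vec_prod_zero[of _ n]) auto
    have "(\<Sum>i<n. vec_index v i * b i l) = 0" if "l < n" for l
    proof -
      have "vec_index (?A *\<^sub>v v) l = 0" using v(3) that by simp
      then show ?thesis using v(1) that by (simp add: scalar_prod_def atLeast0LessThan mult.commute)
    qed
    then have "\<forall>i<n. vec_index v i = 0" using b unfolding lattice_basis_def lin_indep_def by blast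
    then have "v = 0\<^sub>v n" using v(1) by (intro eq_vecI) auto
    then show False using v(2) by simp
  qed
qed

lemma abs_diff_le_of_ennreal:
  assumes "ennreal a \<le> ennreal b + ennreal e" "ennreal b \<le> ennreal a + ennreal e"
    and "a \<ge> 0" "b \<ge> 0" "e \<ge> 0"
  shows "\<bar>a - b\<bar> \<le> e"
  using assms by (simp add: abs_le_iff flip: ennreal_plus)

context sliced_set
begin

lemma emeasure_linear_image_finite:
  assumes "I \<subseteq> {..<n}"
  shows "leb_vol I p < \<infinity>"
proof -
  interpret L: product_sigma_finite "\<lambda>_::nat. lborel :: real measure" by standard
  have fin: "finite I" using assms finite_subset by blast
  obtain R where R: "\<And>z l. z \<in> Z \<Longrightarrow> l < n \<Longrightarrow> \<bar>z l\<bar> \<le> R" using bdd by blast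
  define r where "r k = (\<Sum>l<n. \<bar>p k l\<bar> * R)" for k
  have "\<bar>\<Sum>l<n. p k l * z l\<bar> \<le> r k" if "z \<in> Z" for z k
    unfolding r_def
    by (rule order_trans[OF sum_abs], intro sum_mono) (auto simp: abs_mult intro!: mult_left_mono R that)
  then have "X I p \<subseteq> Pi\<^sub>E I (\<lambda>k. {- r k..r k})"
    unfolding linear_image_def by (auto simp: abs_le_iff minus_le_iff)
  then have "leb_vol I p \<le> emeasure (Leb I) (Pi\<^sub>E I (\<lambda>k. {- r k..r k}))"
    unfolding mixed_vol_def mixed_empty using fin by (intro emeasure_mono sets_PiM_I_finite) auto
  also have "\<dots> = (\<Prod>k\<in>I. emeasure lborel {- r k..r k})"
    using fin by (intro L.emeasure_PiM) auto
  also have "\<dots> < \<infinity>" by (simp add: ennreal_prod_eq_top less_top[symmetric] emeasure_lborel_Icc_eq)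
  finally show ?thesis .
qed

lemma measure_linear_image:
  assumes "I \<subseteq> {..<n}"
  shows "leb_vol I p = ennreal (measure (lebesgue_on_coords I) (X I p))"
proof -
  have "X I p \<in> sets (Leb I)"
    using meas_mixed[OF assms, of p "{}"] by (simp add: mixed_empty)
  then have "measure (lebesgue_on_coords I) (X I p) = measure (Leb I) (X I p)"
    unfolding lebesgue_on_coords_def by (rule measure_completion)
  then show ?thesis using emeasure_linear_image_finite[OF assms, of p]
    unfolding mixed_vol_def mixed_empty by (simp add: emeasure_eq_ennreal_measure)
qed

lemma restrict_image: "I \<subseteq> {..<n} \<Longrightarrow> (\<lambda>x. restrict x I) ` Z = X I unit_row"
  using linear_image_unit_rows[of I "\<lambda>k. k"] by auto

lemma coord_vol_le: "coord_vol j \<le> ennreal (proj_vol n j Z)"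
proof -
  have "coord_vol j = (\<Sum>I | I \<subseteq> {..<n} \<and> card I = j.
      ennreal (measure (lebesgue_on_coords I) ((\<lambda>x. restrict x I) ` Z)))"
    unfolding coord_vol_def
    by (intro sum.cong refl)
      (use measure_linear_image restrict_image in \<open>auto simp: mixed_vol_def mixed_empty\<close>)
  also have "\<dots> \<le> ennreal (proj_vol n j Z)"
  proof (cases "j = 0")
    case True
    have "{I. I \<subseteq> {..<n} \<and> card I = 0} = {{}}" by (auto dest: finite_subset)
    \<comment> \<open>The empty product is a single point of mass 1, whence the value 1 prescribed
      for \<open>j = 0\<close> is an upper bound.\<close>
    moreover have "measure (lebesgue_on_coords {}) A \<le> 1" for A
    proof -
      have "emeasure (lebesgue_on_coords {}) (space (lebesgue_on_coords {})) = 1"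
        by (simp add: lebesgue_on_coords_def space_PiM sets_PiM_empty)
      then interpret fm: finite_measure "lebesgue_on_coords {}"
        by (intro finite_measureI) simp
      have "measure (lebesgue_on_coords {}) A \<le> measure (lebesgue_on_coords {}) (space (lebesgue_on_coords {}))"
        by (rule fm.bounded_measure)
      then show ?thesis
        using \<open>emeasure (lebesgue_on_coords {}) (space (lebesgue_on_coords {})) = 1\<close>
        by (simp add: measure_def)
    qed
    ultimately show ?thesis using True by (simp add: proj_vol_def)
  qed (simp add: proj_vol_def sum_ennreal)
  finally show ?thesis .
qed

text \<open>In the constant, \<open>n\<close> is the number of exchanged coordinates,
  \<open>h * (1 + h) ^ n\<close> the cost of one exchange, and \<open>2 ^ n\<close> bounds the
  number of projections. The last power bounds the factors \<open>h ^ n * n * c\<close> from the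
  replaced rows; the maxima with 1 allow the exponent \<open>card J\<close> to be raised to
  \<open>n\<close>.\<close>

lemma count_estimate:
  assumes Z: "Z \<subseteq> Rn n" and b: "lattice_basis n b \<Lambda>" and c: "c \<ge> 0"
    and reduced: "\<And>y i. i < n \<Longrightarrow> \<bar>y i\<bar> * enorm n (b i) \<le> c * enorm n (comb n b y)"
  shows "\<bar>real (card (Z \<inter> \<Lambda>)) - vol n Z / lattice_det n \<Lambda>\<bar> \<le>
    real n * real (h * (1 + h) ^ n) * 2 ^ n * (max 1 (real (h ^ n * n)) * max 1 c) ^ n *
    (\<Sum>j<n. proj_vol n j Z / (\<Prod>i = 1..j. succ_min n \<Lambda> i))"
proof -
  let ?B = "\<lambda>i l. b l i"
  define g where "g j = proj_vol n j Z / (\<Prod>i = 1..j. succ_min n \<Lambda> i)" for j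
  define D where "D = (max 1 (real (h ^ n * n)) * max 1 c) ^ n"
  have pv: "proj_vol n j Z \<ge> 0" for j by (simp add: proj_vol_def sum_nonneg)
  have sm: "(\<Prod>i = 1..j. succ_min n \<Lambda> i) > 0" if "j \<le> n" for j
    by (rule prod_pos) (use that succ_min_pos[OF b] in auto)
  have g: "g j \<ge> 0" if "j \<le> n" for j
    unfolding g_def using pv[of j] sm[OF that] by simp
  have D: "D \<ge> 0" by (simp add: D_def)
  have bpos: "enorm n (b k) > 0" if "k < n" for k
    using b that unfolding lattice_basis_def by (blast intro: lin_indep_nonzero)
  obtain p where p: "\<And>i l. i < n \<Longrightarrow> l < n \<Longrightarrow> (\<Sum>m<n. ?B i m * p m l) = (if i = l then 1 else 0)"
    "\<And>i l. i < n \<Longrightarrow> l < n \<Longrightarrow> (\<Sum>m<n. p i m * ?B m l) = (if i = l then 1 else 0)"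
    using fdet_inverse[OF fdet_lattice_basis(2)[OF b]] by blast
  have id: "lmap n (\<lambda>i l. if i = l then 1 else 0) x = x" if "x \<in> Rn n" for x
  proof
    fix i
    have "(\<Sum>l<n. (if i = l then 1 else 0) * x l) = (\<Sum>l<n. if l = i then x l else 0)"
      by (intro sum.cong) auto
    then show "lmap n (\<lambda>i l. if i = l then 1 else 0) x i = x i"
      using that by (auto simp: lmap_def Rn_def PiE_def extensional_def)
  qed
  have Bp: "lmap n ?B (lmap n p x) = x" and pB: "lmap n p (lmap n ?B x) = x" if "x \<in> Rn n" for x
    using lmap_mult[of n "\<lambda>i l. if i = l then 1 else 0" ?B p x] lmap_mult[of n "\<lambda>i l. if i = l then 1 else 0" p ?B x]
      p id[OF that] by simp_all
  have lm: "lmap n q x \<in> Rn n" for q x by (simp add: lmap_def Rn_def)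
  define Y where "Y = X {..<n} p"
  have Y: "Y = lmap n p ` Z" by (simp add: Y_def linear_image_def lmap_def[abs_def])
  have p_bound: "\<bar>p k l\<bar> \<le> c / enorm n (b k)" if kl: "k < n" "l < n" for k l
  proof -
    \<comment> \<open>Column \<open>l\<close> of \<open>p\<close> holds the coefficients of the unit
      vector with index \<open>l\<close> in the basis \<open>b\<close>, a vector of norm 1, to which
      reducedness applies.\<close>
    have "comb n b (\<lambda>m. p m l) i = unit_row l i" if "i < n" for i
      using p(1)[OF that kl(2)] by (simp add: comb_def unit_row_def mult.commute)
    then have "enorm n (comb n b (\<lambda>m. p m l)) = enorm n (unit_row l)" by (rule enorm_cong)
    also have "(enorm n (unit_row l))\<^sup>2 = 1"
      unfolding enorm_sq ip_def using sum_unit_row[OF kl(2), of "unit_row l"] by (simp add: unit_row_def)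
    then have "enorm n (unit_row l) = 1" using enorm_nonneg[of n "unit_row l"] by (simp add: power2_eq_1_iff)
    finally show ?thesis using reduced[OF kl(1), of "\<lambda>m. p m l"] bpos[OF kl(1)] by (simp add: field_simps)
  qed
  have leb_vol_bound: "leb_vol J p \<le> ennreal (D * g (card J))" if J: "J \<subseteq> {..<n}" for J
  proof -
    have cJ: "card J \<le> n" using card_mono[OF _ J] by simp
    have bJ: "(\<Prod>k\<in>J. enorm n (b k)) > 0" using bpos J by (intro prod_pos) auto
    have "leb_vol J p \<le> of_nat ((h ^ n * n) ^ card J) * ennreal (\<Prod>k\<in>J. c / enorm n (b k)) * coord_vol (card J)"
      using p_bound bpos c J by (intro leb_vol_le_coord_vol) (auto simp: subset_iff)
    also have "\<dots> \<le> ennreal (real ((h ^ n * n) ^ card J)) * ennreal (\<Prod>k\<in>J. c / enorm n (b k)) *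
        ennreal (proj_vol n (card J) Z)"
      using coord_vol_le by (intro mult_mono) (auto simp: ennreal_of_nat_eq_real_of_nat)
    also have "\<dots> = ennreal (real ((h ^ n * n) ^ card J) * (\<Prod>k\<in>J. c / enorm n (b k)) * proj_vol n (card J) Z)"
      using c pv by (simp add: ennreal_mult prod_nonneg)
    also have "\<dots> \<le> ennreal (D * g (card J))"
    proof (rule ennreal_leI)
      have "real ((h ^ n * n) ^ card J) * (\<Prod>k\<in>J. c / enorm n (b k)) =
          (real (h ^ n * n) * c) ^ card J / (\<Prod>k\<in>J. enorm n (b k))"
        by (simp add: prod_dividef power_mult_distrib)
      also have "\<dots> \<le> D / (\<Prod>i = 1..card J. succ_min n \<Lambda> i)"
      proof (rule frac_le)
        have "(real (h ^ n * n) * c) ^ card J \<le> (max 1 (real (h ^ n * n)) * max 1 c) ^ card J"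
          using c by (intro power_mono mult_mono) auto
        also have "\<dots> \<le> D" unfolding D_def
          using cJ mult_mono[of 1 "max 1 (real (h ^ n * n))" 1 "max 1 c"] by (intro power_increasing) auto
        finally show "(real (h ^ n * n) * c) ^ card J \<le> D" .
        show "(\<Prod>i = 1..card J. succ_min n \<Lambda> i) \<le> (\<Prod>k\<in>J. enorm n (b k))"
          by (rule prod_succ_min_le[OF b J])
      qed (use D sm[OF cJ] in auto)
      finally have "real ((h ^ n * n) ^ card J) * (\<Prod>k\<in>J. c / enorm n (b k)) * proj_vol n (card J) Z \<le>
          D / (\<Prod>i = 1..card J. succ_min n \<Lambda> i) * proj_vol n (card J) Z"
        using pv by (intro mult_right_mono)
      then show "real ((h ^ n * n) ^ card J) * (\<Prod>k\<in>J. c / enorm n (b k)) * proj_vol n (card J) Z \<le> D * g (card J)"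
        by (simp add: g_def)
    qed
    finally show ?thesis .
  qed
  define E where "E = 2 ^ n * (D * (\<Sum>j<n. g j))"
  have gsum: "(\<Sum>j<n. g j) \<ge> 0" using g by (intro sum_nonneg) auto
  have "(\<Sum>J | J \<subset> {..<n}. leb_vol J p) \<le> ennreal E"
  proof -
    have "(\<Sum>J | J \<subset> {..<n}. leb_vol J p) \<le> (\<Sum>J | J \<subset> {..<n}. ennreal (D * (\<Sum>j<n. g j)))"
    proof (rule sum_mono)
      fix J assume "J \<in> {J. J \<subset> {..<n}}"
      then have J: "J \<subseteq> {..<n}" "card J < n" using psubset_card_mono[of "{..<n}" J] by auto
      then have "g (card J) \<le> (\<Sum>j<n. g j)" using g by (intro member_le_sum) auto
      then have "ennreal (D * g (card J)) \<le> ennreal (D * (\<Sum>j<n. g j))"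
        using D by (intro ennreal_leI mult_left_mono)
      then show "leb_vol J p \<le> ennreal (D * (\<Sum>j<n. g j))" using leb_vol_bound[OF J(1)] by (rule order_trans[rotated])
    qed
    also have "\<dots> \<le> (\<Sum>J\<in>Pow {..<n}. ennreal (D * (\<Sum>j<n. g j)))" by (intro sum_mono2) auto
    also have "\<dots> = of_nat (2 ^ n) * ennreal (D * (\<Sum>j<n. g j))" by (simp add: card_Pow)
    also have "\<dots> = ennreal E"
      using D gsum unfolding E_def by (simp add: ennreal_mult ennreal_of_nat_eq_real_of_nat flip: ennreal_power)
    finally show ?thesis .
  qed
  then have err: "of_nat (card {..<n}) * (of_nat (h * (1 + h) ^ n) * (\<Sum>J | J \<subset> {..<n}. leb_vol J p)) \<le>
      ennreal (real n * (real (h * (1 + h) ^ n) * E))"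
    using D gsum
    by (simp add: ennreal_mult E_def ennreal_of_nat_eq_real_of_nat[symmetric] mult_left_mono
        flip: of_nat_mult of_nat_power)
  obtain R where R: "\<And>z l. z \<in> Z \<Longrightarrow> l < n \<Longrightarrow> \<bar>z l\<bar> \<le> R" using bdd by blast
  define R' where "R' = (\<Sum>k<n. \<Sum>l<n. \<bar>p k l\<bar> * R)"
  have Ybdd: "\<bar>y i\<bar> \<le> R'" if y: "y \<in> Y" and i: "i < n" for y i
  proof -
    obtain z where z: "z \<in> Z" "y = lmap n p z" using y Y by blast
    have R0: "R \<ge> 0" using R[OF z(1) i] by linarith
    have "\<bar>y i\<bar> \<le> (\<Sum>l<n. \<bar>p i l\<bar> * R)" unfolding z(2) lmap_def using i
      by (simp, intro order_trans[OF sum_abs] sum_mono) (auto simp: abs_mult intro!: mult_left_mono R z)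
    also have "\<dots> \<le> R'"
      unfolding R'_def using i R0 by (intro member_le_sum[of i _ "\<lambda>k. \<Sum>l<n. \<bar>p k l\<bar> * R"]) (auto intro!: sum_nonneg)
    finally show ?thesis .
  qed
  have "Y \<in> sets (Pi\<^sub>M {..<n} (\<lambda>_. borel))" unfolding Y_def by (rule meas) simp
  then have "mixed_vol {..<n} {..<n} p = of_nat (card {y\<in>Y. \<forall>i<n. y i \<in> \<int>})" 
    unfolding mixed_vol_def Y_def[symmetric] by (rule emeasure_int_points(2)) (rule Ybdd)
  also have "card {y\<in>Y. \<forall>i<n. y i \<in> \<int>} = card (Z \<inter> \<Lambda>)"
  proof (rule bij_betw_same_card[of "lmap n ?B"], rule bij_betwI[where g = "lmap n p"])
    have "lmap n ?B y \<in> Z \<inter> \<Lambda>" if y: "y \<in> Y" "\<forall>i<n. y i \<in> \<int>" for y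
    proof
      show "lmap n ?B y \<in> Z" using y(1) Bp Z unfolding Y by auto
      have "\<forall>i. \<exists>z::int. i < n \<longrightarrow> y i = of_int z" using y(2) by (auto elim: Ints_cases)
      then obtain z :: "nat \<Rightarrow> int" where z: "\<And>i. i < n \<Longrightarrow> y i = of_int (z i)" by metis
      have "lmap n ?B y = (\<lambda>l\<in>{..<n}. \<Sum>i<n. of_int (z i) * b i l)"
        unfolding lmap_def by (intro restrict_ext sum.cong) (auto simp: z)
      then show "lmap n ?B y \<in> \<Lambda>" unfolding lattice_basis_mem_iff[OF b] by blast
    qed
    then show "lmap n ?B \<in> {y\<in>Y. \<forall>i<n. y i \<in> \<int>} \<rightarrow> Z \<inter> \<Lambda>" by blast
    show "lmap n p \<in> Z \<inter> \<Lambda> \<rightarrow> {y\<in>Y. \<forall>i<n. y i \<in> \<int>}"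
    proof
      fix x assume x: "x \<in> Z \<inter> \<Lambda>"
      then have "x \<in> \<Lambda>" by blast
      then obtain z :: "nat \<Rightarrow> int" where z: "x = (\<lambda>l\<in>{..<n}. \<Sum>i<n. of_int (z i) * b i l)"
        unfolding lattice_basis_mem_iff[OF b] by blast
      define y where "y = (\<lambda>i\<in>{..<n}. real_of_int (z i))"
      have "x = lmap n ?B y" unfolding z lmap_def y_def by (intro restrict_ext sum.cong) auto
      moreover have "y \<in> Rn n" by (simp add: y_def Rn_def)
      ultimately have "lmap n p x = y" using pB by simp
      moreover have "lmap n p x \<in> Y" using x unfolding Y by blast
      ultimately show "lmap n p x \<in> {y\<in>Y. \<forall>i<n. y i \<in> \<int>}" by (simp add: y_def)
    qed
    show "lmap n p (lmap n ?B y) = y" if "y \<in> {y\<in>Y. \<forall>i<n. y i \<in> \<int>}" for y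
      using that lm pB unfolding Y by auto
    show "lmap n ?B (lmap n p x) = x" if "x \<in> Z \<inter> \<Lambda>" for x using Bp that Z by blast
  qed
  finally have count: "mixed_vol {..<n} {..<n} p = ennreal (real (card (Z \<inter> \<Lambda>)))"
    by (simp add: ennreal_of_nat_eq_real_of_nat)
  have sp: "space (lebn n) = Rn n" by (simp add: space_PiM Rn_def)
  have "X {..<n} unit_row = Z"
  proof -
    have "restrict x {..<n} = x" if "x \<in> Z" for x
      using that Z by (auto simp: Rn_def PiE_def extensional_def restrict_def subset_iff fun_eq_iff)
    then show ?thesis using restrict_image[of "{..<n}"] by simp
  qed
  then have Zm: "Z \<in> sets (lebn n)" and Zv: "emeasure (lebn n) Z = ennreal (vol n Z)"
    using meas_mixed[of "{..<n}" unit_row "{}"] measure_linear_image[of "{..<n}" unit_row]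
    by (simp_all add: mixed_empty mixed_vol_def vol_def)
  \<comment> \<open>As \<open>Y\<close> is the preimage of \<open>Z\<close> under the basis matrix,
    the transformation formula identifies the volume of \<open>Y\<close> with the main term.\<close>
  have "lmap n ?B -` Z \<inter> space (lebn n) = Y"
    unfolding sp Y using Bp pB lm Z by (auto simp: image_iff) (metis)
  then have volZ: "ennreal (vol n Z) = ennreal (lattice_det n \<Lambda>) * leb_vol {..<n} p"
    using emeasure_lmap_vimage[OF fdet_lattice_basis(2)[OF b] Zm] fdet_lattice_basis(1)[OF b] Zv
    by (simp add: mixed_vol_def mixed_empty Y_def)
  define V where "V = measure (lebesgue_on_coords {..<n}) Y"
  have lamV: "leb_vol {..<n} p = ennreal V" unfolding V_def Y_def by (rule measure_linear_image) simp
  have det: "lattice_det n \<Lambda> > 0" using fdet_lattice_basis[OF b] by simp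
  have V0: "V \<ge> 0" by (simp add: V_def)
  have "ennreal (vol n Z) = ennreal (lattice_det n \<Lambda> * V)"
    using volZ lamV det V0 by (simp add: ennreal_mult)
  then have "vol n Z = lattice_det n \<Lambda> * V"
    using det V0 by (subst (asm) ennreal_inj) (simp_all add: vol_def)
  then have V: "V = vol n Z / lattice_det n \<Lambda>" using det by (simp add: field_simps)
  have "\<bar>real (card (Z \<inter> \<Lambda>)) - V\<bar> \<le> real n * (real (h * (1 + h) ^ n) * E)"
  proof (rule abs_diff_le_of_ennreal)
    note close = mixed_vol_close_to_leb_vol[of "{..<n}" "{..<n}" p, OF finite_lessThan order_refl order_refl, unfolded count lamV]
    show "ennreal (real (card (Z \<inter> \<Lambda>))) \<le> ennreal V + ennreal (real n * (real (h * (1 + h) ^ n) * E))"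
      using close(1) add_left_mono[OF err] by (rule order_trans)
    show "ennreal V \<le> ennreal (real (card (Z \<inter> \<Lambda>))) + ennreal (real n * (real (h * (1 + h) ^ n) * E))"
      using close(2) add_left_mono[OF err] by (rule order_trans)
    show "0 \<le> real n * (real (h * (1 + h) ^ n) * E)" using D gsum by (simp add: E_def)
  qed (use V0 in auto)
  then show ?thesis unfolding V E_def D_def g_def by (simp add: mult_ac)
qed

end

theorem theorem1p3:
  fixes S :: "nat \<Rightarrow> (nat \<Rightarrow> real) set set" and m n :: nat and Z :: "(nat \<Rightarrow> real) set"
  assumes "o_minimal S"
    and "\<And>k A. k \<ge> 1 \<Longrightarrow> semialgebraic k A \<Longrightarrow> A \<in> S k"
    and "m \<ge> 1" and "n \<ge> 1"
    and "Z \<in> S (m + n)"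
    and "\<And>T. T \<in> Rn m \<Longrightarrow> bounded_in n (fiber m n Z T)"
  shows "\<exists>c :: real. \<forall>T \<in> Rn m. \<forall>\<Lambda>. full_lattice n \<Lambda> \<longrightarrow>
    \<bar>real (card (fiber m n Z T \<inter> \<Lambda>)) - vol n (fiber m n Z T) / lattice_det n \<Lambda>\<bar>
      \<le> c * (\<Sum>j<n. proj_vol n j (fiber m n Z T) / (\<Prod>i = 1..j. succ_min n \<Lambda> i))"
proof -
  interpret o_minimal_semialgebraic S
    using assms(1,2) by (simp add: o_minimal_semialgebraic_def o_minimal_semialgebraic_axioms_def)
  obtain h where h: "\<And>T I i p w. insert i I \<subseteq> {..<n} \<Longrightarrow> i \<notin> I \<Longrightarrow> w \<in> extensional I \<Longrightarrow>
     interval_union h {t. w(i := t) \<in> linear_image n (fiber m n Z T) (insert i I) p}"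
    using uniform_slices[OF assms(5,3)] by blast
  obtain c where c: "c \<ge> 0" "\<And>\<Lambda>. full_lattice n \<Lambda> \<Longrightarrow> \<exists>b. lattice_basis n b \<Lambda> \<and>
     (\<forall>y. \<forall>i<n. \<bar>y i\<bar> * enorm n (b i) \<le> c * enorm n (comb n b y))"
    using reduced_lattice_basis[of n] by blast
  show ?thesis
  proof (intro exI ballI allI impI)
    fix T \<Lambda> assume T: "T \<in> Rn m" and \<Lambda>: "full_lattice n \<Lambda>"
    interpret sliced_set n h "fiber m n Z T"
    proof
      obtain B where B: "\<And>x. x \<in> fiber m n Z T \<Longrightarrow> enorm n x \<le> B"
        using assms(6)[OF T] unfolding bounded_in_def by blast
      have "\<bar>z l\<bar> \<le> B" if "z \<in> fiber m n Z T" "l < n" for z l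
        using member_le_L2_set[of "{..<n}" l "\<lambda>i. \<bar>z i\<bar>"] B[OF that(1)] that(2)
        by (simp add: enorm_def L2_set_def)
      then show "\<exists>R. \<forall>z\<in>fiber m n Z T. \<forall>l<n. \<bar>z l\<bar> \<le> R" by blast
    qed (use linear_image_fiber_measurable[OF assms(5,3)] h in auto)
    obtain b where b: "lattice_basis n b \<Lambda>"
      "\<And>y i. i < n \<Longrightarrow> \<bar>y i\<bar> * enorm n (b i) \<le> c * enorm n (comb n b y)"
      using c(2)[OF \<Lambda>] by blast
    have "fiber m n Z T \<subseteq> Rn n" by (auto simp: fiber_def)
    \<comment> \<open>The witness left open by \<open>exI\<close> is fixed here; it involves only
      \<open>n\<close>, \<open>h\<close> and \<open>c\<close>, all obtained before \<open>T\<close>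
      and \<open>\<Lambda>\<close>.\<close>
    from count_estimate[OF this b(1) c(1) b(2)]
    show "\<bar>real (card (fiber m n Z T \<inter> \<Lambda>)) - vol n (fiber m n Z T) / lattice_det n \<Lambda>\<bar> \<le>
      real n * real (h * (1 + h) ^ n) * 2 ^ n * (max 1 (real (h ^ n * n)) * max 1 c) ^ n *
      (\<Sum>j<n. proj_vol n j (fiber m n Z T) / (\<Prod>i = 1..j. succ_min n \<Lambda> i))" .
  qed
qed

end
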